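(* There is a fully polynomial-time approximation scheme for the parametric knapsack problem (as defined in the context) running in strongly polynomial time $\mathcal{O}(n^4/\varepsilon^2)$; that is, there is an algorithm that, given an instance with $n$ items and any $\varepsilon\in(0,1)$, in $\mathcal{O}(n^4/\varepsilon^2)$ time outputs a partition of $\mathbb{R}$ into finitely many intervals together with, for each interval $I$, a feasible solution $x^I\in\{0,1\}^n$ such that $\sum_{i=1}^n (a_i+\lambda b_i)x^I_i\ge(1-\varepsilon)\,p^*(\lambda)$ for all $\lambda\in I$.
   Context: Parametric knapsack problem: given a capacity $W$ and $n$ items, item $i$ having weight $w_i\in\mathbb{N}_{>0}$ (with $w_i\le W$) and affine profit $p_i(\lambda)=a_i+\lambda b_i$ with $a_i,b_i\in\mathbb{Z}$ arbitrary (possibly negative), define for every $\lambda\in\mathbb{R}$ the optimal profit $p^*(\lambda)=\max\{\sum_{i=1}^n(a_i+\lambda b_i)x_i:\ \sum_{i=1}^n w_ix_i\le W,\ x\in\{0,1\}^n\}$. A solution to the problem consists of a partition of the real line into intervals together with a feasible solution $x\in\{0,1\}^n$ (i.e. $\sum_i w_ix_i\le W$) for each interval. An FPTAS must, for every $\varepsilon\in(0,1)$, provide for every $\lambda$ a feasible solution of profit at least $(1-\varepsilon)p^*(\lambda)$, in time polynomial in $n$ and $1/\varepsilon$. "Strongly polynomial" means the number of arithmetic operations is bounded by a polynomial in $n$ and $1/\varepsilon$ independent of the magnitudes of the numbers in the input. *)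

theory Defs
  imports "HOL-Analysis.Analysis"
begin

section \<open>The parametric knapsack problem\<close>

text \<open>Items are indexed by \<open>0, \<dots>, n - 1\<close>; only the values of \<open>weight\<close>, \<open>icpt\<close> and
  \<open>slope\<close> below \<open>items\<close> are part of the instance.\<close>

record knapsack =
  items :: nat
  capacity :: nat
  weight :: "nat \<Rightarrow> nat"
  icpt :: "nat \<Rightarrow> int"
  slope :: "nat \<Rightarrow> int"

definition knapsack_instance :: "knapsack \<Rightarrow> bool" where
  "knapsack_instance P \<longleftrightarrow> (\<forall>i<items P. 0 < weight P i \<and> weight P i \<le> capacity P)"

definition feasible :: "knapsack \<Rightarrow> (nat \<Rightarrow> nat) set" where
  "feasible P = {x \<in> {..<items P} \<rightarrow>\<^sub>E {0, 1}. (\<Sum>i<items P. weight P i * x i) \<le> capacity P}"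

definition profit :: "knapsack \<Rightarrow> real \<Rightarrow> (nat \<Rightarrow> nat) \<Rightarrow> real" where
  "profit P l x = (\<Sum>i<items P. (real_of_int (icpt P i) + l * real_of_int (slope P i)) * real (x i))"

definition opt_profit :: "knapsack \<Rightarrow> real \<Rightarrow> real" where
  "opt_profit P l = Max (profit P l ` feasible P)"

lemma finite_feasible: "finite (feasible P)"
proof (rule finite_subset)
  show "feasible P \<subseteq> {..<items P} \<rightarrow>\<^sub>E {0, 1}"
    by (auto simp: feasible_def)
  show "finite ({..<items P} \<rightarrow>\<^sub>E {0, 1::nat})"
    by (intro finite_PiE) auto
qed

lemma feasible_nonempty: "feasible P \<noteq> {}"
proof -
  have "restrict (\<lambda>_. 0) {..<items P} \<in> feasible P"
    by (auto simp: feasible_def)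
  then show ?thesis
    by blast
qed

text \<open>A solution is a finite set of pairs of an interval and its knapsack solution; the
  intervals form a partition of the real line, and \<open>inj_on fst\<close> says that every interval
  carries exactly one knapsack solution.\<close>

definition approx_solution :: "knapsack \<Rightarrow> real \<Rightarrow> (real set \<times> (nat \<Rightarrow> nat)) set \<Rightarrow> bool" where
  "approx_solution P \<epsilon> S \<longleftrightarrow>
     finite S \<and> inj_on fst S \<and> partition_on UNIV (fst ` S) \<and>
     (\<forall>(I, x)\<in>S. is_interval I \<and> x \<in> feasible P \<and>
        (\<forall>l\<in>I. profit P l x \<ge> (1 - \<epsilon>) * opt_profit P l))"

section \<open>The machine model\<close>

text \<open>
  A real RAM, programmed in a structured language. The memory consists of named, unbounded
  arrays of natural numbers (used for addresses, counters and bits) and of real numbers; a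
  scalar is an array used at index 0 only. Every array admits indirect addressing. All
  operations have unit cost: on naturals addition, truncated subtraction and comparison, on reals
  the four exact arithmetic operations and comparison. There is no rounding, no conversion
  between the two sorts, and the only real constants are integers, so neither digit
  manipulation on numbers nor information hidden in constants is available for free.
  Division by zero yields zero, as everywhere in HOL.
\<close>

record ram =
  nmem :: "string \<Rightarrow> nat \<Rightarrow> nat"
  rmem :: "string \<Rightarrow> nat \<Rightarrow> real"

datatype nexp =
    NConst nat
  | NGet string nexp
  | NAdd nexp nexp
  | NSub nexp nexp

datatype rexp =
    RConst int
  | RGet string nexp
  | RAdd rexp rexp
  | RSub rexp rexp
  | RMul rexp rexp
  | RDiv rexp rexp

datatype bexp =
    NLess nexp nexp
  | RLess rexp rexp
  | Neg bexp
  | Conj bexp bexp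

datatype com =
    Skip
  | NSet string nexp nexp
  | RSet string nexp rexp
  | Seq com com
  | Cond bexp com com
  | While bexp com

fun nval :: "nexp \<Rightarrow> ram \<Rightarrow> nat" where
  "nval (NConst k) s = k"
| "nval (NGet X e) s = nmem s X (nval e s)"
| "nval (NAdd e f) s = nval e s + nval f s"
| "nval (NSub e f) s = nval e s - nval f s"

fun rval :: "rexp \<Rightarrow> ram \<Rightarrow> real" where
  "rval (RConst k) s = real_of_int k"
| "rval (RGet X e) s = rmem s X (nval e s)"
| "rval (RAdd e f) s = rval e s + rval f s"
| "rval (RSub e f) s = rval e s - rval f s"
| "rval (RMul e f) s = rval e s * rval f s"
| "rval (RDiv e f) s = rval e s / rval f s"

fun bval :: "bexp \<Rightarrow> ram \<Rightarrow> bool" where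
  "bval (NLess e f) s \<longleftrightarrow> nval e s < nval f s"
| "bval (RLess e f) s \<longleftrightarrow> rval e s < rval f s"
| "bval (Neg b) s \<longleftrightarrow> \<not> bval b s"
| "bval (Conj b d) s \<longleftrightarrow> bval b s \<and> bval d s"

fun ncost :: "nexp \<Rightarrow> nat" where
  "ncost (NConst k) = 1"
| "ncost (NGet X e) = 1 + ncost e"
| "ncost (NAdd e f) = 1 + ncost e + ncost f"
| "ncost (NSub e f) = 1 + ncost e + ncost f"

fun rcost :: "rexp \<Rightarrow> nat" where
  "rcost (RConst k) = 1"
| "rcost (RGet X e) = 1 + ncost e"
| "rcost (RAdd e f) = 1 + rcost e + rcost f"
| "rcost (RSub e f) = 1 + rcost e + rcost f"
| "rcost (RMul e f) = 1 + rcost e + rcost f"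
| "rcost (RDiv e f) = 1 + rcost e + rcost f"

fun bcost :: "bexp \<Rightarrow> nat" where
  "bcost (NLess e f) = 1 + ncost e + ncost f"
| "bcost (RLess e f) = 1 + rcost e + rcost f"
| "bcost (Neg b) = 1 + bcost b"
| "bcost (Conj b d) = 1 + bcost b + bcost d"

text \<open>\<open>exec c s t s'\<close>: started in \<open>s\<close>, program \<open>c\<close> terminates in \<open>s'\<close> after \<open>t\<close> operations.\<close>

inductive exec :: "com \<Rightarrow> ram \<Rightarrow> nat \<Rightarrow> ram \<Rightarrow> bool" where
  exec_Skip: "exec Skip s 1 s"
| exec_NSet: "exec (NSet X e f) s (1 + ncost e + ncost f)
    (s\<lparr>nmem := (nmem s)(X := (nmem s X)(nval e s := nval f s))\<rparr>)"
| exec_RSet: "exec (RSet X e f) s (1 + ncost e + rcost f)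
    (s\<lparr>rmem := (rmem s)(X := (rmem s X)(nval e s := rval f s))\<rparr>)"
| exec_Seq: "exec c s t s' \<Longrightarrow> exec d s' u s'' \<Longrightarrow> exec (Seq c d) s (t + u) s''"
| exec_CondT: "bval b s \<Longrightarrow> exec c s t s' \<Longrightarrow> exec (Cond b c d) s (1 + bcost b + t) s'"
| exec_CondF: "\<not> bval b s \<Longrightarrow> exec d s t s' \<Longrightarrow> exec (Cond b c d) s (1 + bcost b + t) s'"
| exec_WhileF: "\<not> bval b s \<Longrightarrow> exec (While b c) s (1 + bcost b) s"
| exec_WhileT: "bval b s \<Longrightarrow> exec c s t s' \<Longrightarrow> exec (While b c) s' u s'' \<Longrightarrow>
    exec (While b c) s (1 + bcost b + t + u) s''"

inductive_cases exec_SkipE: "exec Skip s t s'"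
inductive_cases exec_NSetE: "exec (NSet X e f) s t s'"
inductive_cases exec_RSetE: "exec (RSet X e f) s t s'"
inductive_cases exec_SeqE: "exec (Seq c d) s t s'"
inductive_cases exec_CondE: "exec (Cond b c d) s t s'"
inductive_cases exec_WhileE: "exec (While b c) s t s'"

lemma exec_deterministic:
  "exec c s t s' \<Longrightarrow> exec c s u s'' \<Longrightarrow> u = t \<and> s'' = s'"
proof (induction arbitrary: u s'' rule: exec.induct)
  case (exec_Skip s)
  from exec_Skip.prems show ?case by (rule exec_SkipE) simp
next
  case (exec_NSet X e f s)
  from exec_NSet.prems show ?case by (rule exec_NSetE) simp
next
  case (exec_RSet X e f s)
  from exec_RSet.prems show ?case by (rule exec_RSetE) simp
next
  case (exec_Seq c s t s' d v r)
  from exec_Seq.prems show ?case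
  proof (rule exec_SeqE)
    fix t1 s1 t2
    assume u: "u = t1 + t2" and 1: "exec c s t1 s1" and 2: "exec d s1 t2 s''"
    from exec_Seq.IH(1)[OF 1] 2 have "t1 = t" "exec d s' t2 s''" by simp_all
    with exec_Seq.IH(2) u show ?thesis by blast
  qed
next
  case (exec_CondT b s c t s' d)
  from exec_CondT.prems show ?case
    by (rule exec_CondE) (use exec_CondT.hyps exec_CondT.IH in fastforce)+
next
  case (exec_CondF b s d t s' c)
  from exec_CondF.prems show ?case
    by (rule exec_CondE) (use exec_CondF.hyps exec_CondF.IH in fastforce)+
next
  case (exec_WhileF b s c)
  from exec_WhileF.prems show ?case
    by (rule exec_WhileE) (use exec_WhileF.hyps in simp_all)
next
  case (exec_WhileT b s c t s' v r)
  from exec_WhileT.prems show ?case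
  proof (rule exec_WhileE)
    assume "\<not> bval b s"
    with exec_WhileT.hyps show ?thesis by simp
  next
    fix t1 s1 t2
    assume u: "u = Suc (bcost b + t1 + t2)" and 1: "exec c s t1 s1"
      and 2: "exec (While b c) s1 t2 s''"
    from exec_WhileT.IH(1)[OF 1] 2 have "t1 = t" "exec (While b c) s' t2 s''" by simp_all
    with exec_WhileT.IH(2) u show ?thesis by fastforce
  qed
qed

section \<open>Input and output conventions\<close>

definition input_state :: "knapsack \<Rightarrow> real \<Rightarrow> ram" where
  "input_state P \<epsilon> =
     \<lparr>nmem = (\<lambda>_ _. 0)(''n'' := (\<lambda>_. 0)(0 := items P)),
      rmem = (\<lambda>_ _. 0)
        (''eps'' := (\<lambda>_. 0)(0 := \<epsilon>),
         ''W'' := (\<lambda>_. 0)(0 := real (capacity P)),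
         ''w'' := (\<lambda>i. if i < items P then real (weight P i) else 0),
         ''a'' := (\<lambda>i. if i < items P then real_of_int (icpt P i) else 0),
         ''b'' := (\<lambda>i. if i < items P then real_of_int (slope P i) else 0))\<rparr>"

text \<open>The output consists of a number \<open>k\<close> of breakpoints, the breakpoints
  \<open>t 0, \<dots>, t (k - 1)\<close>, and the solutions of the \<open>k + 1\<close> intervals
  \<open>(-\<infinity>, t 0], (t 0, t 1], \<dots>, (t (k - 1), \<infinity>)\<close>, stored consecutively in the array \<open>x\<close>,
  with \<open>n\<close> entries for each interval.\<close>

definition output_interval :: "ram \<Rightarrow> nat \<Rightarrow> real set" where
  "output_interval s j =
     {l. (0 < j \<longrightarrow> rmem s ''t'' (j - 1) < l) \<and> (j < nmem s ''k'' 0 \<longrightarrow> l \<le> rmem s ''t'' j)}"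

definition output_solution :: "knapsack \<Rightarrow> ram \<Rightarrow> (real set \<times> (nat \<Rightarrow> nat)) set" where
  "output_solution P s =
     (\<lambda>j. (output_interval s j, \<lambda>i\<in>{..<items P}. nmem s ''x'' (j * items P + i))) ` {..nmem s ''k'' 0}"

end

theory Submission imports Defs begin

text \<open>
  Put \<open>\<lambda> = s / (1 - \<bar>s\<bar>)\<close> with \<open>s \<in> [-1, 1]\<close>: after scaling by \<open>1 - \<bar>s\<bar>\<close>, every profit is affine in
  \<open>s\<close> on each of the halves \<open>[-1, 0]\<close> and \<open>[0, 1]\<close>. Let \<open>U s\<close> be the optimum of the LP relaxation,
  so that \<open>p\<^sup>* \<le> U \<le> 2 p\<^sup>*\<close>, and round the profit of item \<open>i\<close> down to a multiple \<open>k\<close> of \<open>U / m\<close> with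
  \<open>m \<approx> 2 n / \<epsilon>\<close>. A dynamic program over the rounded profits, which sum up to at most \<open>m\<close>, takes
  \<open>O(n m)\<close> steps and loses at most \<open>n U / m \<le> \<epsilon> p\<^sup>*\<close>.

  It remains to bound the number of values of \<open>s\<close> at which a rounded profit changes. As a maximum of
  affine functions \<open>U\<close> is convex, so \<open>m p\<^sub>i - k U\<close> is concave and changes its sign at most twice on
  each half; over all \<open>i\<close> and \<open>k \<le> m\<close> this gives \<open>O(n m)\<close> events. The events are found by sweeping
  \<open>s\<close> from left to right. Between two of the \<open>O(n\<^sup>2)\<close> points where the order of the ratios
  \<open>p\<^sub>i / w\<^sub>i\<close> changes, \<open>U\<close> is affine, hence known from its values at two points, and the next event is
  found by linear interpolation. With \<open>O(n\<^sup>2 + n m)\<close> events at a cost of \<open>O(n\<^sup>2 + n m)\<close> each,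
  the total is \<open>O(n\<^sup>4 / \<epsilon>\<^sup>2)\<close>.
\<close>

section \<open>The linear relaxation\<close>

text \<open>Rounding relative to \<open>opt_profit\<close> would be circular; \<open>U\<close> needs
  only n + 1 dual values and has explicit breakpoints. The substitution turns both unbounded rays
  into ordinary cells, as -1 and 1 are the images of the two infinities, and the positive factor
  does not affect relative errors. The obstacle is ties. The machine has no floor operation and
  \<open>U\<close> may vanish, so nothing is divided by \<open>U\<close>: item i reaches level k iff
  \<open>level_diff\<close> is nonnegative. This function may vanish at the ends of a cell or on a
  whole segment. Hence only strict sign changes count as events, rounded profits are read off at the
  midpoint of a cell, and affinity carries the signs found there to the closed cell. The number of
  steps is bounded by a set \<open>events\<close> fixed independently of the run: each step stops at
  a member of it strictly to the right of the previous stop. In the condition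
  \<open>2 * n \<le> \<epsilon> * m\<close>, n accounts for one lost unit \<open>U / m\<close> per
  item and 2 for \<open>U\<close> exceeding the optimum; the least such m is O(n /
  \<epsilon>).\<close>

text \<open>The LP dual is the minimum of \<open>dual_obj\<close> over all \<open>\<mu> \<ge> 0\<close>. It is attained at a ratio of profit to
  weight or at 0; the latter is the ratio of a dummy item \<open>n\<close> of profit 0.\<close>

definition dual_obj :: "nat \<Rightarrow> real \<Rightarrow> (nat \<Rightarrow> real) \<Rightarrow> (nat \<Rightarrow> real) \<Rightarrow> real \<Rightarrow> real" where
  "dual_obj n W w p \<mu> = \<mu> * W + (\<Sum>i<n. max 0 (p i - \<mu> * w i))"

definition ratio :: "(nat \<Rightarrow> real) \<Rightarrow> (nat \<Rightarrow> real) \<Rightarrow> nat \<Rightarrow> real" where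
  "ratio w p j = max 0 (p j / w j)"

definition lp_bound :: "nat \<Rightarrow> real \<Rightarrow> (nat \<Rightarrow> real) \<Rightarrow> (nat \<Rightarrow> real) \<Rightarrow> real" where
  "lp_bound n W w p = Min ((\<lambda>j. dual_obj n W w p (ratio w p j)) ` {..n})"

lemma lp_bound_le: "j \<le> n \<Longrightarrow> lp_bound n W w p \<le> dual_obj n W w p (ratio w p j)"
  unfolding lp_bound_def by (intro Min_le) auto

lemma lp_bound_attained: "\<exists>j\<le>n. lp_bound n W w p = dual_obj n W w p (ratio w p j)"
proof -
  have "lp_bound n W w p \<in> (\<lambda>j. dual_obj n W w p (ratio w p j)) ` {..n}"
    unfolding lp_bound_def by (intro Min_in) auto
  then show ?thesis by auto
qed

lemma lp_bound_eqI:
  assumes "\<And>j. j \<le> n \<Longrightarrow> u \<le> dual_obj n W w p (ratio w p j)"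
    and "\<exists>j\<le>n. u = dual_obj n W w p (ratio w p j)"
  shows "lp_bound n W w p = u"
  using assms lp_bound_le lp_bound_attained by (metis order_antisym)

text \<open>Lagrangian relaxation: once the capacity is priced at \<open>\<mu>\<close>, each reduced
  profit times \<open>x i\<close> is at most its positive part.\<close>

lemma weak_duality:
  assumes x: "\<And>i. i < n \<Longrightarrow> 0 \<le> x i \<and> x i \<le> 1"
    and wx: "(\<Sum>i<n. w i * x i) \<le> W" and mu: "0 \<le> \<mu>"
  shows "(\<Sum>i<n. p i * x i) \<le> dual_obj n W w p \<mu>"
proof -
  have "(\<Sum>i<n. p i * x i) = \<mu> * (\<Sum>i<n. w i * x i) + (\<Sum>i<n. (p i - \<mu> * w i) * x i)"
    by (simp add: sum_distrib_left flip: sum.distrib) (simp add: algebra_simps)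
  also have "\<dots> \<le> \<mu> * W + (\<Sum>i<n. max 0 (p i - \<mu> * w i))"
  proof (intro add_mono sum_mono)
    show "\<mu> * (\<Sum>i<n. w i * x i) \<le> \<mu> * W" using wx mu by (rule mult_left_mono)
    fix i assume "i \<in> {..<n}"
    then have "0 \<le> x i" "x i \<le> 1" using x by auto
    then show "(p i - \<mu> * w i) * x i \<le> max 0 (p i - \<mu> * w i)"
      by (cases "0 \<le> p i - \<mu> * w i") (auto simp: mult_left_le mult_nonpos_nonneg max_def)
  qed
  finally show ?thesis by (simp add: dual_obj_def)
qed

lemma lp_bound_ge:
  assumes "\<And>i. i < n \<Longrightarrow> 0 \<le> x i \<and> x i \<le> 1" and "(\<Sum>i<n. w i * x i) \<le> W"
  shows "(\<Sum>i<n. p i * x i) \<le> lp_bound n W w p"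
proof -
  obtain j where "lp_bound n W w p = dual_obj n W w p (ratio w p j)"
    using lp_bound_attained by blast
  with weak_duality[OF assms, of "ratio w p j"] show ?thesis by (simp add: ratio_def)
qed

text \<open>If the elements of \<open>T\<close> are added one at a time, some \<open>h\<close> is
  the first to exceed \<open>W\<close>. It becomes the split item, chosen among the items tied at
  the optimal multiplier.\<close>

lemma critical_element:
  fixes w :: "'a \<Rightarrow> real"
  assumes "finite T" "c \<le> W" "W < c + sum w T"
  shows "\<exists>T' h. T' \<subseteq> T \<and> h \<in> T - T' \<and> c + sum w T' \<le> W \<and> W < c + sum w T' + w h"
  using assms
proof (induction T rule: finite_induct)
  case (insert t T)
  show ?case
  proof (cases "W < c + sum w T")
    case True
    with insert.IH insert.prems obtain T' h where
      "T' \<subseteq> T \<and> h \<in> T - T' \<and> c + sum w T' \<le> W \<and> W < c + sum w T' + w h" by blast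
    then show ?thesis by (intro exI[of _ T'] exI[of _ h]) auto
  next
    case False
    then show ?thesis using insert by (intro exI[of _ T] exI[of _ t]) auto
  qed
qed simp

text \<open>The multiplier is the smallest candidate for which the items of strictly larger ratio
  fit. These items, a part of the tied ones and a fraction of one split item \<open>h\<close> attain
  the dual value; \<open>A\<close> is the integral part.\<close>

lemma greedy_fractional_solution:
  assumes w: "\<And>i. i \<le> n \<Longrightarrow> 0 < w i" and W: "0 \<le> W" and pn: "p n = 0"
  shows "\<exists>x A. (\<forall>i<n. 0 \<le> x i \<and> x i \<le> 1) \<and> (\<Sum>i<n. w i * x i) \<le> W \<and>
    lp_bound n W w p = (\<Sum>i<n. p i * x i) \<and> A \<subseteq> {..<n} \<and> sum w A \<le> W \<and>
    (lp_bound n W w p \<le> sum p A \<or> (\<exists>h<n. lp_bound n W w p \<le> sum p A + p h))"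
proof -
  define S where "S \<mu> = {i. i < n \<and> \<mu> * w i < p i}" for \<mu>
  define C where "C = ratio w p ` {..n}"
  define Good where "Good = {\<mu> \<in> C. sum w (S \<mu>) \<le> W}"
  have C: "finite C" "C \<noteq> {}" by (auto simp: C_def)
  have C0: "\<And>c. c \<in> C \<Longrightarrow> 0 \<le> c" by (auto simp: C_def ratio_def)
  have zero: "0 \<in> C" using w[of n] pn by (force simp: C_def ratio_def)
  have rC: "\<And>i. i < n \<Longrightarrow> ratio w p i \<in> C" by (auto simp: C_def)
  have "S (Max C) = {}"
  proof -
    have False if "i \<in> S (Max C)" for i
    proof -
      from that have i: "i < n" "Max C * w i < p i" by (auto simp: S_def)
      then have "Max C < p i / w i" using w[of i] by (simp add: field_simps)
      also have "\<dots> \<le> ratio w p i" by (simp add: ratio_def)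
      also have "\<dots> \<le> Max C" using C rC i by simp
      finally show False by simp
    qed
    then show ?thesis by blast
  qed
  then have "Max C \<in> Good" using C W by (auto simp: Good_def)
  then have Good: "Good \<noteq> {}" by blast
  have "finite Good" using C(1) by (simp add: Good_def)
  note Good = this Good
  define \<mu> where "\<mu> = Min Good"
  have "\<mu> \<in> Good" unfolding \<mu>_def using Good by (rule Min_in)
  then have muC: "\<mu> \<in> C" and wS: "sum w (S \<mu>) \<le> W" by (auto simp: Good_def)
  have mu0: "0 \<le> \<mu>" using muC C0 by blast
  obtain j where j: "j \<le> n" "\<mu> = ratio w p j" using muC by (auto simp: C_def)
  have finS: "finite (S \<mu>)" by (simp add: S_def)
  have dual: "dual_obj n W w p \<mu> = \<mu> * W + (sum p (S \<mu>) - \<mu> * sum w (S \<mu>))"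
  proof -
    have "(\<Sum>i<n. max 0 (p i - \<mu> * w i)) = (\<Sum>i\<in>S \<mu>. max 0 (p i - \<mu> * w i))"
      by (rule sum.mono_neutral_right) (auto simp: S_def)
    also have "\<dots> = (\<Sum>i\<in>S \<mu>. p i - \<mu> * w i)"
      by (rule sum.cong) (auto simp: S_def)
    finally show ?thesis by (simp add: dual_obj_def sum_subtractf sum_distrib_left)
  qed
  have "\<exists>x A. (\<forall>i<n. 0 \<le> x i \<and> x i \<le> 1) \<and> (\<Sum>i<n. w i * x i) \<le> W \<and>
    dual_obj n W w p \<mu> = (\<Sum>i<n. p i * x i) \<and> A \<subseteq> {..<n} \<and> sum w A \<le> W \<and>
    (dual_obj n W w p \<mu> \<le> sum p A \<or> (\<exists>h<n. dual_obj n W w p \<mu> \<le> sum p A + p h))"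
  proof (cases "\<mu> = 0")
    case True
    have eq: "(\<Sum>i<n. f i * (if i \<in> S \<mu> then 1 else 0)) = sum f (S \<mu>)" for f :: "nat \<Rightarrow> real"
      by (rule sum.mono_neutral_cong_right) (auto simp: S_def)
    have "dual_obj n W w p \<mu> = sum p (S \<mu>)" using dual True by simp
    moreover have "S \<mu> \<subseteq> {..<n}" by (auto simp: S_def)
    ultimately show ?thesis
      by (intro exI[of _ "\<lambda>i. if i \<in> S \<mu> then 1 else 0"] exI[of _ "S \<mu>"])
        (use wS in \<open>auto simp: eq\<close>)
  next
    case False
    define T where "T = {i. i < n \<and> p i = \<mu> * w i}"
    \<comment> \<open>The next smaller candidate is not in \<open>Good\<close>. As no ratio lies
      strictly between the two, the overflow is due to the items of ratio exactly
      \<open>\<mu>\<close>, whose reduced profit is 0.\<close>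
    define \<mu>' where "\<mu>' = Max {c \<in> C. c < \<mu>}"
    have ne: "finite {c \<in> C. c < \<mu>}" "{c \<in> C. c < \<mu>} \<noteq> {}" using C zero False mu0 by auto
    then have mu': "\<mu>' \<in> C" "\<mu>' < \<mu>" using Max_in[OF ne] by (auto simp: \<mu>'_def)
    have "\<mu>' \<notin> Good" using mu' Good by (auto simp: \<mu>_def)
    then have big: "W < sum w (S \<mu>')" using mu' by (auto simp: Good_def)
    have "S \<mu>' \<subseteq> S \<mu> \<union> T"
    proof
      fix i assume "i \<in> S \<mu>'"
      then have i: "i < n" "\<mu>' * w i < p i" by (auto simp: S_def)
      have wi: "0 < w i" using w i by simp
      have "\<mu>' < p i / w i" using wi i by (simp add: field_simps)
      moreover have "0 \<le> \<mu>'" using mu' C0 by blast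
      ultimately have r: "ratio w p i = p i / w i" "\<mu>' < ratio w p i" by (auto simp: ratio_def)
      have "\<not> ratio w p i < \<mu>"
      proof
        assume "ratio w p i < \<mu>"
        then have "ratio w p i \<le> \<mu>'" unfolding \<mu>'_def using ne rC[OF i(1)] by (intro Max_ge) auto
        with r show False by simp
      qed
      then have "\<mu> * w i \<le> p i" using r wi by (simp add: field_simps)
      then show "i \<in> S \<mu> \<union> T" using i by (auto simp: S_def T_def)
    qed
    then have "sum w (S \<mu>') \<le> sum w (S \<mu> \<union> T)"
      by (rule sum_mono2[rotated]) (use w in \<open>auto simp: S_def T_def less_imp_le\<close>)
    also have "\<dots> = sum w (S \<mu>) + sum w T"
      by (rule sum.union_disjoint) (auto simp: S_def T_def)
    finally have "W < sum w (S \<mu>) + sum w T" using big by simp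
    then obtain T' h where T': "T' \<subseteq> T" "h \<in> T - T'" "sum w (S \<mu>) + sum w T' \<le> W"
      "W < sum w (S \<mu>) + sum w T' + w h"
      using critical_element[of T "sum w (S \<mu>)" W w] wS by (auto simp: T_def)
    define A where "A = S \<mu> \<union> T'"
    have finT': "finite T'" using T'(1) by (rule finite_subset) (simp add: T_def)
    have disj: "S \<mu> \<inter> T' = {}" using T'(1) by (auto simp: S_def T_def)
    have sumA: "sum f A = sum f (S \<mu>) + sum f T'" for f :: "nat \<Rightarrow> real"
      unfolding A_def using finS finT' disj by (rule sum.union_disjoint)
    have A: "A \<subseteq> {..<n}" using T'(1) by (auto simp: A_def S_def T_def)
    have h: "h < n" "p h = \<mu> * w h" "h \<notin> A" using T'(2) by (auto simp: T_def A_def S_def)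
    have wh: "0 < w h" using w h by simp
    \<comment> \<open>This fraction of \<open>h\<close> fills the capacity exactly, as complementary
      slackness demands for a positive multiplier.\<close>
    define f where "f = (W - sum w A) / w h"
    have f: "0 \<le> f" "f \<le> 1" using T' wh by (auto simp: f_def sumA field_simps)
    define x where "x i = (if i \<in> A then 1 else if i = h then f else 0)" for i
    have sumx: "(\<Sum>i<n. g i * x i) = sum g A + g h * f" for g :: "nat \<Rightarrow> real"
    proof -
      have "(\<Sum>i<n. g i * x i) = (\<Sum>i\<in>insert h A. g i * x i)"
        by (rule sum.mono_neutral_right) (use A h in \<open>auto simp: x_def\<close>)
      also have "\<dots> = g h * x h + (\<Sum>i\<in>A. g i * x i)"
        using h A by (subst sum.insert) (auto intro: finite_subset)
      also have "(\<Sum>i\<in>A. g i * x i) = sum g A" by (rule sum.cong) (auto simp: x_def)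
      finally show ?thesis using h by (simp add: x_def)
    qed
    have pT: "sum p T' = \<mu> * sum w T'"
      unfolding sum_distrib_left by (rule sum.cong) (use T'(1) in \<open>auto simp: T_def\<close>)
    have whf: "w h * f = W - sum w A" using wh by (simp add: f_def)
    have "dual_obj n W w p \<mu> = sum p A + p h * f"
    proof -
      have "p h * f = \<mu> * (W - sum w A)" using whf h by (simp add: mult.assoc)
      then show ?thesis by (simp add: dual sumA pT algebra_simps)
    qed
    moreover have "p h * f \<le> p h" using f mu0 wh h by (simp add: mult_left_le)
    moreover have "\<forall>i<n. 0 \<le> x i \<and> x i \<le> 1" using f by (simp add: x_def)
    moreover have "sum w A \<le> W" using T'(3) by (simp add: sumA)
    ultimately show ?thesis
      using h A whf unfolding sumx[symmetric]
      by (intro exI[of _ x] exI[of _ A]) (auto simp: sumx intro!: exI[of _ h])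
  qed
  then obtain x A where xA: "\<forall>i<n. 0 \<le> x i \<and> x i \<le> 1" "(\<Sum>i<n. w i * x i) \<le> W"
    "dual_obj n W w p \<mu> = (\<Sum>i<n. p i * x i)" "A \<subseteq> {..<n}" "sum w A \<le> W"
    "dual_obj n W w p \<mu> \<le> sum p A \<or> (\<exists>h<n. dual_obj n W w p \<mu> \<le> sum p A + p h)" by blast
  \<comment> \<open>\<open>x\<close> is feasible for the relaxation and attains the dual value of
    \<open>\<mu>\<close>, so weak duality makes both optimal.\<close>
  have "lp_bound n W w p = dual_obj n W w p \<mu>"
    using lp_bound_le[OF j(1), of W w p] lp_bound_ge[of n x w W p] xA j by (intro order_antisym) auto
  with xA show ?thesis by (intro exI[of _ x] exI[of _ A]) auto
qed

section \<open>Affine functions on a segment, in division-free form, and their sign changes\<close>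

definition interpolated_on :: "real \<Rightarrow> real \<Rightarrow> (real \<Rightarrow> real) \<Rightarrow> bool" where
  "interpolated_on l r f \<longleftrightarrow> (\<forall>y\<in>{l..r}. (r - l) * f y = (r - y) * f l + (y - l) * f r)"

definition one_signed_on :: "real \<Rightarrow> real \<Rightarrow> (real \<Rightarrow> real) \<Rightarrow> bool" where
  "one_signed_on l r f \<longleftrightarrow> (\<forall>y\<in>{l..r}. 0 \<le> f y) \<or> (\<forall>y\<in>{l..r}. f y \<le> 0)"

text \<open>The value \<open>r\<close> stands for the absence of a crossing. A zero at an end point
  does not count, so the sweep cannot get stuck at the point it has just reached.\<close>

definition crossing :: "real \<Rightarrow> real \<Rightarrow> (real \<Rightarrow> real) \<Rightarrow> real" where
  "crossing l r f = (if f l * f r < 0 then l + (r - l) * (f l / (f l - f r)) else r)"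

lemma interpolated_on_add: "interpolated_on l r f \<Longrightarrow> interpolated_on l r g \<Longrightarrow> interpolated_on l r (\<lambda>x. f x + g x)"
  by (simp add: interpolated_on_def distrib_left)

lemma interpolated_on_cmult: "interpolated_on l r f \<Longrightarrow> interpolated_on l r (\<lambda>x. c * f x)"
  unfolding interpolated_on_def
proof
  fix y assume f: "\<forall>y\<in>{l..r}. (r - l) * f y = (r - y) * f l + (y - l) * f r" and "y \<in> {l..r}"
  then have "c * ((r - l) * f y) = c * ((r - y) * f l + (y - l) * f r)" by simp
  then show "(r - l) * (c * f y) = (r - y) * (c * f l) + (y - l) * (c * f r)" by algebra
qed

lemma interpolated_on_diff: "interpolated_on l r f \<Longrightarrow> interpolated_on l r g \<Longrightarrow> interpolated_on l r (\<lambda>x. f x - g x)"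
  using interpolated_on_add[of l r f "\<lambda>x. (-1) * g x"] interpolated_on_cmult[of l r g "-1"] by simp

lemma interpolated_on_zero: "interpolated_on l r (\<lambda>x. 0)"
  by (simp add: interpolated_on_def)

lemma interpolated_on_sum: "(\<And>i. i \<in> A \<Longrightarrow> interpolated_on l r (f i)) \<Longrightarrow> interpolated_on l r (\<lambda>x. \<Sum>i\<in>A. f i x)"
  by (induction A rule: infinite_finite_induct)
     (auto intro: interpolated_on_zero interpolated_on_add)

lemma interpolated_on_affine: "interpolated_on l r (\<lambda>x. c + d * x)"
  unfolding interpolated_on_def by (auto simp: algebra_simps)

lemma interpolated_on_cong:
  "l \<le> r \<Longrightarrow> (\<And>x. x \<in> {l..r} \<Longrightarrow> f x = g x) \<Longrightarrow> interpolated_on l r f \<longleftrightarrow> interpolated_on l r g"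
  by (simp add: interpolated_on_def)

lemma interpolated_on_max_zero:
  assumes "l \<le> r" "interpolated_on l r f" "one_signed_on l r f"
  shows "interpolated_on l r (\<lambda>x. max 0 (f x))"
  using assms(3) unfolding one_signed_on_def
proof
  assume "\<forall>y\<in>{l..r}. 0 \<le> f y"
  then have "interpolated_on l r (\<lambda>x. max 0 (f x)) \<longleftrightarrow> interpolated_on l r f"
    using assms(1) by (intro interpolated_on_cong) auto
  with assms(2) show ?thesis by simp
next
  assume "\<forall>y\<in>{l..r}. f y \<le> 0"
  then have "interpolated_on l r (\<lambda>x. max 0 (f x)) \<longleftrightarrow> interpolated_on l r (\<lambda>x. 0)"
    using assms(1) by (intro interpolated_on_cong) auto
  then show ?thesis by (simp add: interpolated_on_zero)
qed

lemma interpolated_on_subinterval: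
  assumes f: "interpolated_on l r f" and "l \<le> z" "z \<le> r" "l < r"
  shows "interpolated_on l z f"
  unfolding interpolated_on_def
proof
  fix y assume y: "y \<in> {l..z}"
  have 1: "(r - l) * f y = (r - y) * f l + (y - l) * f r"
    and 2: "(r - l) * f z = (r - z) * f l + (z - l) * f r"
    using f y assms by (auto simp: interpolated_on_def)
  have "(r - l) * ((z - l) * f y) = (r - l) * ((z - y) * f l + (y - l) * f z)"
    using 1 2 by algebra
  then show "(z - l) * f y = (z - y) * f l + (y - l) * f z" using assms by simp
qed

lemma crossing_gt: "l < r \<Longrightarrow> l < crossing l r f"
proof -
  assume lr: "l < r"
  { assume "f l * f r < 0"
    then have "0 < f l / (f l - f r)" by (auto simp: mult_less_0_iff zero_less_divide_iff) }
  then show ?thesis using lr mult_pos_pos[of "r - l" "f l / (f l - f r)"]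
    by (auto simp: crossing_def simp del: times_divide_eq_right)
qed

lemma interpolated_on_crossing:
  assumes f: "interpolated_on l r f" and lr: "l < r" and opp: "f l * f r < 0"
  shows "crossing l r f < r" "f (crossing l r f) = 0"
    "\<And>y. y \<in> {l..r} \<Longrightarrow> (r - l) * f y = (y - crossing l r f) * (f r - f l)"
proof -
  let ?z = "crossing l r f"
  have d: "f l - f r \<noteq> 0" using opp by (auto simp: mult_less_0_iff)
  have z: "(?z - l) * (f l - f r) = (r - l) * f l" using opp d by (simp add: crossing_def)
  have "f l / (f l - f r) < 1" using opp by (auto simp: mult_less_0_iff divide_less_eq)
  then show zr: "?z < r"
    using opp lr mult_strict_left_mono[of "f l / (f l - f r)" 1 "r - l"] by (simp add: crossing_def)
  show *: "(r - l) * f y = (y - ?z) * (f r - f l)" if "y \<in> {l..r}" for y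
  proof -
    have "(r - l) * f y = (r - y) * f l + (y - l) * f r" using f that by (auto simp: interpolated_on_def)
    then show ?thesis using z by algebra
  qed
  have "(r - l) * f ?z = 0" using *[of ?z] zr crossing_gt[OF lr, of f] by simp
  then show "f ?z = 0" using lr by simp
qed

text \<open>With end values of opposite signs the function is a constant multiple of the signed
  distance from its zero; otherwise it is a weighted mean of two values of one sign. As
  \<open>z\<close> may lie before the crossing, one \<open>z\<close> serves many functions at
  once.\<close>

lemma one_signed_on_crossing:
  assumes f: "interpolated_on l r f" and lr: "l < r" and z: "z \<le> crossing l r f"
  shows "one_signed_on l z f"
proof (cases "f l * f r < 0")
  case True
  note c = interpolated_on_crossing[OF f lr True]
  have *: "(r - l) * f y = (y - crossing l r f) * (f r - f l)" if "y \<in> {l..z}" for y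
    using c(3)[of y] that z c(1) by auto
  show ?thesis
  proof (cases "f l < f r")
    case True
    have "f y \<le> 0" if "y \<in> {l..z}" for y
    proof -
      have "(r - l) * f y \<le> 0" unfolding *[OF that]
        using that z True by (intro mult_nonpos_nonneg) auto
      then show ?thesis using lr by (simp add: mult_le_0_iff)
    qed
    then show ?thesis by (auto simp: one_signed_on_def)
  next
    case False
    have "0 \<le> f y" if "y \<in> {l..z}" for y
    proof -
      have "0 \<le> (r - l) * f y" unfolding *[OF that]
        using that z False by (intro mult_nonpos_nonpos) auto
      then show ?thesis using lr by (simp add: zero_le_mult_iff)
    qed
    then show ?thesis by (auto simp: one_signed_on_def)
  qed
next
  case False
  then have zr: "z \<le> r" using z by (simp add: crossing_def)
  have *: "(r - l) * f y = (r - y) * f l + (y - l) * f r" if "y \<in> {l..z}" for y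
    using f that zr by (auto simp: interpolated_on_def)
  have "0 \<le> f l \<and> 0 \<le> f r \<or> f l \<le> 0 \<and> f r \<le> 0"
    using False by (auto simp: mult_less_0_iff not_less)
  then show ?thesis
  proof
    assume s: "0 \<le> f l \<and> 0 \<le> f r"
    have "0 \<le> f y" if "y \<in> {l..z}" for y
    proof -
      have "0 \<le> (r - l) * f y" unfolding *[OF that] using that zr s by simp
      then show ?thesis using lr by (simp add: zero_le_mult_iff)
    qed
    then show ?thesis by (auto simp: one_signed_on_def)
  next
    assume s: "f l \<le> 0 \<and> f r \<le> 0"
    have "f y \<le> 0" if "y \<in> {l..z}" for y
    proof -
      have "(r - l) * f y \<le> 0" unfolding *[OF that] using that zr s
        by (intro add_nonpos_nonpos mult_nonneg_nonpos) auto
      then show ?thesis using lr by (simp add: mult_le_0_iff)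
    qed
    then show ?thesis by (auto simp: one_signed_on_def)
  qed
qed

text \<open>The end values have weakly the same sign and a weighted mean of 0 with positive weights,
  so both vanish. This settles the ties: a level met exactly at the midpoint of a cell is met on the
  whole cell.\<close>

lemma interpolated_on_zero_inside:
  assumes f: "interpolated_on l r f" and s: "one_signed_on l r f"
    and c: "l < c" "c < r" "f c = 0" and y: "y \<in> {l..r}"
  shows "f y = 0"
proof -
  have e: "(r - l) * f x = (r - x) * f l + (x - l) * f r" if "x \<in> {l..r}" for x
    using f that by (auto simp: interpolated_on_def)
  have "(r - c) * f l + (c - l) * f r = 0" using e[of c] c by simp
  moreover have "0 \<le> f l \<and> 0 \<le> f r \<or> f l \<le> 0 \<and> f r \<le> 0"
    using s c by (auto simp: one_signed_on_def)
  ultimately have "f l = 0 \<and> f r = 0"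
  proof (elim disjE conjE)
    assume h: "(r - c) * f l + (c - l) * f r = 0" "0 \<le> f l" "0 \<le> f r"
    then have "0 \<le> (r - c) * f l" "0 \<le> (c - l) * f r" using c by auto
    with h have "(r - c) * f l = 0" "(c - l) * f r = 0" by linarith+
    then show ?thesis using c by simp
  next
    assume h: "(r - c) * f l + (c - l) * f r = 0" "f l \<le> 0" "f r \<le> 0"
    then have "(r - c) * f l \<le> 0" "(c - l) * f r \<le> 0" using c by (auto intro: mult_nonneg_nonpos)
    with h have "(r - c) * f l = 0" "(c - l) * f r = 0" by linarith+
    then show ?thesis using c by simp
  qed
  then show ?thesis using e[OF y] c by simp
qed

lemma card_le_2_if_no_chain:
  fixes Z :: "real set"
  assumes "\<And>x y z. x \<in> Z \<Longrightarrow> y \<in> Z \<Longrightarrow> z \<in> Z \<Longrightarrow> x < y \<Longrightarrow> y < z \<Longrightarrow> False"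
  shows "finite Z \<and> card Z \<le> 2"
proof (rule ccontr)
  assume "\<not> ?thesis"
  then have "infinite Z \<or> 3 \<le> card Z" by auto
  then obtain T where T: "T \<subseteq> Z" "card T = 3"
    by (metis infinite_arbitrarily_large obtain_subset_with_card_n)
  then obtain u v t where "T = {u, v, t}" "u \<noteq> v" "v \<noteq> t" "u \<noteq> t" by (auto simp: card_3_iff)
  then show False using T assms[of u v t] assms[of u t v] assms[of v u t] assms[of v t u]
      assms[of t u v] assms[of t v u] by (auto simp: neq_iff)
qed

section \<open>Events of the sweep and rounding\<close>

text \<open>The dummy item has weight 1; \<open>\<sigma>\<close> is the sign of the half under consideration.\<close>

locale sweep =
  fixes n m :: nat and W :: real and w a b :: "nat \<Rightarrow> real"
  assumes w_pos: "i \<le> n \<Longrightarrow> 0 < w i" and w_le: "i < n \<Longrightarrow> w i \<le> W" and W_nonneg: "0 \<le> W"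
    and w_n: "w n = 1" and a_n: "a n = 0" and b_n: "b n = 0" and m_pos: "0 < m"
begin

text \<open>Where \<open>\<sigma> * x = \<bar>x\<bar>\<close>, this is the profit at
  \<open>x / (1 - \<bar>x\<bar>)\<close> times \<open>1 - \<bar>x\<bar>\<close>. With
  \<open>\<sigma>\<close> as a parameter it is affine on the whole line, so convexity arguments need
  not respect the halves.\<close>

definition p :: "real \<Rightarrow> real \<Rightarrow> nat \<Rightarrow> real" where
  "p \<sigma> x i = a i * (1 - \<sigma> * x) + b i * x"

definition U :: "real \<Rightarrow> real \<Rightarrow> real" where
  "U \<sigma> x = lp_bound n W w (p \<sigma> x)"

text \<open>Comparison of two ratios, cleared of denominators. For the dummy item
  \<open>j = n\<close> it is the profit of \<open>i\<close> itself, so sign changes of profits are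
  among the order changes.\<close>

definition order_diff :: "real \<Rightarrow> nat \<Rightarrow> nat \<Rightarrow> real \<Rightarrow> real" where
  "order_diff \<sigma> i j x = w j * p \<sigma> x i - w i * p \<sigma> x j"

text \<open>Its sign tells whether item \<open>i\<close> is worth at least \<open>k\<close> units of
  size \<open>U / m\<close>; the product form remains meaningful when \<open>U\<close> is 0.\<close>

definition level_diff :: "real \<Rightarrow> nat \<Rightarrow> nat \<Rightarrow> real \<Rightarrow> real" where
  "level_diff \<sigma> i k x = real m * p \<sigma> x i - real k * U \<sigma> x"

lemma p_affine: "p \<sigma> x i = a i + (b i - \<sigma> * a i) * x"
  by (simp add: p_def algebra_simps)

lemma p_n: "p \<sigma> x n = 0"
  by (simp add: p_def a_n b_n)

lemma interpolated_on_p: "interpolated_on l r (\<lambda>x. p \<sigma> x i)"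
  unfolding p_affine by (rule interpolated_on_affine)

lemma interpolated_on_order_diff: "interpolated_on l r (order_diff \<sigma> i j)"
  unfolding order_diff_def[abs_def]
  by (intro interpolated_on_diff interpolated_on_cmult interpolated_on_p)

lemma U_ge:
  assumes "\<And>i. i < n \<Longrightarrow> 0 \<le> x i \<and> x i \<le> 1" and "(\<Sum>i<n. w i * x i) \<le> W"
  shows "(\<Sum>i<n. p \<sigma> y i * x i) \<le> U \<sigma> y"
  unfolding U_def using assms by (rule lp_bound_ge)

lemma U_nonneg: "0 \<le> U \<sigma> y"
  using U_ge[of "\<lambda>_. 0" \<sigma> y] W_nonneg by simp

text \<open>By \<open>w_le\<close> the item fits on its own. This is what allows capping the rounded
  profits at \<open>m\<close>.\<close>

lemma U_ge_p: "i < n \<Longrightarrow> p \<sigma> y i \<le> U \<sigma> y"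
  using U_ge[of "\<lambda>j. if j = i then 1 else 0" \<sigma> y] w_le[of i]
  by (simp add: if_distrib[of "times _"] cong: if_cong)

text \<open>The constraints do not depend on the parameter: a fractional solution that is optimal at
  \<open>y\<close> stays feasible everywhere, and its profit is the affine minorant.\<close>

lemma U_supporting_line: "\<exists>c d. U \<sigma> y = c + d * y \<and> (\<forall>x. c + d * x \<le> U \<sigma> x)"
proof -
  obtain x where x: "\<forall>i<n. 0 \<le> x i \<and> x i \<le> 1" "(\<Sum>i<n. w i * x i) \<le> W"
    "U \<sigma> y = (\<Sum>i<n. p \<sigma> y i * x i)"
    using greedy_fractional_solution[of n w W "p \<sigma> y", OF w_pos W_nonneg p_n] unfolding U_def by blast
  define c where "c = (\<Sum>i<n. a i * x i)"
  define d where "d = (\<Sum>i<n. (b i - \<sigma> * a i) * x i)"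
  have e: "(\<Sum>i<n. p \<sigma> z i * x i) = c + d * z" for z
    unfolding c_def d_def sum_distrib_right sum.distrib[symmetric]
    by (rule sum.cong) (auto simp: p_affine algebra_simps)
  show ?thesis using x U_ge[of x \<sigma>] by (intro exI[of _ c] exI[of _ d]) (simp add: e)
qed

text \<open>The split item of the greedy solution is feasible on its own.\<close>

lemma U_le_twice:
  assumes B: "\<And>x::nat \<Rightarrow> nat. (\<forall>i<n. x i \<in> {0, 1}) \<Longrightarrow> (\<Sum>i<n. w i * real (x i)) \<le> W \<Longrightarrow>
    (\<Sum>i<n. p \<sigma> y i * real (x i)) \<le> B"
  shows "U \<sigma> y \<le> 2 * B"
proof -
  have set: "sum (p \<sigma> y) A \<le> B" if A: "A \<subseteq> {..<n}" "sum w A \<le> W" for A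
  proof -
    have e: "(\<Sum>i<n. f i * real (of_bool (i \<in> A))) = sum f A" for f :: "nat \<Rightarrow> real"
      by (rule sum.mono_neutral_cong_right) (use A in auto)
    show ?thesis using B[of "\<lambda>i. of_bool (i \<in> A)"] A(2) unfolding e by simp
  qed
  have B0: "0 \<le> B" using set[of "{}"] W_nonneg by simp
  obtain A where A: "A \<subseteq> {..<n}" "sum w A \<le> W"
    "U \<sigma> y \<le> sum (p \<sigma> y) A \<or> (\<exists>h<n. U \<sigma> y \<le> sum (p \<sigma> y) A + p \<sigma> y h)"
    using greedy_fractional_solution[of n w W "p \<sigma> y", OF w_pos W_nonneg p_n] unfolding U_def by blast
  have "p \<sigma> y h \<le> B" if "h < n" for h using set[of "{h}"] w_le[OF that] that by simp
  then show ?thesis using A set[OF A(1,2)] B0 by fastforce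
qed

text \<open>Without order changes, every maximum in the dual value, including the one in
  \<open>ratio\<close>, is resolved the same way on the whole segment: either the multiplier is the
  quotient for \<open>j\<close> and the summands are positive parts of \<open>order_diff\<close>
  divided by \<open>w j\<close>, or it is 0 and they are positive parts of profits.\<close>

lemma interpolated_on_dual:
  assumes lr: "l \<le> r" and s: "\<And>i j. i \<le> n \<Longrightarrow> j \<le> n \<Longrightarrow> one_signed_on l r (order_diff \<sigma> i j)"
    and j: "j \<le> n"
  shows "interpolated_on l r (\<lambda>x. dual_obj n W w (p \<sigma> x) (ratio w (p \<sigma> x) j))"
proof -
  have sp: "one_signed_on l r (\<lambda>x. p \<sigma> x i)" if "i \<le> n" for i
    using s[OF that, of n] by (simp add: order_diff_def[abs_def] p_n w_n)
  note wj = w_pos[OF j]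
  consider "\<forall>x\<in>{l..r}. 0 \<le> p \<sigma> x j" | "\<forall>x\<in>{l..r}. p \<sigma> x j \<le> 0"
    using sp[OF j] by (auto simp: one_signed_on_def)
  then show ?thesis
  proof cases
    case 1
    have e: "dual_obj n W w (p \<sigma> x) (ratio w (p \<sigma> x) j) =
      (W / w j) * p \<sigma> x j + (\<Sum>i<n. (1 / w j) * max 0 (order_diff \<sigma> i j x))" if x: "x \<in> {l..r}" for x
    proof -
      have r: "ratio w (p \<sigma> x) j = p \<sigma> x j / w j" using 1 x wj by (simp add: ratio_def)
      have "max 0 (p \<sigma> x i - p \<sigma> x j / w j * w i) = (1 / w j) * max 0 (order_diff \<sigma> i j x)" for i
        using wj by (simp add: order_diff_def max_def field_simps)
      then show ?thesis by (simp add: dual_obj_def r)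
    qed
    have "interpolated_on l r (\<lambda>x. (W / w j) * p \<sigma> x j + (\<Sum>i<n. (1 / w j) * max 0 (order_diff \<sigma> i j x)))"
      by (intro interpolated_on_add interpolated_on_cmult interpolated_on_sum interpolated_on_p
          interpolated_on_max_zero lr interpolated_on_order_diff s j) simp
    then show ?thesis using interpolated_on_cong[OF lr e] by simp
  next
    case 2
    have e: "dual_obj n W w (p \<sigma> x) (ratio w (p \<sigma> x) j) = (\<Sum>i<n. max 0 (p \<sigma> x i))" if x: "x \<in> {l..r}" for x
    proof -
      have "ratio w (p \<sigma> x) j = 0" using 2 x wj by (simp add: ratio_def divide_le_0_iff)
      then show ?thesis by (simp add: dual_obj_def)
    qed
    have "interpolated_on l r (\<lambda>x. \<Sum>i<n. max 0 (p \<sigma> x i))"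
      by (intro interpolated_on_sum interpolated_on_max_zero interpolated_on_p lr sp) simp
    then show ?thesis using interpolated_on_cong[OF lr e] by simp
  qed
qed

text \<open>Between two crossings, \<open>U\<close> is concave as a minimum of affine functions, and it is convex
  because it has supporting lines.\<close>

lemma interpolated_on_U:
  assumes lr: "l \<le> r" and s: "\<And>i j. i \<le> n \<Longrightarrow> j \<le> n \<Longrightarrow> one_signed_on l r (order_diff \<sigma> i j)"
  shows "interpolated_on l r (U \<sigma>)"
  unfolding interpolated_on_def
proof
  fix y assume y: "y \<in> {l..r}"
  obtain j where j: "j \<le> n" "U \<sigma> y = dual_obj n W w (p \<sigma> y) (ratio w (p \<sigma> y) j)"
    using lp_bound_attained[of n W w "p \<sigma> y"] by (auto simp: U_def)
  define g where "g x = dual_obj n W w (p \<sigma> x) (ratio w (p \<sigma> x) j)" for x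
  have g: "(r - l) * g y = (r - y) * g l + (y - l) * g r"
    using interpolated_on_dual[OF lr s j(1)] y by (auto simp: interpolated_on_def g_def)
  have Ug: "U \<sigma> x \<le> g x" for x unfolding U_def g_def using j(1) by (rule lp_bound_le)
  obtain c d where cd: "U \<sigma> y = c + d * y" "\<And>x. c + d * x \<le> U \<sigma> x"
    using U_supporting_line by blast
  have "(r - y) * U \<sigma> l + (y - l) * U \<sigma> r \<le> (r - l) * U \<sigma> y"
    using g j(2) y Ug[of l] Ug[of r] by (auto simp: g_def[of y] intro!: add_mono mult_left_mono)
  moreover have "(r - y) * (c + d * l) + (y - l) * (c + d * r) \<le> (r - y) * U \<sigma> l + (y - l) * U \<sigma> r"
    using y cd(2) by (intro add_mono mult_left_mono) auto
  moreover have "(r - y) * (c + d * l) + (y - l) * (c + d * r) = (r - l) * U \<sigma> y"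
    unfolding cd(1) by algebra
  ultimately show "(r - l) * U \<sigma> y = (r - y) * U \<sigma> l + (y - l) * U \<sigma> r" by linarith
qed

lemma interpolated_on_level_diff:
  "interpolated_on l r (U \<sigma>) \<Longrightarrow> interpolated_on l r (level_diff \<sigma> i k)"
  unfolding level_diff_def[abs_def]
  by (intro interpolated_on_diff interpolated_on_cmult interpolated_on_p)

text \<open>\<open>order_root\<close> is used only if the denominator is not 0.\<close>

definition order_root :: "real \<Rightarrow> nat \<Rightarrow> nat \<Rightarrow> real" where
  "order_root \<sigma> i j = - order_diff \<sigma> i j 0 / (order_diff \<sigma> i j 1 - order_diff \<sigma> i j 0)"

text \<open>The identity m p = k U may hold on a whole interval, which would give infinitely many
  zeros. The second condition keeps only zeros that negative values approach, which suffices for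
  sign changes.\<close>

definition level_roots :: "real \<Rightarrow> nat \<Rightarrow> nat \<Rightarrow> real set" where
  "level_roots \<sigma> i k = {z. level_diff \<sigma> i k z = 0 \<and>
     (\<forall>e>0. \<exists>y. \<bar>y - z\<bar> < e \<and> level_diff \<sigma> i k y < 0)}"

text \<open>A superset of the possible stops inside a half, taken over the whole line: membership of
  the stops and the size of the set are all that matters. It refers to no state of the program, so
  the events still ahead can serve as a termination measure.\<close>

definition half_events :: "real \<Rightarrow> real set" where
  "half_events \<sigma> = (\<lambda>(i, j). order_root \<sigma> i j) ` ({..n} \<times> {..n}) \<union>
     (\<Union>(i, k)\<in>{..<n} \<times> {1..m}. level_roots \<sigma> i k)"

definition events :: "real set" where
  "events = half_events (-1) \<union> half_events 1 \<union> {0, 1}"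

text \<open>An \<open>order_diff\<close> is affine on the whole line, so its zero does not depend on
  the segment on which it was detected.\<close>

lemma order_crossing_event:
  assumes "l < r" "order_diff \<sigma> i j l * order_diff \<sigma> i j r < 0" "i \<le> n" "j \<le> n"
  shows "crossing l r (order_diff \<sigma> i j) \<in> half_events \<sigma>"
proof -
  let ?f = "order_diff \<sigma> i j" and ?z = "crossing l r (order_diff \<sigma> i j)"
  have f0: "?f ?z = 0"
    using interpolated_on_crossing(2)[OF interpolated_on_order_diff assms(1,2)] .
  have lin: "?f x = ?f 0 + x * (?f 1 - ?f 0)" for x
    by (simp add: order_diff_def p_affine algebra_simps)
  have "?f 1 - ?f 0 \<noteq> 0"
  proof
    assume "?f 1 - ?f 0 = 0"
    then have "?f l = ?f r" using lin[of l] lin[of r] by simp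
    then show False using assms(2) by (simp add: mult_less_0_iff)
  qed
  then have "?z = order_root \<sigma> i j"
    using lin[of ?z] f0 by (simp add: order_root_def field_simps)
  then show ?thesis using assms(3,4) by (auto simp: half_events_def)
qed

text \<open>At a strict sign change one side of the zero is negative arbitrarily close to it, which
  is the extra condition in \<open>level_roots\<close>.\<close>

lemma level_crossing_event:
  assumes U: "interpolated_on l r (U \<sigma>)" and lr: "l < r"
    and opp: "level_diff \<sigma> i k l * level_diff \<sigma> i k r < 0" and "i < n" "k \<in> {1..m}"
  shows "crossing l r (level_diff \<sigma> i k) \<in> half_events \<sigma>"
proof -
  let ?f = "level_diff \<sigma> i k" and ?z = "crossing l r (level_diff \<sigma> i k)"
  note c = interpolated_on_crossing[OF interpolated_on_level_diff[OF U] lr opp]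
  have lz: "l < ?z" using lr by (rule crossing_gt)
  have "\<exists>y. \<bar>y - ?z\<bar> < e \<and> ?f y < 0" if e: "0 < e" for e
  proof -
    define \<delta> where "\<delta> = min (e / 2) (min (?z - l) (r - ?z))"
    have \<delta>: "0 < \<delta>" "\<delta> < e" "\<delta> \<le> ?z - l" "\<delta> \<le> r - ?z" using e lz c(1) by (auto simp: \<delta>_def)
    have "?f l \<noteq> ?f r" using opp by (auto simp: mult_less_0_iff)
    then consider "?f l < ?f r" | "?f r < ?f l" by linarith
    then show ?thesis
    proof cases
      case 1
      have "(r - l) * ?f (?z - \<delta>) = (?z - \<delta> - ?z) * (?f r - ?f l)" using \<delta> lz c(1) by (intro c(3)) auto
      also have "\<dots> < 0" using \<delta> 1 by (intro mult_neg_pos) auto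
      finally show ?thesis using lr \<delta> by (intro exI[of _ "?z - \<delta>"]) (auto simp: mult_less_0_iff)
    next
      case 2
      have "(r - l) * ?f (?z + \<delta>) = (?z + \<delta> - ?z) * (?f r - ?f l)" using \<delta> lz c(1) by (intro c(3)) auto
      also have "\<dots> < 0" using \<delta> 2 by (intro mult_pos_neg) auto
      finally show ?thesis using lr \<delta> by (intro exI[of _ "?z + \<delta>"]) (auto simp: mult_less_0_iff)
    qed
  qed
  then have "?z \<in> level_roots \<sigma> i k" using c(2) by (simp add: level_roots_def)
  then show ?thesis using assms by (auto simp: half_events_def)
qed

text \<open>\<open>level_diff\<close> is concave, so it is nonnegative between two of its roots.\<close>

lemma card_level_roots: "finite (level_roots \<sigma> i k) \<and> card (level_roots \<sigma> i k) \<le> 2"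
proof (rule card_le_2_if_no_chain)
  let ?f = "level_diff \<sigma> i k"
  fix x y z assume R: "x \<in> level_roots \<sigma> i k" "y \<in> level_roots \<sigma> i k" "z \<in> level_roots \<sigma> i k"
    and xy: "x < y" and yz: "y < z"
  have "0 < min (y - x) (z - y)" using xy yz by simp
  then obtain v where v: "\<bar>v - y\<bar> < min (y - x) (z - y)" "?f v < 0"
    using R(2) unfolding level_roots_def by blast
  then have xv: "x < v" "v < z" by auto
  obtain c d where cd: "U \<sigma> v = c + d * v" "\<And>x. c + d * x \<le> U \<sigma> x"
    using U_supporting_line by blast
  \<comment> \<open>Replacing \<open>U\<close> by its supporting line at \<open>v\<close> gives an
    affine majorant of \<open>level_diff\<close> that agrees with it at \<open>v\<close>; being
    nonnegative at \<open>x\<close> and \<open>z\<close>, it cannot be negative between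
    them.\<close>
  define H where "H u = real m * p \<sigma> u i - real k * (c + d * u)" for u
  have fH: "?f u \<le> H u" for u using cd(2)[of u] by (simp add: level_diff_def H_def mult_left_mono)
  have "0 \<le> H x" "0 \<le> H z" using R(1,3) fH[of x] fH[of z] by (simp_all add: level_roots_def)
  then have "0 \<le> (z - v) * H x + (v - x) * H z" using xv by simp
  also have "\<dots> = (z - x) * H v" unfolding H_def p_affine by algebra
  finally have "0 \<le> H v" using xv by (simp add: zero_le_mult_iff)
  then show False using v(2) cd(1) by (simp add: H_def level_diff_def)
qed

lemma card_half_events: "finite (half_events \<sigma>) \<and> card (half_events \<sigma>) \<le> (n + 1) * (n + 1) + 2 * (n * m)"
proof -
  let ?A = "(\<lambda>(i, j). order_root \<sigma> i j) ` ({..n} \<times> {..n})"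
  let ?B = "\<Union>(i, k)\<in>{..<n} \<times> {1..m}. level_roots \<sigma> i k"
  have A: "finite ?A" "card ?A \<le> (n + 1) * (n + 1)"
    using card_image_le[of "{..n} \<times> {..n}" "\<lambda>(i, j). order_root \<sigma> i j"] by (auto simp: card_cartesian_product)
  have "card ?B \<le> (\<Sum>x\<in>{..<n} \<times> {1..m}. card (case x of (i, k) \<Rightarrow> level_roots \<sigma> i k))"
    by (rule card_UN_le) simp
  also have "\<dots> \<le> (\<Sum>x\<in>{..<n} \<times> {1..m}. 2)"
    by (rule sum_mono) (use card_level_roots in auto)
  also have "\<dots> = 2 * (n * m)" by (simp add: card_cartesian_product)
  finally have B: "card ?B \<le> 2 * (n * m)" .
  have "finite ?B" using card_level_roots by auto
  then show ?thesis unfolding half_events_def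
    using A B card_Un_le[of ?A ?B] by simp
qed

lemma card_events: "finite events \<and> card events \<le> 8 * ((n + 1) * (n + m + 1))"
proof -
  have "card events \<le> card (half_events (-1) \<union> half_events 1) + card {0, 1::real}"
    unfolding events_def by (rule card_Un_le)
  also have "\<dots> \<le> card (half_events (-1)) + card (half_events 1) + 2"
    using card_Un_le[of "half_events (-1)" "half_events 1"] by simp
  also have "\<dots> \<le> 2 * ((n + 1) * (n + 1) + 2 * (n * m)) + 2"
    using card_half_events[of "-1"] card_half_events[of 1] by simp
  also have "\<dots> \<le> 8 * ((n + 1) * (n + m + 1))" by (simp add: algebra_simps)
  finally show ?thesis using card_half_events unfolding events_def by simp
qed

text \<open>The floor of m p / U at \<open>c\<close>, without a division. Level 0 carries no
  condition, so items of negative profit are rounded to 0.\<close>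

definition rounded :: "real \<Rightarrow> real \<Rightarrow> (nat \<Rightarrow> nat) \<Rightarrow> bool" where
  "rounded \<sigma> c q \<longleftrightarrow> (\<forall>i<n. q i \<le> m \<and> (1 \<le> q i \<longrightarrow> 0 \<le> level_diff \<sigma> i (q i) c) \<and>
     (\<forall>k. q i < k \<longrightarrow> k \<le> m \<longrightarrow> level_diff \<sigma> i k c < 0))"

definition binary :: "(nat \<Rightarrow> nat) \<Rightarrow> bool" where
  "binary x \<longleftrightarrow> (\<forall>i<n. x i \<in> {0, 1}) \<and> (\<Sum>i<n. w i * real (x i)) \<le> W"

text \<open>Items of rounded profit 0 are excluded because their true profit may be negative.
  Competitors are limited to rounded value \<open>m\<close>, the last column of the table.\<close>

definition optimal_rounded :: "(nat \<Rightarrow> nat) \<Rightarrow> (nat \<Rightarrow> nat) \<Rightarrow> bool" where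
  "optimal_rounded q x \<longleftrightarrow> binary x \<and> (\<forall>i<n. x i = 1 \<longrightarrow> 1 \<le> q i) \<and>
     (\<forall>y. binary y \<longrightarrow> (\<Sum>i<n. q i * y i) \<le> m \<longrightarrow> (\<Sum>i<n. q i * y i) \<le> (\<Sum>i<n. q i * x i))"

definition val :: "real \<Rightarrow> real \<Rightarrow> (nat \<Rightarrow> nat) \<Rightarrow> real" where
  "val \<sigma> y x = (\<Sum>i<n. p \<sigma> y i * real (x i))"

lemma val_le_U: "binary x \<Longrightarrow> val \<sigma> y x \<le> U \<sigma> y"
  unfolding val_def by (rule U_ge) (auto simp: binary_def)

text \<open>The levels found at \<open>c\<close> bound the profits on the whole closed cell: an item
  counted in \<open>q i\<close> units is worth at least that many units of \<open>U / m\<close>, and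
  no item is worth more than \<open>q i + 1\<close> of them. An optimal solution therefore loses at
  most n U / m, which \<open>U_le_twice\<close> and \<open>eps\<close> turn into the relative
  error.\<close>

lemma cell_approximation:
  assumes lz: "l < z" and Uaff: "interpolated_on l z (U \<sigma>)"
    and sgn: "\<And>i k. i < n \<Longrightarrow> k \<in> {1..m} \<Longrightarrow> one_signed_on l z (level_diff \<sigma> i k)"
    and c: "l < c" "c < z" and q: "rounded \<sigma> c q" and x: "optimal_rounded q x"
    and y: "y \<in> {l..z}" and eps: "2 * real n \<le> \<epsilon> * real m"
    and o: "binary x'" "\<And>x''. binary x'' \<Longrightarrow> val \<sigma> y x'' \<le> val \<sigma> y x'"
  shows "(1 - \<epsilon>) * val \<sigma> y x' \<le> val \<sigma> y x"
proof -
  note Laff = interpolated_on_level_diff[OF Uaff]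
  have lo: "0 \<le> level_diff \<sigma> i (q i) y" if i: "i < n" "1 \<le> q i" for i
  proof -
    have k: "q i \<in> {1..m}" "0 \<le> level_diff \<sigma> i (q i) c" using q i by (auto simp: rounded_def)
    have s: "one_signed_on l z (level_diff \<sigma> i (q i))" using sgn i k by blast
    then consider "\<forall>y\<in>{l..z}. 0 \<le> level_diff \<sigma> i (q i) y"
      | "\<forall>y\<in>{l..z}. level_diff \<sigma> i (q i) y \<le> 0" by (auto simp: one_signed_on_def)
    then show ?thesis
    proof cases
      case 2
      \<comment> \<open>The level is reached at \<open>c\<close> although the sign on the cell is
        nonpositive, so it is met with equality there and hence on the whole cell.\<close>
      then have "level_diff \<sigma> i (q i) c = 0" using k c by (intro order_antisym) auto
      then show ?thesis using interpolated_on_zero_inside[OF Laff s c _ y] by simp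
    qed (use y in auto)
  qed
  have hi: "real m * p \<sigma> y i \<le> (real (q i) + 1) * U \<sigma> y" if i: "i < n" for i
  proof (cases "q i < m")
    case True
    then have "level_diff \<sigma> i (q i + 1) c < 0" using q i by (auto simp: rounded_def)
    moreover have "one_signed_on l z (level_diff \<sigma> i (q i + 1))" using sgn[OF i, of "q i + 1"] True by simp
    moreover have "c \<in> {l..z}" using c by simp
    ultimately have "level_diff \<sigma> i (q i + 1) y \<le> 0"
      using y unfolding one_signed_on_def by (meson not_less)
    then show ?thesis by (simp add: level_diff_def add.commute)
  next
    case False
    \<comment> \<open>At the cap no next level has been tested; the bound of each profit by
      \<open>U\<close> takes its place.\<close>
    then have "q i = m" using q i by (auto simp: rounded_def)
    moreover have "real m * p \<sigma> y i \<le> real m * U \<sigma> y" using U_ge_p[OF i] by (simp add: mult_left_mono)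
    ultimately show ?thesis using U_nonneg[of \<sigma> y] by (simp add: distrib_right)
  qed
  have xb: "binary x" and x1: "\<And>i. i < n \<Longrightarrow> x i = 1 \<Longrightarrow> 1 \<le> q i"
    using x by (auto simp: optimal_rounded_def)
  have xU: "U \<sigma> y * real (\<Sum>i<n. q i * x i) \<le> real m * val \<sigma> y x"
    unfolding val_def sum_distrib_left of_nat_sum
  proof (rule sum_mono)
    fix i assume "i \<in> {..<n}"
    then have i: "i < n" by simp
    show "U \<sigma> y * real (q i * x i) \<le> real m * (p \<sigma> y i * real (x i))"
    proof (cases "x i = 1")
      case True
      then show ?thesis using lo[OF i x1[OF i True]] by (simp add: level_diff_def mult.commute)
    next
      case False
      then have "x i = 0" using xb i by (auto simp: binary_def)
      then show ?thesis by simp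
    qed
  qed
  have o0: "0 \<le> val \<sigma> y x'" using o(2)[of "\<lambda>_. 0"] W_nonneg by (simp add: binary_def val_def)
  have U2: "U \<sigma> y \<le> 2 * val \<sigma> y x'"
    by (rule U_le_twice) (use o(2) in \<open>auto simp: binary_def val_def\<close>)
  have main: "real m * val \<sigma> y x' \<le> real m * val \<sigma> y x + real n * U \<sigma> y"
  proof (cases "U \<sigma> y = 0")
    case True
    then have "val \<sigma> y x' \<le> 0" using val_le_U[OF o(1), of \<sigma> y] by simp
    then have "real m * val \<sigma> y x' \<le> 0" by (simp add: mult_nonneg_nonpos)
    then show ?thesis using xU True by simp
  next
    case False
    have Us: "one_signed_on l z (U \<sigma>)" using U_nonneg by (auto simp: one_signed_on_def)
    \<comment> \<open>\<open>U\<close> is nonnegative and affine on the cell; a zero at the interior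
      point \<open>c\<close> would force it to vanish at \<open>y\<close> too.\<close>
    have Uc: "0 < U \<sigma> c"
      using interpolated_on_zero_inside[OF Uaff Us c _ y] False U_nonneg[of \<sigma> c] by fastforce
    \<comment> \<open>Items rounded to 0 are dropped: their profit at \<open>c\<close> may be
      negative, which would spoil the bound on the rounded value by the true one.\<close>
    define x0 where "x0 i = (if 1 \<le> q i then x' i else 0)" for i
    have bx0: "binary x0"
    proof -
      have "(\<Sum>i<n. w i * real (x0 i)) \<le> (\<Sum>i<n. w i * real (x' i))"
        by (rule sum_mono) (use w_pos in \<open>auto simp: x0_def less_imp_le\<close>)
      then show ?thesis using o(1) by (auto simp: binary_def x0_def)
    qed
    \<comment> \<open>This places \<open>x'\<close> among the competitors of \<open>x\<close>: its
      rounded value in units of \<open>U / m\<close> at \<open>c\<close> is at most the profit of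
      the feasible \<open>x0\<close>, hence at most \<open>U\<close>, so it is at most
      \<open>m\<close>.\<close>
    have "U \<sigma> c * real (\<Sum>i<n. q i * x' i) \<le> real m * val \<sigma> c x0"
      unfolding val_def sum_distrib_left of_nat_sum
    proof (rule sum_mono)
      fix i assume "i \<in> {..<n}"
      then have i: "i < n" by simp
      show "U \<sigma> c * real (q i * x' i) \<le> real m * (p \<sigma> c i * real (x0 i))"
      proof (cases "1 \<le> q i")
        case True
        then have "0 \<le> level_diff \<sigma> i (q i) c" using q i by (auto simp: rounded_def)
        then have "U \<sigma> c * real (q i) * real (x' i) \<le> real m * p \<sigma> c i * real (x' i)"
          by (intro mult_right_mono) (auto simp: level_diff_def mult.commute)
        then show ?thesis using True by (simp add: x0_def mult.assoc)
      next
        case False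
        then have "q i = 0" by simp
        then show ?thesis by (simp add: x0_def)
      qed
    qed
    also have "\<dots> \<le> real m * U \<sigma> c" using val_le_U[OF bx0] by (simp add: mult_left_mono)
    finally have "real (\<Sum>i<n. q i * x' i) \<le> real m" using Uc by (simp add: mult.commute)
    then have "(\<Sum>i<n. q i * x' i) \<le> m" by (simp only: of_nat_le_iff)
    then have V: "(\<Sum>i<n. q i * x' i) \<le> (\<Sum>i<n. q i * x i)" using x o(1) by (auto simp: optimal_rounded_def)
    have "real m * val \<sigma> y x' \<le> (\<Sum>i<n. U \<sigma> y * real (q i * x' i) + U \<sigma> y)"
      unfolding val_def sum_distrib_left
    proof (rule sum_mono)
      fix i assume "i \<in> {..<n}"
      then have i: "i < n" by simp
      have "x' i = 0 \<or> x' i = 1" using o(1) i by (auto simp: binary_def)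
      then show "real m * (p \<sigma> y i * real (x' i)) \<le> U \<sigma> y * real (q i * x' i) + U \<sigma> y"
        using hi[OF i] U_nonneg[of \<sigma> y] by (auto simp: algebra_simps)
    qed
    also have "\<dots> = U \<sigma> y * real (\<Sum>i<n. q i * x' i) + real n * U \<sigma> y"
      by (simp add: sum.distrib sum_distrib_left)
    also have "\<dots> \<le> U \<sigma> y * real (\<Sum>i<n. q i * x i) + real n * U \<sigma> y"
      using V U_nonneg by (intro add_mono mult_left_mono of_nat_mono) auto
    also have "\<dots> \<le> real m * val \<sigma> y x + real n * U \<sigma> y" using xU by simp
    finally show ?thesis .
  qed
  have "real n * U \<sigma> y \<le> (2 * real n) * val \<sigma> y x'" using mult_left_mono[OF U2, of "real n"] by simp
  also have "\<dots> \<le> \<epsilon> * real m * val \<sigma> y x'" using eps o0 by (rule mult_right_mono)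
  finally have "real m * ((1 - \<epsilon>) * val \<sigma> y x') \<le> real m * val \<sigma> y x" using main by (simp add: algebra_simps)
  then show ?thesis using m_pos by simp
qed

end

section \<open>Total correctness with time bounds\<close>

fun nmods :: "com \<Rightarrow> string set" where
  "nmods Skip = {}"
| "nmods (NSet X e f) = {X}"
| "nmods (RSet X e f) = {}"
| "nmods (Seq c d) = nmods c \<union> nmods d"
| "nmods (Cond b c d) = nmods c \<union> nmods d"
| "nmods (While b c) = nmods c"

fun rmods :: "com \<Rightarrow> string set" where
  "rmods Skip = {}"
| "rmods (NSet X e f) = {}"
| "rmods (RSet X e f) = {X}"
| "rmods (Seq c d) = rmods c \<union> rmods d"
| "rmods (Cond b c d) = rmods c \<union> rmods d"
| "rmods (While b c) = rmods c"

definition agree :: "string set \<Rightarrow> string set \<Rightarrow> ram \<Rightarrow> ram \<Rightarrow> bool" where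
  "agree N R s s' \<longleftrightarrow> (\<forall>Y. Y \<notin> N \<longrightarrow> nmem s' Y = nmem s Y) \<and> (\<forall>Y. Y \<notin> R \<longrightarrow> rmem s' Y = rmem s Y)"

lemma agreeN: "agree N R s s' \<Longrightarrow> Y \<notin> N \<Longrightarrow> nmem s' Y = nmem s Y"
  and agreeR: "agree N R s s' \<Longrightarrow> Y \<notin> R \<Longrightarrow> rmem s' Y = rmem s Y"
  by (simp_all add: agree_def)

lemma exec_agree: "exec c s t s' \<Longrightarrow> agree (nmods c) (rmods c) s s'"
  by (induction rule: exec.induct) (auto simp: agree_def)

definition ok :: "com \<Rightarrow> ram \<Rightarrow> nat \<Rightarrow> (ram \<Rightarrow> bool) \<Rightarrow> bool" where
  "ok c s T Q \<longleftrightarrow> (\<exists>t s'. exec c s t s' \<and> t \<le> T \<and> Q s')"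

text \<open>The frame condition comes with every use: postconditions mention only what a program
  computes, and preservation of everything else follows from its syntax.\<close>

lemma ok_weaken: "ok c s T Q \<Longrightarrow> T \<le> T' \<Longrightarrow> (\<And>s'. Q s' \<Longrightarrow> agree (nmods c) (rmods c) s s' \<Longrightarrow> Q' s') \<Longrightarrow> ok c s T' Q'"
  unfolding ok_def by (meson exec_agree le_trans)

lemma ok_time: "ok c s T Q \<Longrightarrow> T \<le> T' \<Longrightarrow> ok c s T' Q"
  by (rule ok_weaken)

lemma ok_Seq:
  assumes "ok c s T R" "\<And>s'. R s' \<Longrightarrow> agree (nmods c) (rmods c) s s' \<Longrightarrow> ok d s' T' Q"
    and "T + T' \<le> T''"
  shows "ok (Seq c d) s T'' Q"
  using assms unfolding ok_def by (meson add_mono exec_Seq exec_agree le_trans)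

fun loop_free :: "com \<Rightarrow> bool" where
  "loop_free (Seq c d) \<longleftrightarrow> loop_free c \<and> loop_free d"
| "loop_free (Cond b c d) \<longleftrightarrow> loop_free c \<and> loop_free d"
| "loop_free (While b c) \<longleftrightarrow> False"
| "loop_free _ \<longleftrightarrow> True"

fun run :: "com \<Rightarrow> ram \<Rightarrow> ram" where
  "run (NSet X e f) s = s\<lparr>nmem := (nmem s)(X := (nmem s X)(nval e s := nval f s))\<rparr>"
| "run (RSet X e f) s = s\<lparr>rmem := (rmem s)(X := (rmem s X)(nval e s := rval f s))\<rparr>"
| "run (Seq c d) s = run d (run c s)"
| "run (Cond b c d) s = (if bval b s then run c s else run d s)"
| "run _ s = s"

text \<open>The costs of both branches are added, which yields a bound that depends on the program
  alone and is evaluated by simplification.\<close>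

fun run_cost :: "com \<Rightarrow> nat" where
  "run_cost (NSet X e f) = 1 + ncost e + ncost f"
| "run_cost (RSet X e f) = 1 + ncost e + rcost f"
| "run_cost (Seq c d) = run_cost c + run_cost d"
| "run_cost (Cond b c d) = 1 + bcost b + run_cost c + run_cost d"
| "run_cost _ = 1"

lemma exec_run: "loop_free c \<Longrightarrow> \<exists>t\<le>run_cost c. exec c s t (run c s)"
proof (induction c arbitrary: s)
  case Skip
  then show ?case using exec_Skip by fastforce
next
  case (NSet X e f)
  then show ?case using exec_NSet by fastforce
next
  case (RSet X e f)
  then show ?case using exec_RSet by fastforce
next
  case (Seq c d)
  then obtain t u where "t \<le> run_cost c" "exec c s t (run c s)"
    "u \<le> run_cost d" "exec d (run c s) u (run d (run c s))" by fastforce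
  then show ?case by (intro exI[of _ "t + u"]) (auto intro: exec_Seq)
next
  case (Cond b c d)
  then obtain t u where "t \<le> run_cost c" "exec c s t (run c s)"
    "u \<le> run_cost d" "exec d s u (run d s)" by fastforce
  then show ?case
    using exec_CondT[of b s c t "run c s" d] exec_CondF[of b s d u "run d s" c]
    by (intro exI[of _ "if bval b s then 1 + bcost b + t else 1 + bcost b + u"]) auto
qed simp

lemma ok_run: "loop_free c \<Longrightarrow> Q (run c s) \<Longrightarrow> run_cost c \<le> T \<Longrightarrow> ok c s T Q"
  unfolding ok_def by (meson exec_run le_trans)

lemma ok_Seq_run:
  assumes "loop_free c" "ok d (run c s) T Q" "run_cost c + T \<le> T'"
  shows "ok (Seq c d) s T' Q"
  using ok_Seq[OF ok_run[OF assms(1), of "\<lambda>s'. s' = run c s"]] assms by blast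

text \<open>The measure is a budget of iterations; the summand outside the product pays for the
  last, failing test.\<close>

lemma ok_While:
  fixes \<mu> :: "ram \<Rightarrow> nat"
  assumes step: "\<And>s. I s \<Longrightarrow> bval b s \<Longrightarrow> ok c s T (\<lambda>s'. I s' \<and> \<mu> s' < \<mu> s)"
    and "I s"
  shows "ok (While b c) s ((1 + bcost b + T) * \<mu> s + (1 + bcost b)) (\<lambda>s'. I s' \<and> \<not> bval b s')"
  using \<open>I s\<close>
proof (induction "\<mu> s" arbitrary: s rule: less_induct)
  case less
  show ?case
  proof (cases "bval b s")
    case True
    obtain t s' where 1: "exec c s t s'" "t \<le> T" "I s'" "\<mu> s' < \<mu> s"
      using step[OF less.prems True] by (auto simp: ok_def)
    obtain u s'' where 2: "exec (While b c) s' u s''"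
      "u \<le> (1 + bcost b + T) * \<mu> s' + (1 + bcost b)" "I s''" "\<not> bval b s''"
      using less.hyps[OF 1(4,3)] by (auto simp: ok_def)
    have "1 + bcost b + t + u \<le> (1 + bcost b + T) * Suc (\<mu> s') + (1 + bcost b)" using 1 2 by simp
    also have "\<dots> \<le> (1 + bcost b + T) * \<mu> s + (1 + bcost b)" using 1(4) by (intro add_mono mult_le_mono2) auto
    finally show ?thesis using exec_WhileT[OF True 1(1) 2(1)] 2 unfolding ok_def by blast
  next
    case False
    then show ?thesis using exec_WhileF[OF False] less.prems unfolding ok_def by fastforce
  qed
qed

abbreviation Nv :: "string \<Rightarrow> nexp" where "Nv X \<equiv> NGet X (NConst 0)"
abbreviation Rv :: "string \<Rightarrow> rexp" where "Rv X \<equiv> RGet X (NConst 0)"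
abbreviation Nlet :: "string \<Rightarrow> nexp \<Rightarrow> com" where "Nlet X e \<equiv> NSet X (NConst 0) e"
abbreviation Rlet :: "string \<Rightarrow> rexp \<Rightarrow> com" where "Rlet X e \<equiv> RSet X (NConst 0) e"

definition For :: "string \<Rightarrow> nexp \<Rightarrow> com \<Rightarrow> com" where
  "For v e c = Seq (Nlet v (NConst 0))
     (While (NLess (Nv v) e) (Seq c (Nlet v (NAdd (Nv v) (NConst 1)))))"

lemma mods_For [simp]: "nmods (For v e c) = insert v (nmods c)" "rmods (For v e c) = rmods c"
  by (auto simp: For_def)

text \<open>Per iteration, the 10 covers the increment and, apart from \<open>ncost e\<close>, the
  test; the other 10 covers the initialisation and the failing test. The bound expression must be
  stable under everything that the loop may modify.\<close>

lemma ok_For: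
  assumes init: "I 0 (s\<lparr>nmem := (nmem s)(v := (nmem s v)(0 := 0))\<rparr>)"
    and step: "\<And>i s'. i < N \<Longrightarrow> agree (insert v (nmods c)) (rmods c) s s' \<Longrightarrow> nmem s' v 0 = i \<Longrightarrow> I i s' \<Longrightarrow>
      ok c s' T (\<lambda>s''. I (Suc i) (s''\<lparr>nmem := (nmem s'')(v := (nmem s'' v)(0 := Suc i))\<rparr>))"
    and bound: "\<And>s'. agree (insert v (nmods c)) (rmods c) s s' \<Longrightarrow> nval e s' = N"
    and v: "v \<notin> nmods c" and T': "(T + ncost e + 10) * N + ncost e + 10 \<le> T'"
  shows "ok (For v e c) s T' (I N)"
proof -
  let ?ag = "agree (insert v (nmods c)) (rmods c) s"
  let ?b = "NLess (Nv v) e" and ?c = "Seq c (Nlet v (NAdd (Nv v) (NConst 1)))"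
  let ?s = "s\<lparr>nmem := (nmem s)(v := (nmem s v)(0 := 0))\<rparr>"
  define J where "J s' \<longleftrightarrow> ?ag s' \<and> nmem s' v 0 \<le> N \<and> I (nmem s' v 0) s'" for s'
  have "ok (While ?b ?c) ?s ((1 + bcost ?b + (T + 6)) * (N - nmem ?s v 0) + (1 + bcost ?b))
    (\<lambda>s'. J s' \<and> \<not> bval ?b s')"
  proof (rule ok_While[where \<mu> = "\<lambda>s. N - nmem s v 0"])
    show "J ?s" using init by (auto simp: J_def agree_def)
    fix s1 assume J1: "J s1" and b: "bval ?b s1"
    let ?i = "nmem s1 v 0"
    have ag: "?ag s1" using J1 by (simp add: J_def)
    have i: "?i < N" using b bound[OF ag] by simp
    have "ok ?c s1 (T + (1 + ncost (NConst 0) + ncost (NAdd (Nv v) (NConst 1))))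
      (\<lambda>s'. J s' \<and> N - nmem s' v 0 < N - ?i)"
    proof (rule ok_Seq[OF step[OF i ag refl]])
      show "I ?i s1" using J1 by (simp add: J_def)
      fix s2 assume I2: "I (Suc ?i) (s2\<lparr>nmem := (nmem s2)(v := (nmem s2 v)(0 := Suc ?i))\<rparr>)"
        and ag2: "agree (nmods c) (rmods c) s1 s2"
      have e: "nmem s2 v = nmem s1 v" using ag2 v by (simp add: agree_def)
      have "?ag (s2\<lparr>nmem := (nmem s2)(v := (nmem s2 v)(0 := Suc ?i))\<rparr>)"
        using ag ag2 by (auto simp: agree_def)
      then show "ok (Nlet v (NAdd (Nv v) (NConst 1))) s2 (1 + ncost (NConst 0) + ncost (NAdd (Nv v) (NConst 1)))
        (\<lambda>s'. J s' \<and> N - nmem s' v 0 < N - ?i)"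
        by (intro ok_run) (use I2 i in \<open>simp_all add: J_def e\<close>)
    qed simp
    then show "ok ?c s1 (T + 6) (\<lambda>s'. J s' \<and> N - nmem s' v 0 < N - ?i)"
      by (simp add: eval_nat_numeral)
  qed
  then have "ok (While ?b ?c) ?s ((T + ncost e + 10) * N + (ncost e + 4)) (\<lambda>s'. J s' \<and> \<not> bval ?b s')"
    by (rule ok_time) (simp add: algebra_simps)
  then have "ok (For v e c) s (3 + ((T + ncost e + 10) * N + (ncost e + 4))) (\<lambda>s'. J s' \<and> \<not> bval ?b s')"
    unfolding For_def by (intro ok_Seq_run[where T = "(T + ncost e + 10) * N + (ncost e + 4)"]) simp_all
  then show ?thesis
  proof (rule ok_weaken)
    fix s' assume "J s' \<and> \<not> bval ?b s'"
    then have "?ag s'" "nmem s' v 0 \<le> N" "I (nmem s' v 0) s'" "\<not> nmem s' v 0 < nval e s'" by (auto simp: J_def)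
    then show "I N s'" using bound[of s'] by simp
  qed (use T' in simp)
qed

text \<open>Beyond being a lower bound for all crossings, \<open>z\<close> carries a witness for its
  origin; this later places the stop in \<open>events\<close>.\<close>

definition next_event :: "real \<Rightarrow> real \<Rightarrow> (real \<Rightarrow> real) set \<Rightarrow> real \<Rightarrow> bool" where
  "next_event l r S z \<longleftrightarrow> l < z \<and> z \<le> r \<and> (\<forall>f\<in>S. z \<le> crossing l r f) \<and>
     (z = r \<or> (\<exists>f\<in>S. f l * f r < 0 \<and> z = crossing l r f))"

lemma next_event_empty: "l < r \<Longrightarrow> next_event l r {} r"
  by (simp add: next_event_def)

definition update_event :: com where
  "update_event = Cond (RLess (RMul (Rv ''fl'') (Rv ''fr'')) (RConst 0))
     (Seq (Rlet ''c'' (RAdd (Rv ''l'') (RMul (RSub (Rv ''r'') (Rv ''l''))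
         (RDiv (Rv ''fl'') (RSub (Rv ''fl'') (Rv ''fr''))))))
       (Cond (RLess (Rv ''c'') (Rv ''z'')) (Rlet ''z'' (Rv ''c'')) Skip))
     Skip"

lemma mods_update_event [simp]: "nmods update_event = {}" "rmods update_event = {''c'', ''z''}"
  by (auto simp: update_event_def)

lemma ok_update_event:
  assumes "l < r" "rmem s ''l'' 0 = l" "rmem s ''r'' 0 = r"
    and "rmem s ''fl'' 0 = f l" "rmem s ''fr'' 0 = f r" "next_event l r S (rmem s ''z'' 0)"
  shows "ok update_event s 60 (\<lambda>s'. next_event l r (insert f S) (rmem s' ''z'' 0))"
  using assms crossing_gt[OF assms(1), of f] unfolding update_event_def
  by (intro ok_run) (auto simp: next_event_def crossing_def)

section \<open>The next event and the rounded profits\<close>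

text \<open>The register \<open>sg\<close> holds the sign \<open>\<sigma>\<close>, \<open>l\<close> the current position of the sweep, \<open>r\<close> the end of a range
  without known events, \<open>z\<close> the first event found so far, and \<open>e\<close> the point at which \<open>U\<close> is evaluated.\<close>

definition profit_exp :: "rexp \<Rightarrow> nexp \<Rightarrow> rexp" where
  "profit_exp X i = RAdd (RMul (RGet ''a'' i) (RSub (RConst 1) (RMul (Rv ''sg'') X))) (RMul (RGet ''b'' i) X)"

lemma rcost_profit_exp [simp]: "rcost (profit_exp X i) = 10 + 2 * rcost X + 2 * ncost i"
  by (simp add: profit_exp_def)

definition dual_body :: com where
  "dual_body = Seq (Rlet ''d'' (RSub (profit_exp (Rv ''e'') (Nv ''i'')) (RMul (Rv ''mu'') (RGet ''w'' (Nv ''i'')))))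
     (Cond (RLess (RConst 0) (Rv ''d'')) (Rlet ''f'' (RAdd (Rv ''f'') (Rv ''d''))) Skip)"

definition dual_prog :: com where
  "dual_prog = Seq (Rlet ''f'' (RMul (Rv ''mu'') (Rv ''W''))) (For ''i'' (Nv ''n'') dual_body)"

text \<open>For \<open>j = 0\<close> the register \<open>U\<close> still holds a value from an
  earlier use, so it is overwritten unconditionally.\<close>

definition bound_body :: com where
  "bound_body = (Seq (Seq (Rlet ''mu'' (RDiv (profit_exp (Rv ''e'') (Nv ''j'')) (RGet ''w'' (Nv ''j''))))
            (Cond (RLess (Rv ''mu'') (RConst 0)) (Rlet ''mu'' (RConst 0)) Skip))
     (Seq dual_prog
       (Cond (Conj (NLess (NConst 0) (Nv ''j'')) (Neg (RLess (Rv ''f'') (Rv ''U'')))) Skip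
         (Rlet ''U'' (Rv ''f'')))))"

definition bound_prog :: com where
  "bound_prog = For ''j'' (NAdd (Nv ''n'') (NConst 1)) bound_body"

definition order_body :: com where
  "order_body = Seq (Seq
     (Rlet ''fl'' (RSub (RMul (RGet ''w'' (Nv ''j'')) (profit_exp (Rv ''l'') (Nv ''i'')))
                        (RMul (RGet ''w'' (Nv ''i'')) (profit_exp (Rv ''l'') (Nv ''j'')))))
     (Rlet ''fr'' (RSub (RMul (RGet ''w'' (Nv ''j'')) (profit_exp (Rv ''r'') (Nv ''i'')))
                        (RMul (RGet ''w'' (Nv ''i'')) (profit_exp (Rv ''r'') (Nv ''j''))))))
     update_event"

definition order_row :: com where
  "order_row = For ''j'' (NAdd (Nv ''n'') (NConst 1)) order_body"

definition order_prog :: com where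
  "order_prog = Seq (Rlet ''z'' (Rv ''r'')) (For ''i'' (NAdd (Nv ''n'') (NConst 1)) order_row)"

text \<open>The level is \<open>h + 1\<close>. Its real copy \<open>kr\<close> is counted along,
  since the machine cannot convert a counter into a real number.\<close>

definition level_body :: com where
  "level_body = Seq (Seq (Rlet ''kr'' (RAdd (Rv ''kr'') (RConst 1))) (Seq
     (Rlet ''fl'' (RSub (RMul (Rv ''mr'') (profit_exp (Rv ''l'') (Nv ''i''))) (RMul (Rv ''kr'') (Rv ''Ul''))))
     (Rlet ''fr'' (RSub (RMul (Rv ''mr'') (profit_exp (Rv ''r'') (Nv ''i''))) (RMul (Rv ''kr'') (Rv ''Ur''))))))
     update_event"

definition level_row :: com where
  "level_row = Seq (Rlet ''kr'' (RConst 0)) (For ''h'' (Nv ''m'') level_body)"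

definition level_prog :: com where
  "level_prog = Seq (Rlet ''z'' (Rv ''r'')) (For ''i'' (Nv ''n'') level_row)"

text \<open>All levels are tried in increasing order and a later success overwrites an earlier one;
  this search replaces the missing floor operation.\<close>

definition round_body :: com where
  "round_body = Seq (Rlet ''kr'' (RAdd (Rv ''kr'') (RConst 1)))
     (Cond (RLess (RMul (Rv ''mr'') (profit_exp (Rv ''e'') (Nv ''i''))) (RMul (Rv ''kr'') (Rv ''U''))) Skip
       (NSet ''q'' (Nv ''i'') (NAdd (Nv ''h'') (NConst 1))))"

definition round_row :: com where
  "round_row = Seq (Seq (NSet ''q'' (Nv ''i'') (NConst 0)) (Rlet ''kr'' (RConst 0)))
     (For ''h'' (Nv ''m'') round_body)"

definition round_prog :: com where
  "round_prog = For ''i'' (Nv ''n'') round_row"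

lemma mods_dual_body [simp]: "nmods dual_body = {}" "rmods dual_body = {''f'', ''d''}"
  by (auto simp: dual_body_def)

lemma mods_dual [simp]: "nmods dual_prog = {''i''}" "rmods dual_prog = {''f'', ''d''}"
  by (auto simp: dual_prog_def)

lemma mods_bound_body [simp]: "nmods bound_body = {''i''}" "rmods bound_body = {''f'', ''d'', ''mu'', ''U''}"
  by (auto simp: bound_body_def)

lemma mods_bound [simp]: "nmods bound_prog = {''i'', ''j''}" "rmods bound_prog = {''f'', ''d'', ''mu'', ''U''}"
  by (auto simp: bound_prog_def)

lemma mods_order_body [simp]: "nmods order_body = {}" "rmods order_body = {''z'', ''fl'', ''fr'', ''c''}"
  by (auto simp: order_body_def)

lemma mods_order_row [simp]: "nmods order_row = {''j''}" "rmods order_row = {''z'', ''fl'', ''fr'', ''c''}"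
  by (auto simp: order_row_def)

lemma mods_order [simp]: "nmods order_prog = {''i'', ''j''}" "rmods order_prog = {''z'', ''fl'', ''fr'', ''c''}"
  by (auto simp: order_prog_def)

lemma mods_level_body [simp]: "nmods level_body = {}" "rmods level_body = {''z'', ''kr'', ''fl'', ''fr'', ''c''}"
  by (auto simp: level_body_def)

lemma mods_level_row [simp]: "nmods level_row = {''h''}" "rmods level_row = {''z'', ''kr'', ''fl'', ''fr'', ''c''}"
  by (auto simp: level_row_def)

lemma mods_level [simp]: "nmods level_prog = {''i'', ''h''}" "rmods level_prog = {''z'', ''kr'', ''fl'', ''fr'', ''c''}"
  by (auto simp: level_prog_def)

lemma mods_round_body [simp]: "nmods round_body = {''q''}" "rmods round_body = {''kr''}"
  by (auto simp: round_body_def)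

lemma mods_round_row [simp]: "nmods round_row = {''h'', ''q''}" "rmods round_row = {''kr''}"
  by (auto simp: round_row_def)

lemma mods_round [simp]: "nmods round_prog = {''i'', ''h'', ''q''}" "rmods round_prog = {''kr''}"
  by (auto simp: round_prog_def)

section \<open>Correctness and cost of the computation of \<open>U\<close>, of the event searches
  and of the rounding\<close>

context sweep begin

definition env :: "real \<Rightarrow> ram \<Rightarrow> bool" where
  "env \<sigma> s \<longleftrightarrow> nmem s ''n'' 0 = n \<and> nmem s ''m'' 0 = m \<and> rmem s ''mr'' 0 = real m \<and>
     rmem s ''W'' 0 = W \<and> rmem s ''sg'' 0 = \<sigma> \<and>
     (\<forall>i\<le>n. rmem s ''w'' i = w i \<and> rmem s ''a'' i = a i \<and> rmem s ''b'' i = b i)"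

lemma env_agree:
  assumes "agree N R s s'" "env \<sigma> s" "N \<inter> {''n'', ''m''} = {}"
    "R \<inter> {''mr'', ''W'', ''sg'', ''w'', ''a'', ''b''} = {}"
  shows "env \<sigma> s'"
proof -
  have "nmem s' ''n'' = nmem s ''n''" "nmem s' ''m'' = nmem s ''m''"
    "rmem s' ''mr'' = rmem s ''mr''" "rmem s' ''W'' = rmem s ''W''" "rmem s' ''sg'' = rmem s ''sg''"
    "rmem s' ''w'' = rmem s ''w''" "rmem s' ''a'' = rmem s ''a''" "rmem s' ''b'' = rmem s ''b''"
    using assms(1,3,4) by (auto simp: agree_def)
  with assms(2) show ?thesis by (simp add: env_def)
qed

lemma rval_profit_exp: "env \<sigma> s \<Longrightarrow> nval i s \<le> n \<Longrightarrow> rval (profit_exp X i) s = p \<sigma> (rval X s) (nval i s)"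
  by (simp add: profit_exp_def env_def p_def)

lemma envD:
  assumes "env \<sigma> s"
  shows "nmem s ''n'' 0 = n" "nmem s ''m'' 0 = m" "rmem s ''mr'' 0 = real m" "rmem s ''W'' 0 = W"
    "\<And>i. i \<le> n \<Longrightarrow> rmem s ''w'' i = w i"
  using assms by (auto simp: env_def)

lemma ok_dual:
  assumes env: "env \<sigma> s" and e: "rmem s ''e'' 0 = x" and mu: "rmem s ''mu'' 0 = \<mu>"
  shows "ok dual_prog s (100 * (n + 1)) (\<lambda>s'. rmem s' ''f'' 0 = dual_obj n W w (p \<sigma> x) \<mu>)"
  unfolding dual_prog_def
proof (rule ok_Seq_run)
  define r where "r = run (Rlet ''f'' (RMul (Rv ''mu'') (Rv ''W''))) s"
  define I where "I i s' \<longleftrightarrow> rmem s' ''f'' 0 = \<mu> * W + (\<Sum>i'<i. max 0 (p \<sigma> x i' - \<mu> * w i'))" for i and s' :: ram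
  have r: "env \<sigma> r" "rmem r ''e'' 0 = x" "rmem r ''mu'' 0 = \<mu>" "rmem r ''f'' 0 = \<mu> * W"
    using assms by (auto simp: r_def env_def)
  have "ok (For ''i'' (Nv ''n'') dual_body) r (92 * n + 12) (I n)"
  proof (rule ok_For[where T = 80])
    fix i s'
    assume i: "i < n" and ag: "agree (insert ''i'' (nmods dual_body)) (rmods dual_body) r s'"
      and si: "nmem s' ''i'' 0 = i" and I: "I i s'"
    have s': "env \<sigma> s'" "rmem s' ''e'' 0 = x" "rmem s' ''mu'' 0 = \<mu>"
      using env_agree[OF ag r(1)] agreeR[OF ag] r by simp_all
    show "ok dual_body s' 80 (\<lambda>s''. I (Suc i) (s''\<lparr>nmem := (nmem s'')(''i'' := (nmem s'' ''i'')(0 := Suc i))\<rparr>))"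
      unfolding dual_body_def
      by (intro ok_run) (use i I s' in \<open>auto simp: I_def si rval_profit_exp envD[OF s'(1)]\<close>)
  qed (use r in \<open>auto simp: env_def agreeN I_def\<close>)
  then show "ok (For ''i'' (Nv ''n'') dual_body) (run (Rlet ''f'' (RMul (Rv ''mu'') (Rv ''W''))) s) (92 * n + 12)
     (\<lambda>s'. rmem s' ''f'' 0 = dual_obj n W w (p \<sigma> x) \<mu>)"
    by (simp add: r_def I_def[abs_def] dual_obj_def)
qed auto

lemma ok_bound:
  assumes env: "env \<sigma> s" and e: "rmem s ''e'' 0 = x"
  shows "ok bound_prog s (400 * ((n + 1) * (n + 1))) (\<lambda>s'. rmem s' ''U'' 0 = U \<sigma> x)"
proof -
  define g where "g j = dual_obj n W w (p \<sigma> x) (ratio w (p \<sigma> x) j)" for j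
  define I where "I j s' \<longleftrightarrow> (\<forall>j'<j. rmem s' ''U'' 0 \<le> g j') \<and> (0 < j \<longrightarrow> (\<exists>j'<j. rmem s' ''U'' 0 = g j'))" for j and s' :: ram
  have "ok bound_prog s (400 * ((n + 1) * (n + 1))) (I (n + 1))"
    unfolding bound_prog_def
  proof (rule ok_For[where T = "100 * (n + 1) + 200"])
    fix j s'
    assume j: "j < n + 1" and ag: "agree (insert ''j'' (nmods bound_body)) (rmods bound_body) s s'"
      and sj: "nmem s' ''j'' 0 = j" and I: "I j s'"
    have s': "env \<sigma> s'" "rmem s' ''e'' 0 = x"
      using env_agree[OF ag env] agreeR[OF ag] e by simp_all
    define c where "c = Seq (Rlet ''mu'' (RDiv (profit_exp (Rv ''e'') (Nv ''j'')) (RGet ''w'' (Nv ''j''))))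
            (Cond (RLess (Rv ''mu'') (RConst 0)) (Rlet ''mu'' (RConst 0)) Skip)"
    define d where "d = Cond (Conj (NLess (NConst 0) (Nv ''j'')) (Neg (RLess (Rv ''f'') (Rv ''U'')))) Skip
         (Rlet ''U'' (Rv ''f''))"
    define r where "r = run c s'"
    have r: "env \<sigma> r" "rmem r ''e'' 0 = x" "rmem r ''mu'' 0 = ratio w (p \<sigma> x) j" "nmem r ''j'' 0 = j"
      "rmem r ''U'' 0 = rmem s' ''U'' 0"
      using s' j by (auto simp: r_def c_def sj ratio_def rval_profit_exp envD[OF s'(1)]) (auto simp: env_def)
    have "ok (Seq dual_prog d) r (100 * (n + 1) + 100)
      (\<lambda>s''. I (Suc j) (s''\<lparr>nmem := (nmem s'')(''j'' := (nmem s'' ''j'')(0 := Suc j))\<rparr>))"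
    proof (rule ok_Seq[OF ok_dual[OF r(1-3)]])
      fix s2 assume f: "rmem s2 ''f'' 0 = dual_obj n W w (p \<sigma> x) (ratio w (p \<sigma> x) j)"
        and ag2: "agree (nmods dual_prog) (rmods dual_prog) r s2"
      have s2: "nmem s2 ''j'' 0 = j" "rmem s2 ''U'' 0 = rmem s' ''U'' 0"
        using agreeR[OF ag2] agreeN[OF ag2] r by simp_all
      have f': "rmem s2 ''f'' 0 = g j" using f by (simp add: g_def)
      show "ok d s2 100 (\<lambda>s''. I (Suc j) (s''\<lparr>nmem := (nmem s'')(''j'' := (nmem s'' ''j'')(0 := Suc j))\<rparr>))"
        unfolding d_def using I
        by (intro ok_run) (auto simp: I_def s2 f' less_Suc_eq not_less)
    qed simp
    then show "ok bound_body s' (100 * (n + 1) + 200)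
      (\<lambda>s''. I (Suc j) (s''\<lparr>nmem := (nmem s'')(''j'' := (nmem s'' ''j'')(0 := Suc j))\<rparr>))"
      unfolding bound_body_def c_def[symmetric] d_def[symmetric] r_def
      by (rule ok_Seq_run[rotated]) (simp_all add: c_def)
  qed (use env in \<open>auto simp: env_def agreeN I_def algebra_simps\<close>)
  then show ?thesis
  proof (rule ok_weaken)
    fix s' assume "I (n + 1) s'"
    then have "U \<sigma> x = rmem s' ''U'' 0"
      unfolding U_def by (intro lp_bound_eqI) (auto simp: I_def g_def less_Suc_eq_le)
    then show "rmem s' ''U'' 0 = U \<sigma> x" by simp
  qed simp
qed

lemma ok_order:
  assumes env: "env \<sigma> s" and l: "rmem s ''l'' 0 = l" and r: "rmem s ''r'' 0 = r" and lr: "l < r"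
  shows "ok order_prog s (600 * ((n + 1) * (n + 1)))
    (\<lambda>s'. next_event l r ((\<lambda>(i, j). order_diff \<sigma> i j) ` ({..n} \<times> {..n})) (rmem s' ''z'' 0))"
proof -
  define S where "S i = (\<lambda>(i, j). order_diff \<sigma> i j) ` ({..<i} \<times> {..n})" for i
  define I where "I i s' \<longleftrightarrow> next_event l r (S i) (rmem s' ''z'' 0)" for i and s' :: ram
  define J where "J i j s' \<longleftrightarrow> next_event l r (S i \<union> order_diff \<sigma> i ` {..<j}) (rmem s' ''z'' 0)" for i j and s' :: ram
  define s1 where "s1 = run (Rlet ''z'' (Rv ''r'')) s"
  have s1: "env \<sigma> s1" "rmem s1 ''l'' 0 = l" "rmem s1 ''r'' 0 = r" "rmem s1 ''z'' 0 = r"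
    using assms by (auto simp: s1_def env_def)
  have "ok (For ''i'' (NAdd (Nv ''n'') (NConst 1)) order_row) s1 (500 * ((n + 1) * (n + 1))) (I (n + 1))"
  proof (rule ok_For[where T = "400 * (n + 1)"])
    fix i s'
    assume i: "i < n + 1" and ag: "agree (insert ''i'' (nmods order_row)) (rmods order_row) s1 s'"
      and si: "nmem s' ''i'' 0 = i" and I: "I i s'"
    have s': "env \<sigma> s'" "rmem s' ''l'' 0 = l" "rmem s' ''r'' 0 = r"
      using env_agree[OF ag s1(1)] agreeR[OF ag] s1 by simp_all
    have "ok order_row s' (400 * (n + 1)) (J i (n + 1))"
      unfolding order_row_def
    proof (rule ok_For[where T = 250])
      fix j t
      assume j: "j < n + 1" and ag2: "agree (insert ''j'' (nmods order_body)) (rmods order_body) s' t"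
        and tj: "nmem t ''j'' 0 = j" and J: "J i j t"
      have t: "env \<sigma> t" "rmem t ''l'' 0 = l" "rmem t ''r'' 0 = r" "nmem t ''i'' 0 = i"
        using env_agree[OF ag2 s'(1)] agreeR[OF ag2] agreeN[OF ag2] s' si by simp_all
      show "ok order_body t 250
        (\<lambda>s''. J i (Suc j) (s''\<lparr>nmem := (nmem s'')(''j'' := (nmem s'' ''j'')(0 := Suc j))\<rparr>))"
        unfolding order_body_def
      proof (rule ok_Seq_run)
        show "ok update_event (run (Seq
           (Rlet ''fl'' (RSub (RMul (RGet ''w'' (Nv ''j'')) (profit_exp (Rv ''l'') (Nv ''i'')))
                              (RMul (RGet ''w'' (Nv ''i'')) (profit_exp (Rv ''l'') (Nv ''j'')))))
           (Rlet ''fr'' (RSub (RMul (RGet ''w'' (Nv ''j'')) (profit_exp (Rv ''r'') (Nv ''i'')))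
                              (RMul (RGet ''w'' (Nv ''i'')) (profit_exp (Rv ''r'') (Nv ''j'')))))) t) 60
          (\<lambda>s''. J i (Suc j) (s''\<lparr>nmem := (nmem s'')(''j'' := (nmem s'' ''j'')(0 := Suc j))\<rparr>))"
          (is "ok _ (run ?c t) _ _")
        proof -
          have v: "rval (profit_exp X e) (t\<lparr>rmem := (rmem t)(''fl'' := g)\<rparr>) = p \<sigma> (rval X (t\<lparr>rmem := (rmem t)(''fl'' := g)\<rparr>)) (nval e t)"
            if "nval e t \<le> n" "nval e (t\<lparr>rmem := (rmem t)(''fl'' := g)\<rparr>) = nval e t" for X e g
            using that t(1) by (subst rval_profit_exp) (auto simp: env_def)
          have "ok update_event (run ?c t) 60
            (\<lambda>s''. next_event l r (insert (order_diff \<sigma> i j) (S i \<union> order_diff \<sigma> i ` {..<j})) (rmem s'' ''z'' 0))"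
            using J i j tj by (intro ok_update_event lr)
              (auto simp: t v rval_profit_exp[OF t(1)] envD[OF t(1)] order_diff_def J_def)
          then show ?thesis
            by (rule ok_weaken) (simp_all add: J_def lessThan_Suc)
        qed
      qed auto
    next
      show "J i 0 (s'\<lparr>nmem := (nmem s')(''j'' := (nmem s' ''j'')(0 := 0))\<rparr>)" using I by (simp add: I_def J_def)
    qed (use s'(1) in \<open>auto simp: env_def agreeN algebra_simps\<close>)
    then show "ok order_row s' (400 * (n + 1))
      (\<lambda>s''. I (Suc i) (s''\<lparr>nmem := (nmem s'')(''i'' := (nmem s'' ''i'')(0 := Suc i))\<rparr>))"
    proof (rule ok_weaken)
      have "S (Suc i) = S i \<union> order_diff \<sigma> i ` {..<n + 1}"
        by (force simp: S_def less_Suc_eq less_Suc_eq_le image_iff)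
      then show "I (Suc i) (s''\<lparr>nmem := (nmem s'')(''i'' := (nmem s'' ''i'')(0 := Suc i))\<rparr>)" if "J i (n + 1) s''" for s''
        using that by (simp add: I_def J_def)
    qed simp
  next
    show "I 0 (s1\<lparr>nmem := (nmem s1)(''i'' := (nmem s1 ''i'')(0 := 0))\<rparr>)"
      using next_event_empty[OF lr] by (simp add: I_def S_def s1)
  qed (use s1(1) in \<open>auto simp: env_def agreeN algebra_simps\<close>)
  then show ?thesis
    unfolding order_prog_def s1_def
    by (rule ok_Seq_run[rotated, OF ok_weaken]) (auto simp: I_def S_def lessThan_Suc_atMost)
qed

lemma ok_level:
  assumes env: "env \<sigma> s" and l: "rmem s ''l'' 0 = l" and r: "rmem s ''r'' 0 = r" and lr: "l < r"
    and Ul: "rmem s ''Ul'' 0 = U \<sigma> l" and Ur: "rmem s ''Ur'' 0 = U \<sigma> r"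
  shows "ok level_prog s (600 * ((n + 1) * (m + 1)))
    (\<lambda>s'. next_event l r ((\<lambda>(i, k). level_diff \<sigma> i k) ` ({..<n} \<times> {1..m})) (rmem s' ''z'' 0))"
proof -
  define S where "S i = (\<lambda>(i, k). level_diff \<sigma> i k) ` ({..<i} \<times> {1..m})" for i
  define I where "I i s' \<longleftrightarrow> next_event l r (S i) (rmem s' ''z'' 0)" for i and s' :: ram
  define J where "J i h s' \<longleftrightarrow> next_event l r (S i \<union> level_diff \<sigma> i ` {1..h}) (rmem s' ''z'' 0) \<and>
    rmem s' ''kr'' 0 = real h" for i h and s' :: ram
  define s1 where "s1 = run (Rlet ''z'' (Rv ''r'')) s"
  have s1: "env \<sigma> s1" "rmem s1 ''l'' 0 = l" "rmem s1 ''r'' 0 = r" "rmem s1 ''z'' 0 = r"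
    "rmem s1 ''Ul'' 0 = U \<sigma> l" "rmem s1 ''Ur'' 0 = U \<sigma> r"
    using assms by (auto simp: s1_def env_def)
  have "ok (For ''i'' (Nv ''n'') level_row) s1 (500 * ((n + 1) * (m + 1))) (I n)"
  proof (rule ok_For[where T = "400 * (m + 1)"])
    fix i s'
    assume i: "i < n" and ag: "agree (insert ''i'' (nmods level_row)) (rmods level_row) s1 s'"
      and si: "nmem s' ''i'' 0 = i" and I: "I i s'"
    define s2 where "s2 = run (Rlet ''kr'' (RConst 0)) s'"
    have s': "env \<sigma> s'" "rmem s' ''l'' 0 = l" "rmem s' ''r'' 0 = r" "rmem s' ''Ul'' 0 = U \<sigma> l" "rmem s' ''Ur'' 0 = U \<sigma> r"
      using env_agree[OF ag s1(1)] agreeR[OF ag] s1 by simp_all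
    then have s2: "env \<sigma> s2" "rmem s2 ''l'' 0 = l" "rmem s2 ''r'' 0 = r" "rmem s2 ''Ul'' 0 = U \<sigma> l" "rmem s2 ''Ur'' 0 = U \<sigma> r"
      "nmem s2 ''i'' 0 = i" "rmem s2 ''kr'' 0 = 0" "rmem s2 ''z'' 0 = rmem s' ''z'' 0"
      by (auto simp: s2_def env_def si)
    have "ok (For ''h'' (Nv ''m'') level_body) s2 (300 * (m + 1)) (J i m)"
    proof (rule ok_For[where T = 250])
      fix h t
      assume h: "h < m" and ag2: "agree (insert ''h'' (nmods level_body)) (rmods level_body) s2 t"
        and th: "nmem t ''h'' 0 = h" and J: "J i h t"
      have t: "env \<sigma> t" "rmem t ''l'' 0 = l" "rmem t ''r'' 0 = r" "nmem t ''i'' 0 = i"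
        "rmem t ''Ul'' 0 = U \<sigma> l" "rmem t ''Ur'' 0 = U \<sigma> r" "rmem t ''kr'' 0 = real h"
        using env_agree[OF ag2 s2(1)] agreeR[OF ag2] agreeN[OF ag2] s2 si J by (simp_all add: J_def)
      define c where "c = Seq (Rlet ''kr'' (RAdd (Rv ''kr'') (RConst 1))) (Seq
         (Rlet ''fl'' (RSub (RMul (Rv ''mr'') (profit_exp (Rv ''l'') (Nv ''i''))) (RMul (Rv ''kr'') (Rv ''Ul''))))
         (Rlet ''fr'' (RSub (RMul (Rv ''mr'') (profit_exp (Rv ''r'') (Nv ''i''))) (RMul (Rv ''kr'') (Rv ''Ur'')))))"
      have v: "rval (profit_exp X (Nv ''i'')) (t\<lparr>rmem := g\<rparr>) = p \<sigma> (rval X (t\<lparr>rmem := g\<rparr>)) i"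
        if "env \<sigma> (t\<lparr>rmem := g\<rparr>)" for X g
        using that t(4) i by (subst rval_profit_exp) auto
      have "ok update_event (run c t) 60
        (\<lambda>s''. next_event l r (insert (level_diff \<sigma> i (Suc h)) (S i \<union> level_diff \<sigma> i ` {1..h})) (rmem s'' ''z'' 0))"
      proof (intro ok_update_event lr)
        have [simp]: "env \<sigma> (t\<lparr>rmem := (rmem t)(''kr'' := g)\<rparr>)" "env \<sigma> (t\<lparr>rmem := (rmem t)(''kr'' := g, ''fl'' := g')\<rparr>)" for g g'
          using t(1) by (auto simp: env_def)
        show "rmem (run c t) ''fl'' 0 = level_diff \<sigma> i (Suc h) l" "rmem (run c t) ''fr'' 0 = level_diff \<sigma> i (Suc h) r"
          by (simp_all add: c_def t v envD[OF t(1)] level_diff_def algebra_simps)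
      qed (use J in \<open>auto simp: c_def t J_def\<close>)
      then show "ok level_body t 250
        (\<lambda>s''. J i (Suc h) (s''\<lparr>nmem := (nmem s'')(''h'' := (nmem s'' ''h'')(0 := Suc h))\<rparr>))"
        unfolding level_body_def c_def[symmetric]
      proof (rule ok_Seq_run[rotated, OF ok_weaken])
        fix s'' assume "agree (nmods update_event) (rmods update_event) (run c t) s''"
          and ne: "next_event l r (insert (level_diff \<sigma> i (Suc h)) (S i \<union> level_diff \<sigma> i ` {1..h})) (rmem s'' ''z'' 0)"
        then have "rmem s'' ''kr'' 0 = rmem (run c t) ''kr'' 0" by (simp add: agreeR)
        also have "\<dots> = real (Suc h)" by (simp add: c_def t)
        finally show "J i (Suc h) (s''\<lparr>nmem := (nmem s'')(''h'' := (nmem s'' ''h'')(0 := Suc h))\<rparr>)"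
          using ne by (simp add: J_def atLeastAtMostSuc_conv)
      qed (auto simp: c_def)
    next
      show "J i 0 (s2\<lparr>nmem := (nmem s2)(''h'' := (nmem s2 ''h'')(0 := 0))\<rparr>)"
        using I by (simp add: I_def J_def s2)
    qed (use s2(1) in \<open>auto simp: env_def agreeN algebra_simps\<close>)
    then show "ok level_row s' (400 * (m + 1))
      (\<lambda>s''. I (Suc i) (s''\<lparr>nmem := (nmem s'')(''i'' := (nmem s'' ''i'')(0 := Suc i))\<rparr>))"
      unfolding level_row_def s2_def
    proof (rule ok_Seq_run[rotated, OF ok_weaken])
      have "S (Suc i) = S i \<union> level_diff \<sigma> i ` {1..m}"
        by (force simp: S_def less_Suc_eq image_iff)
      then show "I (Suc i) (s''\<lparr>nmem := (nmem s'')(''i'' := (nmem s'' ''i'')(0 := Suc i))\<rparr>)" if "J i m s''" for s''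
        using that by (simp add: I_def J_def)
    qed auto
  next
    show "I 0 (s1\<lparr>nmem := (nmem s1)(''i'' := (nmem s1 ''i'')(0 := 0))\<rparr>)"
      using next_event_empty[OF lr] by (simp add: I_def S_def s1)
  qed (use s1(1) in \<open>auto simp: env_def agreeN algebra_simps\<close>)
  then show ?thesis
    unfolding level_prog_def s1_def
    by (rule ok_Seq_run[rotated, OF ok_weaken]) (auto simp: I_def S_def)
qed

lemma ok_round:
  assumes env: "env \<sigma> s" and e: "rmem s ''e'' 0 = x" and U: "rmem s ''U'' 0 = U \<sigma> x"
  shows "ok round_prog s (600 * ((n + 1) * (m + 1))) (\<lambda>s'. rounded \<sigma> x (nmem s' ''q''))"
proof -
  \<comment> \<open>The rounding condition of item \<open>i\<close> restricted to the levels up to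
    \<open>h\<close>; for \<open>h = m\<close> it is the one in \<open>rounded\<close>.\<close>
  define R where "R i h v \<longleftrightarrow> v \<le> h \<and> (1 \<le> v \<longrightarrow> 0 \<le> level_diff \<sigma> i v x) \<and>
     (\<forall>k. v < k \<longrightarrow> k \<le> h \<longrightarrow> level_diff \<sigma> i k x < 0)" for i h v
  define I where "I i s' \<longleftrightarrow> (\<forall>i'<i. R i' m (nmem s' ''q'' i'))" for i and s' :: ram
  define J where "J i h s' \<longleftrightarrow> I i s' \<and> R i h (nmem s' ''q'' i) \<and> rmem s' ''kr'' 0 = real h" for i h and s' :: ram
  have "ok round_prog s (600 * ((n + 1) * (m + 1))) (I n)"
    unfolding round_prog_def
  proof (rule ok_For[where T = "300 * (m + 1)"])
    fix i s'
    assume i: "i < n" and ag: "agree (insert ''i'' (nmods round_row)) (rmods round_row) s s'"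
      and si: "nmem s' ''i'' 0 = i" and I: "I i s'"
    have s': "env \<sigma> s'" "rmem s' ''e'' 0 = x" "rmem s' ''U'' 0 = U \<sigma> x"
      using env_agree[OF ag env] agreeR[OF ag] e U by simp_all
    define c where "c = Seq (NSet ''q'' (Nv ''i'') (NConst 0)) (Rlet ''kr'' (RConst 0))"
    define s2 where "s2 = run c s'"
    have s2: "env \<sigma> s2" "rmem s2 ''e'' 0 = x" "rmem s2 ''U'' 0 = U \<sigma> x" "nmem s2 ''i'' 0 = i" "J i 0 s2"
      using s' I by (auto simp: s2_def c_def env_def si J_def I_def R_def)
    have "ok (For ''h'' (Nv ''m'') round_body) s2 (200 * (m + 1)) (J i m)"
    proof (rule ok_For[where T = 100])
      fix h t
      assume h: "h < m" and ag2: "agree (insert ''h'' (nmods round_body)) (rmods round_body) s2 t"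
        and th: "nmem t ''h'' 0 = h" and J: "J i h t"
      have t: "env \<sigma> t" "rmem t ''e'' 0 = x" "rmem t ''U'' 0 = U \<sigma> x" "nmem t ''i'' 0 = i" "rmem t ''kr'' 0 = real h"
        using env_agree[OF ag2 s2(1)] agreeR[OF ag2] agreeN[OF ag2] s2 J by (simp_all add: J_def)
      have v: "rval (profit_exp X (Nv ''i'')) (t\<lparr>rmem := (rmem t)(''kr'' := g)\<rparr>) = p \<sigma> (rval X (t\<lparr>rmem := (rmem t)(''kr'' := g)\<rparr>)) i" for X g
        using t i by (subst rval_profit_exp) (auto simp: env_def)
      have R: "R i h (nmem t ''q'' i)" "\<forall>i'<i. R i' m (nmem t ''q'' i')" using J by (auto simp: J_def I_def)
      have lt: "real m * p \<sigma> x i < (real h + 1) * U \<sigma> x \<longleftrightarrow> level_diff \<sigma> i (Suc h) x < 0"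
        by (simp add: level_diff_def add.commute)
      have up: "level_diff \<sigma> i (Suc h) x < 0 \<Longrightarrow> R i (Suc h) (nmem t ''q'' i)"
        "\<not> level_diff \<sigma> i (Suc h) x < 0 \<Longrightarrow> R i (Suc h) (Suc h)"
        using R(1) by (auto simp: R_def le_Suc_eq)
      show "ok round_body t 100
        (\<lambda>s''. J i (Suc h) (s''\<lparr>nmem := (nmem s'')(''h'' := (nmem s'' ''h'')(0 := Suc h))\<rparr>))"
        unfolding round_body_def
        by (intro ok_run) (use up R in \<open>auto simp: J_def I_def t v th envD[OF t(1)] lt\<close>)
    qed (use s2 in \<open>auto simp: env_def agreeN algebra_simps J_def I_def\<close>)
    then show "ok round_row s' (300 * (m + 1))
      (\<lambda>s''. I (Suc i) (s''\<lparr>nmem := (nmem s'')(''i'' := (nmem s'' ''i'')(0 := Suc i))\<rparr>))"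
      unfolding round_row_def s2_def c_def
      by (rule ok_Seq_run[rotated, OF ok_weaken]) (auto simp: J_def I_def less_Suc_eq)
  qed (use env in \<open>auto simp: env_def agreeN algebra_simps I_def\<close>)
  then show ?thesis by (rule ok_weaken) (auto simp: I_def R_def rounded_def)
qed

end

section \<open>The dynamic program\<close>

text \<open>Row \<open>i\<close> of the table \<open>D\<close> starts at \<open>i * (m + 1)\<close>; as there is no multiplication of addresses, \<open>rb\<close> and
  \<open>rc\<close> hold the starts of two consecutive rows.\<close>

definition table_body :: com where
  "table_body = (let c = RAdd (RGet ''D'' (NAdd (Nv ''rb'') (NSub (Nv ''v'') (NGet ''q'' (Nv ''i''))))) (RGet ''w'' (Nv ''i''));
       d = RGet ''D'' (NAdd (Nv ''rb'') (Nv ''v'')) in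
     Cond (Conj (Neg (NLess (Nv ''v'') (NGet ''q'' (Nv ''i'')))) (RLess c d))
       (RSet ''D'' (NAdd (Nv ''rc'') (Nv ''v'')) c) (RSet ''D'' (NAdd (Nv ''rc'') (Nv ''v'')) d))"

definition table_row :: com where
  "table_row = Seq (For ''v'' (NAdd (Nv ''m'') (NConst 1)) table_body)
     (Seq (Nlet ''rb'' (Nv ''rc'')) (Nlet ''rc'' (NAdd (Nv ''rc'') (NAdd (Nv ''m'') (NConst 1)))))"

definition table_init_body :: com where
  "table_init_body = RSet ''D'' (Nv ''v'') (RAdd (Rv ''W'') (RConst 1))"

definition table_prog :: com where
  "table_prog = Seq (For ''v'' (NAdd (Nv ''m'') (NConst 1)) table_init_body)
     (Seq (Seq (Rlet ''D'' (RConst 0)) (Seq (Nlet ''rb'' (NConst 0)) (Nlet ''rc'' (NAdd (Nv ''m'') (NConst 1)))))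
       (For ''i'' (Nv ''n'') table_row))"

definition best_body :: com where
  "best_body = Cond (RLess (Rv ''W'') (RGet ''D'' (NAdd (Nv ''rb'') (Nv ''v'')))) Skip (Nlet ''V'' (Nv ''v''))"

definition best_prog :: com where
  "best_prog = Seq (Nlet ''V'' (NConst 0)) (For ''v'' (NAdd (Nv ''m'') (NConst 1)) best_body)"

definition back_body :: com where
  "back_body = Seq (Nlet ''rc'' (NSub (Nv ''rb'') (NAdd (Nv ''m'') (NConst 1))))
     (Seq (Nlet ''y'' (NSub (Nv ''n'') (NAdd (Nv ''i'') (NConst 1))))
     (Seq (Cond (RLess (RGet ''D'' (NAdd (Nv ''rb'') (Nv ''V''))) (RGet ''D'' (NAdd (Nv ''rc'') (Nv ''V''))))
         (Seq (NSet ''x'' (NAdd (Nv ''off'') (Nv ''y'')) (NConst 1)) (Nlet ''V'' (NSub (Nv ''V'') (NGet ''q'' (Nv ''y'')))))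
         (NSet ''x'' (NAdd (Nv ''off'') (Nv ''y'')) (NConst 0)))
       (Nlet ''rb'' (Nv ''rc''))))"

definition back_prog :: com where
  "back_prog = For ''i'' (Nv ''n'') back_body"

lemma mods_table_body [simp]: "nmods table_body = {}" "rmods table_body = {''D''}"
  by (auto simp: table_body_def Let_def)

lemma mods_table_row [simp]: "nmods table_row = {''v'', ''rb'', ''rc''}" "rmods table_row = {''D''}"
  by (auto simp: table_row_def)

lemma mods_table_init_body [simp]: "nmods table_init_body = {}" "rmods table_init_body = {''D''}"
  by (auto simp: table_init_body_def)

lemma mods_table [simp]: "nmods table_prog = {''i'', ''v'', ''rb'', ''rc''}" "rmods table_prog = {''D''}"
  by (auto simp: table_prog_def)

lemma mods_best_body [simp]: "nmods best_body = {''V''}" "rmods best_body = {}"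
  by (auto simp: best_body_def)

lemma mods_best [simp]: "nmods best_prog = {''v'', ''V''}" "rmods best_prog = {}"
  by (auto simp: best_prog_def)

lemma mods_back_body [simp]: "nmods back_body = {''rc'', ''y'', ''x'', ''V'', ''rb''}" "rmods back_body = {}"
  by (auto simp: back_body_def)

lemma mods_back [simp]: "nmods back_prog = {''i'', ''rc'', ''y'', ''x'', ''V'', ''rb''}" "rmods back_prog = {}"
  by (auto simp: back_prog_def)

section \<open>Correctness and cost of the dynamic program\<close>

context sweep begin

text \<open>Every weight above \<open>W\<close> stands for infinity.\<close>

primrec min_weight :: "(nat \<Rightarrow> nat) \<Rightarrow> nat \<Rightarrow> nat \<Rightarrow> real" where
  "min_weight q 0 v = (if v = 0 then 0 else W + 1)"
| "min_weight q (Suc i) v = (if q i \<le> v \<and> min_weight q i (v - q i) + w i < min_weight q i v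
     then min_weight q i (v - q i) + w i else min_weight q i v)"

text \<open>One half of the meaning of the table: entries are lower bounds for weights. That an
  entry within the capacity is attained is shown by the backtracking itself.\<close>

lemma min_weight_le:
  assumes "\<forall>j<i. x j \<in> {0, 1::nat}"
  shows "min_weight q i (\<Sum>j<i. q j * x j) \<le> (\<Sum>j<i. w j * real (x j))"
  using assms
proof (induction i)
  case (Suc i)
  let ?v = "\<Sum>j<i. q j * x j"
  have IH: "min_weight q i ?v \<le> (\<Sum>j<i. w j * real (x j))" using Suc by simp
  have "x i = 0 \<or> x i = 1" using Suc.prems by auto
  then show ?case
  proof
    assume "x i = 0"
    then show ?thesis using IH by simp
  next
    assume "x i = 1"
    then show ?thesis using IH by (auto simp: not_less)
  qed
qed simp

definition row :: "nat \<Rightarrow> nat" where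
  "row i = i * (m + 1)"

lemma row_0 [simp]: "row 0 = 0" and row_Suc: "row (Suc i) = row i + Suc m"
  by (simp_all add: row_def)

text \<open>Writing row \<open>Suc i\<close> leaves the earlier rows intact, which the backtracking
  still reads.\<close>

lemma row_less: "i' \<le> i \<Longrightarrow> v \<le> m \<Longrightarrow> row i' + v < row (Suc i)"
proof -
  assume "i' \<le> i" "v \<le> m"
  then have "row i' + v < row (Suc i')" by (simp add: row_Suc)
  also have "\<dots> \<le> row (Suc i)" unfolding row_def using \<open>i' \<le> i\<close> by (intro mult_le_mono1) simp
  finally show ?thesis .
qed

definition table :: "(nat \<Rightarrow> nat) \<Rightarrow> nat \<Rightarrow> ram \<Rightarrow> bool" where
  "table q i s \<longleftrightarrow> (\<forall>i'\<le>i. \<forall>v\<le>m. rmem s ''D'' (row i' + v) = min_weight q i' v)"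

lemma ok_table:
  assumes env: "env \<sigma> s"
  shows "ok table_prog s (600 * ((n + 1) * (m + 1)))
    (\<lambda>s'. table (nmem s ''q'') n s' \<and> nmem s' ''rb'' 0 = row n)"
proof -
  define q where "q = nmem s ''q''"
  define I0 where "I0 v s' \<longleftrightarrow> (\<forall>v'<v. rmem s' ''D'' v' = W + 1)" for v and s' :: ram
  define I where "I i s' \<longleftrightarrow> table q i s' \<and> nmem s' ''rb'' 0 = row i \<and> nmem s' ''rc'' 0 = row (Suc i)"
    for i and s' :: ram
  define J where "J i v s' \<longleftrightarrow> I i s' \<and> (\<forall>v'<v. rmem s' ''D'' (row (Suc i) + v') = min_weight q (Suc i) v')"
    for i v and s' :: ram
  let ?c = "Seq (Rlet ''D'' (RConst 0)) (Seq (Nlet ''rb'' (NConst 0)) (Nlet ''rc'' (NAdd (Nv ''m'') (NConst 1))))"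
  have init: "ok (For ''v'' (NAdd (Nv ''m'') (NConst 1)) table_init_body) s (40 * (m + 1)) (I0 (m + 1))"
  proof (rule ok_For[where T = 10])
    fix v s'
    assume v: "v < m + 1" and ag: "agree (insert ''v'' (nmods table_init_body)) (rmods table_init_body) s s'"
      and sv: "nmem s' ''v'' 0 = v" and I0: "I0 v s'"
    have s': "env \<sigma> s'" using env_agree[OF ag env] by simp
    show "ok table_init_body s' 10 (\<lambda>s''. I0 (Suc v) (s''\<lparr>nmem := (nmem s'')(''v'' := (nmem s'' ''v'')(0 := Suc v))\<rparr>))"
      unfolding table_init_body_def
      by (intro ok_run) (use I0 in \<open>auto simp: I0_def sv less_Suc_eq envD[OF s']\<close>)
  qed (use env in \<open>auto simp: env_def agreeN I0_def\<close>)
  show ?thesis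
    unfolding table_prog_def
  proof (rule ok_Seq[OF init])
    fix s1 assume I0: "I0 (m + 1) s1"
      and ag1: "agree (nmods (For ''v'' (NAdd (Nv ''m'') (NConst 1)) table_init_body))
        (rmods (For ''v'' (NAdd (Nv ''m'') (NConst 1)) table_init_body)) s s1"
    define s2 where "s2 = run ?c s1"
    have s1: "env \<sigma> s1" "nmem s1 ''q'' = q" using env_agree[OF ag1 env] agreeN[OF ag1] by (simp_all add: q_def)
    then have s2: "env \<sigma> s2" "nmem s2 ''q'' = q" "I 0 s2"
      using I0 by (auto simp: s2_def env_def I_def table_def I0_def row_Suc)
    have "ok (For ''i'' (Nv ''n'') table_row) s2 (200 * ((n + 1) * (m + 1))) (I n)"
    proof (rule ok_For[where T = "120 * (m + 1)"])
      fix i s'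
      assume i: "i < n" and ag: "agree (insert ''i'' (nmods table_row)) (rmods table_row) s2 s'"
        and si: "nmem s' ''i'' 0 = i" and I: "I i s'"
      have s': "env \<sigma> s'" "nmem s' ''q'' = q" using env_agree[OF ag s2(1)] agreeN[OF ag] s2 by simp_all
      show "ok table_row s' (120 * (m + 1))
        (\<lambda>s''. I (Suc i) (s''\<lparr>nmem := (nmem s'')(''i'' := (nmem s'' ''i'')(0 := Suc i))\<rparr>))"
        unfolding table_row_def
      proof (rule ok_Seq)
        show "ok (For ''v'' (NAdd (Nv ''m'') (NConst 1)) table_body) s' (100 * (m + 1)) (J i (m + 1))"
        proof (rule ok_For[where T = 70])
          fix v t
          assume v: "v < m + 1" and ag2: "agree (insert ''v'' (nmods table_body)) (rmods table_body) s' t"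
            and tv: "nmem t ''v'' 0 = v" and J: "J i v t"
          have t: "env \<sigma> t" "nmem t ''q'' = q" "nmem t ''i'' 0 = i"
            using env_agree[OF ag2 s'(1)] agreeN[OF ag2] s' si by simp_all
          have rb: "nmem t ''rb'' 0 = row i" and rc: "nmem t ''rc'' 0 = row (Suc i)"
            using J by (auto simp: J_def I_def)
          have tab: "rmem t ''D'' (row i' + v') = min_weight q i' v'" if "i' \<le> i" "v' \<le> m" for i' v'
            using J that by (simp add: J_def I_def table_def)
          have old: "rmem t ''D'' (row (Suc i) + v') = min_weight q (Suc i) v'" if "v' < v" for v'
            using J that by (simp add: J_def)
          define t' where "t' = run table_body t"
          have D': "rmem t' ''D'' = (rmem t ''D'')(row (Suc i) + v := min_weight q (Suc i) v)"
          proof -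
            have "rmem t ''D'' (row i + v) = min_weight q i v" "rmem t ''D'' (row i + (v - q i)) = min_weight q i (v - q i)"
              using v tab[of i] by simp_all
            then show ?thesis
              using i unfolding t'_def table_body_def Let_def
              by (simp add: rb rc t tv envD[OF t(1)] not_less del: diff_add_assoc2 diff_add_assoc add_diff_assoc)
          qed
          have N': "nmem t' = nmem t" by (simp add: t'_def table_body_def Let_def)
          have "J i (Suc v) (t'\<lparr>nmem := (nmem t')(''v'' := (nmem t' ''v'')(0 := Suc v))\<rparr>)"
          proof -
            have "table q i t'"
              unfolding table_def
            proof (intro allI impI)
              fix i' v' assume "i' \<le> i" "v' \<le> m"
              then show "rmem t' ''D'' (row i' + v') = min_weight q i' v'"
                using row_less[of i' i v'] tab[of i' v'] by (simp add: D')
            qed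
            moreover have "rmem t' ''D'' (row (Suc i) + v') = min_weight q (Suc i) v'" if "v' < Suc v" for v'
              using old[of v'] that by (cases "v' = v") (simp_all add: D')
            ultimately show ?thesis using rb rc by (simp add: J_def I_def N' table_def)
          qed
          then show "ok table_body t 70
            (\<lambda>s''. J i (Suc v) (s''\<lparr>nmem := (nmem s'')(''v'' := (nmem s'' ''v'')(0 := Suc v))\<rparr>))"
            unfolding t'_def by (intro ok_run) (assumption | simp add: table_body_def Let_def)+
        next
          show "J i 0 (s'\<lparr>nmem := (nmem s')(''v'' := (nmem s' ''v'')(0 := 0))\<rparr>)" using I by (simp add: J_def I_def table_def)
        qed (use s' in \<open>auto simp: env_def agreeN algebra_simps\<close>)
      next
        fix t assume J: "J i (m + 1) t" and ag2: "agree (nmods (For ''v'' (NAdd (Nv ''m'') (NConst 1)) table_body))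
          (rmods (For ''v'' (NAdd (Nv ''m'') (NConst 1)) table_body)) s' t"
        have t: "env \<sigma> t" using env_agree[OF ag2 s'(1)] by simp
        have "table q (Suc i) t" using J by (auto simp: J_def I_def table_def le_Suc_eq less_Suc_eq_le)
        then show "ok (Seq (Nlet ''rb'' (Nv ''rc'')) (Nlet ''rc'' (NAdd (Nv ''rc'') (NAdd (Nv ''m'') (NConst 1))))) t 20
          (\<lambda>s''. I (Suc i) (s''\<lparr>nmem := (nmem s'')(''i'' := (nmem s'' ''i'')(0 := Suc i))\<rparr>))"
          using J by (intro ok_run) (simp_all add: J_def I_def table_def envD[OF t] row_Suc)
      qed simp
    qed (use s2 in \<open>auto simp: env_def agreeN algebra_simps I_def table_def\<close>)
    then show "ok (Seq ?c (For ''i'' (Nv ''n'') table_row)) s1 (230 * ((n + 1) * (m + 1)))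
      (\<lambda>s'. table (nmem s ''q'') n s' \<and> nmem s' ''rb'' 0 = row n)"
      unfolding s2_def
      by (rule ok_Seq_run[rotated, OF ok_weaken]) (auto simp: I_def q_def)
  qed (simp add: algebra_simps)
qed

lemma ok_best:
  assumes env: "env \<sigma> s" and tab: "table q n s" and rb: "nmem s ''rb'' 0 = row n"
  shows "ok best_prog s (60 * (m + 1)) (\<lambda>s'. nmem s' ''V'' 0 \<le> m \<and> min_weight q n (nmem s' ''V'' 0) \<le> W \<and>
    (\<forall>v\<le>m. min_weight q n v \<le> W \<longrightarrow> v \<le> nmem s' ''V'' 0))"
proof -
  define I where "I v s' \<longleftrightarrow> nmem s' ''V'' 0 \<le> m \<and> (0 < v \<longrightarrow> min_weight q n (nmem s' ''V'' 0) \<le> W) \<and>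
    (\<forall>v'<v. min_weight q n v' \<le> W \<longrightarrow> v' \<le> nmem s' ''V'' 0)" for v and s' :: ram
  \<comment> \<open>The empty solution keeps column 0 within the capacity, so \<open>V\<close> is
    valid from the first iteration on.\<close>
  have zero: "min_weight q i 0 \<le> W" for i
    using min_weight_le[of i "\<lambda>_. 0" q] W_nonneg by simp
  define s1 where "s1 = run (Nlet ''V'' (NConst 0)) s"
  have s1: "env \<sigma> s1" "table q n s1" "nmem s1 ''rb'' 0 = row n" "nmem s1 ''V'' 0 = 0"
    using assms by (auto simp: s1_def env_def table_def)
  have "ok (For ''v'' (NAdd (Nv ''m'') (NConst 1)) best_body) s1 (50 * (m + 1)) (I (m + 1))"
  proof (rule ok_For[where T = 20])
    fix v s'
    assume v: "v < m + 1" and ag: "agree (insert ''v'' (nmods best_body)) (rmods best_body) s1 s'"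
      and sv: "nmem s' ''v'' 0 = v" and I: "I v s'"
    have s': "env \<sigma> s'" "rmem s' ''D'' = rmem s1 ''D''" "nmem s' ''rb'' 0 = row n"
      using env_agree[OF ag s1(1)] agreeN[OF ag] agreeR[OF ag] s1 by simp_all
    have D: "rmem s' ''D'' (row n + v) = min_weight q n v" using s1(2) s'(2) v by (simp add: table_def)
    have v0: "W < min_weight q n v \<Longrightarrow> 0 < v" using zero[of n] by (cases v) auto
    have "nmem (run best_body s') ''V'' 0 = (if W < min_weight q n v then nmem s' ''V'' 0 else v)"
      by (simp add: best_body_def sv envD[OF s'(1)] s'(3) D)
    then have "I (Suc v) (run best_body s')" using I v v0 by (auto simp: I_def less_Suc_eq)
    then have "I (Suc v) ((run best_body s')\<lparr>nmem := (nmem (run best_body s'))(''v'' := (nmem (run best_body s') ''v'')(0 := Suc v))\<rparr>)"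
      by (simp add: I_def)
    then show "ok best_body s' 20 (\<lambda>s''. I (Suc v) (s''\<lparr>nmem := (nmem s'')(''v'' := (nmem s'' ''v'')(0 := Suc v))\<rparr>))"
      by (intro ok_run) (assumption | simp add: best_body_def)+
  qed (use s1 in \<open>auto simp: env_def agreeN I_def\<close>)
  then show ?thesis
    unfolding best_prog_def s1_def
    by (rule ok_Seq_run[rotated, OF ok_weaken]) (auto simp: I_def less_Suc_eq_le)
qed

text \<open>Item y is taken iff row y + 1 strictly improves on row y in the current column.
  Optimality follows since the value collected is the last column within the capacity, and every
  competitor's column is within it too.\<close>

lemma ok_back:
  assumes env: "env \<sigma> s" and tab: "table q n s" and rb: "nmem s ''rb'' 0 = row n"
    and q: "nmem s ''q'' = q" and off: "nmem s ''off'' 0 = k"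
    and V: "nmem s ''V'' 0 \<le> m" "min_weight q n (nmem s ''V'' 0) \<le> W"
    and best: "\<And>v. v \<le> m \<Longrightarrow> min_weight q n v \<le> W \<Longrightarrow> v \<le> nmem s ''V'' 0"
  shows "ok back_prog s (100 * (n + 1)) (\<lambda>s'. optimal_rounded q (\<lambda>i. nmem s' ''x'' (k + i)) \<and>
    (\<forall>j<k. nmem s' ''x'' j = nmem s ''x'' j))"
proof -
  define X where "X s' i = nmem s' ''x'' (k + i)" for s' :: ram and i
  define V0 where "V0 = nmem s ''V'' 0"
  \<comment> \<open>After c rounds the last c items are decided, \<open>V\<close> is the rounded
    value still to be collected, and the entry for it is the weight set aside for the remaining
    items.\<close>
  define I where "I c s' \<longleftrightarrow> (\<forall>j<k. nmem s' ''x'' j = nmem s ''x'' j) \<and>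
    nmem s' ''rb'' 0 = row (n - c) \<and> nmem s' ''V'' 0 \<le> m \<and>
    (\<forall>j\<in>{n - c..<n}. X s' j \<in> {0, 1} \<and> (X s' j = 1 \<longrightarrow> 1 \<le> q j)) \<and>
    (\<Sum>j\<in>{n - c..<n}. q j * X s' j) + nmem s' ''V'' 0 = V0 \<and>
    (\<Sum>j\<in>{n - c..<n}. w j * real (X s' j)) + min_weight q (n - c) (nmem s' ''V'' 0) \<le> W" for c and s' :: ram
  have "ok back_prog s (100 * (n + 1)) (I n)"
    unfolding back_prog_def
  proof (rule ok_For[where T = 70])
    fix c t
    assume c: "c < n" and ag: "agree (insert ''i'' (nmods back_body)) (rmods back_body) s t"
      and tc: "nmem t ''i'' 0 = c" and I: "I c t"
    have t: "env \<sigma> t" "nmem t ''q'' = q" "nmem t ''off'' 0 = k" "rmem t ''D'' = rmem s ''D''"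
      using env_agree[OF ag env] agreeN[OF ag] agreeR[OF ag] q off by simp_all
    define y where "y = n - Suc c"
    have y: "n - c = Suc y" "n - Suc c = y" "y < n" using c by (auto simp: y_def)
    define v where "v = nmem t ''V'' 0"
    have vm: "v \<le> m" and trb: "nmem t ''rb'' 0 = row (Suc y)" using I by (auto simp: I_def v_def y)
    have D: "rmem t ''D'' (row i + u) = min_weight q i u" if "i \<le> n" "u \<le> m" for i u
      using tab t(4) that by (simp add: table_def)
    have D1: "rmem t ''D'' (row (Suc y) + v) = min_weight q (Suc y) v"
      and D2: "rmem t ''D'' (row y + v) = min_weight q y v"
      using D[of "Suc y" v] D[of y v] vm y by (simp_all del: min_weight.simps)
    have sub: "row (Suc y) - Suc m = row y" by (simp add: row_Suc)
    define b where "b \<longleftrightarrow> min_weight q (Suc y) v < min_weight q y v"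
    define t' where "t' = run back_body t"
    have t': "nmem t' ''x'' = (nmem t ''x'')(k + y := of_bool b)" "nmem t' ''rb'' 0 = row y"
      "nmem t' ''V'' 0 = (if b then v - q y else v)"
      unfolding t'_def back_body_def b_def
      by (simp_all add: t(2,3) tc trb envD[OF t(1)] y v_def[symmetric] D1 D2 sub del: mult_Suc min_weight.simps)
    have Xy: "X t' y = of_bool b" and Xj: "\<And>j. j \<noteq> y \<Longrightarrow> X t' j = X t j"
      by (auto simp: X_def t')
    \<comment> \<open>For \<open>q y = 0\<close> an improvement would mean that adding a positive
      weight decreases an entry; so only items of positive rounded profit are taken.\<close>
    have bq: "b \<Longrightarrow> q y \<le> v \<and> 1 \<le> q y \<and> min_weight q (Suc y) v = min_weight q y (v - q y) + w y"
      using w_pos[of y] y by (cases "q y") (auto simp: b_def split: if_splits)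
    have nb: "\<not> b \<Longrightarrow> min_weight q (Suc y) v = min_weight q y v" by (auto simp: b_def)
    have ivl: "{y..<n} = insert y {Suc y..<n}" using y by auto
    have sum: "(\<Sum>j\<in>{y..<n}. f j (X t' j)) = f y (of_bool b) + (\<Sum>j\<in>{Suc y..<n}. f j (X t j))"
      for f :: "nat \<Rightarrow> nat \<Rightarrow> 'c::comm_monoid_add"
    proof -
      have "(\<Sum>j\<in>{Suc y..<n}. f j (X t' j)) = (\<Sum>j\<in>{Suc y..<n}. f j (X t j))"
        by (rule sum.cong) (auto simp: Xj)
      then show ?thesis unfolding ivl by (subst sum.insert) (auto simp: Xy)
    qed
    have I': "\<forall>j<k. nmem t ''x'' j = nmem s ''x'' j"
      "\<forall>j\<in>{Suc y..<n}. X t j \<in> {0, 1} \<and> (X t j = 1 \<longrightarrow> 1 \<le> q j)"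
      "(\<Sum>j\<in>{Suc y..<n}. q j * X t j) + v = V0"
      "(\<Sum>j\<in>{Suc y..<n}. w j * real (X t j)) + min_weight q (Suc y) v \<le> W"
      using I unfolding I_def y v_def by auto
    have "I (Suc c) t'"
      unfolding I_def y
    proof (intro conjI)
      show "\<forall>j\<in>{y..<n}. X t' j \<in> {0, 1} \<and> (X t' j = 1 \<longrightarrow> 1 \<le> q j)"
        unfolding ivl using I'(2) bq by (auto simp: Xy Xj)
      show "(\<Sum>j\<in>{y..<n}. q j * X t' j) + nmem t' ''V'' 0 = V0"
        unfolding sum[of "\<lambda>j x. q j * x"] using I'(3) bq by (auto simp: t')
      show "(\<Sum>j\<in>{y..<n}. w j * real (X t' j)) + min_weight q y (nmem t' ''V'' 0) \<le> W"
        unfolding sum[of "\<lambda>j x. w j * real x"] using I'(4) bq nb by (cases b) (auto simp: t' simp del: min_weight.simps)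
    qed (use I' vm in \<open>auto simp: t'\<close>)
    then have "I (Suc c) (t'\<lparr>nmem := (nmem t')(''i'' := (nmem t' ''i'')(0 := Suc c))\<rparr>)"
      by (simp add: I_def X_def)
    then show "ok back_body t 70 (\<lambda>s''. I (Suc c) (s''\<lparr>nmem := (nmem s'')(''i'' := (nmem s'' ''i'')(0 := Suc c))\<rparr>))"
      unfolding t'_def by (intro ok_run) (assumption | simp add: back_body_def)+
  qed (use env V rb in \<open>auto simp: env_def agreeN I_def V0_def\<close>)
  then show ?thesis
  proof (rule ok_weaken)
    fix s' assume "I n s'"
    then have I: "\<forall>j<k. nmem s' ''x'' j = nmem s ''x'' j"
      "\<And>j. j < n \<Longrightarrow> X s' j \<in> {0, 1} \<and> (X s' j = 1 \<longrightarrow> 1 \<le> q j)"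
      "(\<Sum>j<n. q j * X s' j) + nmem s' ''V'' 0 = V0"
      "(\<Sum>j<n. w j * real (X s' j)) + min_weight q 0 (nmem s' ''V'' 0) \<le> W"
      by (auto simp: I_def atLeast0LessThan)
    have "0 \<le> (\<Sum>j<n. w j * real (X s' j))" using w_pos by (intro sum_nonneg) (auto simp: less_imp_le)
    \<comment> \<open>In row 0 any other column holds \<open>W + 1\<close>, which exceeds the
      capacity.\<close>
    then have "nmem s' ''V'' 0 = 0" using I(4) by (auto split: if_splits)
    then have q0: "(\<Sum>j<n. q j * X s' j) = V0" "(\<Sum>j<n. w j * real (X s' j)) \<le> W" using I by auto
    have "optimal_rounded q (X s')"
      unfolding optimal_rounded_def
    proof (intro conjI allI impI)
      show "binary (X s')" using I q0 by (simp add: binary_def)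
      fix z assume z: "binary z" "(\<Sum>i<n. q i * z i) \<le> m"
      then have "min_weight q n (\<Sum>i<n. q i * z i) \<le> W"
        using min_weight_le[of n z q] by (auto simp: binary_def)
      then show "(\<Sum>i<n. q i * z i) \<le> (\<Sum>i<n. q i * X s' i)" using best z q0 by (simp add: V0_def)
    qed (use I in auto)
    then show "optimal_rounded q (\<lambda>i. nmem s' ''x'' (k + i)) \<and> (\<forall>j<k. nmem s' ''x'' j = nmem s ''x'' j)"
      using I by (simp add: X_def[abs_def])
  qed simp
qed

end

section \<open>The sweep\<close>

text \<open>The point 0 starts the right half. As the search ends at 0 or 1 at the latest, no cell
  meets both halves in its interior.\<close>

definition step1 :: com where
  "step1 = Cond (RLess (Rv ''l'') (RConst 0)) (Seq (Rlet ''sg'' (RConst (-1))) (Rlet ''r'' (RConst 0)))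
     (Seq (Rlet ''sg'' (RConst 1)) (Rlet ''r'' (RConst 1)))"

definition step2 :: com where
  "step2 = Seq (Rlet ''r'' (Rv ''z'')) (Rlet ''e'' (Rv ''l''))"

definition step3 :: com where
  "step3 = Seq (Rlet ''Ul'' (Rv ''U'')) (Rlet ''e'' (Rv ''r''))"

definition step4 :: com where
  "step4 = Rlet ''Ur'' (Rv ''U'')"

definition step5 :: com where
  "step5 = Rlet ''e'' (RDiv (RAdd (Rv ''l'') (Rv ''z'')) (RConst 2))"

definition step6 :: com where
  "step6 = Seq (RSet ''t'' (Nv ''k'') (RDiv (Rv ''z'') (RSub (RConst 1) (RMul (Rv ''sg'') (Rv ''z'')))))
     (Seq (Nlet ''k'' (NAdd (Nv ''k'') (NConst 1))) (Seq (Nlet ''off'' (NAdd (Nv ''off'') (Nv ''n'')))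
       (Rlet ''l'' (Rv ''z''))))"

definition step_prog :: com where
  "step_prog = Seq step1 (Seq order_prog (Seq step2 (Seq bound_prog (Seq step3 (Seq bound_prog
     (Seq step4 (Seq level_prog (Seq step5 (Seq bound_prog (Seq round_prog (Seq table_prog
     (Seq best_prog (Seq back_prog step6)))))))))))))"

text \<open>The real copy of n and the least m with \<open>2 * n \<le> m * eps\<close> are found by
  counting, for lack of conversion and rounding. Only the weight of the dummy item is written; its
  profit is 0 in the input already.\<close>

definition init_prog :: com where
  "init_prog = Seq (RSet ''w'' (Nv ''n'') (RConst 1))
     (Seq (For ''i'' (Nv ''n'') (Rlet ''nr'' (RAdd (Rv ''nr'') (RConst 1))))
     (Seq (Seq (Nlet ''m'' (NConst 1)) (Seq (Rlet ''mr'' (RConst 1)) (Rlet ''l'' (RConst (-1)))))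
       (While (RLess (RMul (Rv ''mr'') (Rv ''eps'')) (RMul (RConst 2) (Rv ''nr'')))
         (Seq (Nlet ''m'' (NAdd (Nv ''m'') (NConst 1))) (Rlet ''mr'' (RAdd (Rv ''mr'') (RConst 1)))))))"

text \<open>The breakpoint stored for the last cell (a division by \<open>1 - \<bar>1\<bar> = 0\<close>) is junk, and the final decrement
  of \<open>k\<close> drops it.\<close>

definition sweep_prog :: com where
  "sweep_prog = Seq init_prog (Seq (While (RLess (Rv ''l'') (RConst 1)) step_prog)
     (Nlet ''k'' (NSub (Nv ''k'') (NConst 1))))"

lemma okE:
  assumes "ok c s T Q"
  obtains t s' where "exec c s t s'" "t \<le> T" "Q s'" "agree (nmods c) (rmods c) s s'"
  using assms exec_agree unfolding ok_def by blast

lemma chain_le: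
  fixes zs :: "nat \<Rightarrow> real"
  assumes "\<And>j. j < k \<Longrightarrow> zs j < zs (Suc j)" "i \<le> j" "j \<le> k"
  shows "zs i \<le> zs j"
  using assms(2,3)
proof (induction j rule: dec_induct)
  case (step j)
  then show ?case using assms(1)[of j] by simp
qed simp

context sweep begin

text \<open>Both ends are included, so it does not matter to which neighbour a breakpoint is
  assigned. Comparing with a maximal \<open>x'\<close> keeps the statement within the scaled
  problem.\<close>

definition good :: "real \<Rightarrow> real \<Rightarrow> real \<Rightarrow> (nat \<Rightarrow> nat) \<Rightarrow> bool" where
  "good \<epsilon> l z x \<longleftrightarrow> binary x \<and> (\<exists>\<sigma>. \<forall>y\<in>{l..z}. \<bar>y\<bar> = \<sigma> * y \<and>
     (\<forall>x'. binary x' \<longrightarrow> (\<forall>x''. binary x'' \<longrightarrow> val \<sigma> y x'' \<le> val \<sigma> y x') \<longrightarrow>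
        (1 - \<epsilon>) * val \<sigma> y x' \<le> val \<sigma> y x))"

text \<open>Up to constants this bounds the cost of one step as well as the number of steps; hence
  the square in the total.\<close>

abbreviation work :: nat where "work \<equiv> (n + 1) * (n + m + 1)"

lemma ok_step:
  assumes env: "env (rmem s ''sg'' 0) s" and l: "rmem s ''l'' 0 = l" "-1 \<le> l" "l < 1"
    and eps: "2 * real n \<le> \<epsilon> * real m" and off: "nmem s ''off'' 0 = k"
  shows "ok step_prog s (6000 * work) (\<lambda>s'. env (rmem s' ''sg'' 0) s' \<and> l < rmem s' ''l'' 0 \<and>
    rmem s' ''l'' 0 \<le> 1 \<and> rmem s' ''l'' 0 \<in> events \<and> nmem s' ''off'' 0 = k + n \<and>
    nmem s' ''k'' 0 = Suc (nmem s ''k'' 0) \<and>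
    rmem s' ''t'' = (rmem s ''t'')(nmem s ''k'' 0 := rmem s' ''l'' 0 / (1 - \<bar>rmem s' ''l'' 0\<bar>)) \<and>
    (\<forall>j<k. nmem s' ''x'' j = nmem s ''x'' j) \<and> good \<epsilon> l (rmem s' ''l'' 0) (\<lambda>i. nmem s' ''x'' (k + i)))"
proof -
  define \<sigma> :: real where "\<sigma> = (if l < 0 then -1 else 1)"
  define r0 :: real where "r0 = (if l < 0 then 0 else 1)"
  have lr0: "l < r0" using l by (auto simp: r0_def)
  define s1 where "s1 = run step1 s"
  obtain t1 where x1: "exec step1 s t1 s1" "t1 \<le> 30"
    using exec_run[of step1 s] by (auto simp: s1_def step1_def)
  have f1: "env \<sigma> s1" "rmem s1 ''l'' 0 = l" "rmem s1 ''r'' 0 = r0" "nmem s1 = nmem s" "rmem s1 ''t'' = rmem s ''t''"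
    using env l by (auto simp: s1_def step1_def env_def \<sigma>_def r0_def)
  obtain t2 s2 where x2: "exec order_prog s1 t2 s2" "t2 \<le> 600 * ((n + 1) * (n + 1))"
    and ne2: "next_event l r0 ((\<lambda>(i, j). order_diff \<sigma> i j) ` ({..n} \<times> {..n})) (rmem s2 ''z'' 0)"
    and ag2: "agree (nmods order_prog) (rmods order_prog) s1 s2"
    by (rule okE[OF ok_order[OF f1(1-3) lr0]])
  \<comment> \<open>Up to \<open>r\<close> the ratios keep their order, so \<open>U\<close> is
    affine there and its two end values suffice to locate all level crossings.\<close>
  define r where "r = rmem s2 ''z'' 0"
  have f2: "env \<sigma> s2" "rmem s2 ''l'' 0 = l" "rmem s2 ''t'' = rmem s ''t''" "nmem s2 ''off'' = nmem s ''off''"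
    "nmem s2 ''k'' = nmem s ''k''" "nmem s2 ''x'' = nmem s ''x''"
    using env_agree[OF ag2 f1(1)] agreeR[OF ag2] agreeN[OF ag2] f1 by simp_all
  have lr: "l < r" "r \<le> r0" using ne2 by (auto simp: next_event_def r_def)
  define s3 where "s3 = run step2 s2"
  obtain t3 where x3: "exec step2 s2 t3 s3" "t3 \<le> 30"
    using exec_run[of step2 s2] by (auto simp: s3_def step2_def)
  have f3: "env \<sigma> s3" "rmem s3 ''e'' 0 = l" "rmem s3 ''l'' 0 = l" "rmem s3 ''r'' 0 = r" "rmem s3 ''t'' = rmem s ''t''"
    "nmem s3 ''off'' = nmem s ''off''" "nmem s3 ''k'' = nmem s ''k''" "nmem s3 ''x'' = nmem s ''x''"
    using f2 by (auto simp: s3_def step2_def env_def r_def)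
  obtain t4 s4 where x4: "exec bound_prog s3 t4 s4" "t4 \<le> 400 * ((n + 1) * (n + 1))"
    and U4: "rmem s4 ''U'' 0 = U \<sigma> l"
    and ag4: "agree (nmods bound_prog) (rmods bound_prog) s3 s4"
    by (rule okE[OF ok_bound[OF f3(1-2)]])
  have f4: "env \<sigma> s4" "rmem s4 ''l'' 0 = l" "rmem s4 ''r'' 0 = r" "rmem s4 ''t'' = rmem s ''t''"
    "nmem s4 ''off'' = nmem s ''off''" "nmem s4 ''k'' = nmem s ''k''" "nmem s4 ''x'' = nmem s ''x''"
    using env_agree[OF ag4 f3(1)] agreeR[OF ag4] agreeN[OF ag4] f3 by simp_all
  define s5 where "s5 = run step3 s4"
  obtain t5 where x5: "exec step3 s4 t5 s5" "t5 \<le> 30"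
    using exec_run[of step3 s4] by (auto simp: s5_def step3_def)
  have f5: "env \<sigma> s5" "rmem s5 ''e'' 0 = r" "rmem s5 ''l'' 0 = l" "rmem s5 ''r'' 0 = r" "rmem s5 ''t'' = rmem s ''t''"
    "nmem s5 ''off'' = nmem s ''off''" "nmem s5 ''k'' = nmem s ''k''" "nmem s5 ''x'' = nmem s ''x''"
    "rmem s5 ''Ul'' 0 = U \<sigma> l"
    using f4 U4 by (auto simp: s5_def step3_def env_def)
  obtain t6 s6 where x6: "exec bound_prog s5 t6 s6" "t6 \<le> 400 * ((n + 1) * (n + 1))"
    and U6: "rmem s6 ''U'' 0 = U \<sigma> r"
    and ag6: "agree (nmods bound_prog) (rmods bound_prog) s5 s6"
    by (rule okE[OF ok_bound[OF f5(1-2)]])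
  have f6: "env \<sigma> s6" "rmem s6 ''l'' 0 = l" "rmem s6 ''r'' 0 = r" "rmem s6 ''t'' = rmem s ''t''"
    "nmem s6 ''off'' = nmem s ''off''" "nmem s6 ''k'' = nmem s ''k''" "nmem s6 ''x'' = nmem s ''x''"
    "rmem s6 ''Ul'' 0 = U \<sigma> l"
    using env_agree[OF ag6 f5(1)] agreeR[OF ag6] agreeN[OF ag6] f5 by simp_all
  define s7 where "s7 = run step4 s6"
  obtain t7 where x7: "exec step4 s6 t7 s7" "t7 \<le> 30"
    using exec_run[of step4 s6] by (auto simp: s7_def step4_def)
  have f7: "env \<sigma> s7" "rmem s7 ''l'' 0 = l" "rmem s7 ''r'' 0 = r" "rmem s7 ''t'' = rmem s ''t''"
    "nmem s7 ''off'' = nmem s ''off''" "nmem s7 ''k'' = nmem s ''k''" "nmem s7 ''x'' = nmem s ''x''"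
    "rmem s7 ''Ul'' 0 = U \<sigma> l" "rmem s7 ''Ur'' 0 = U \<sigma> r"
    using f6 U6 by (auto simp: s7_def step4_def env_def)
  obtain t8 s8 where x8: "exec level_prog s7 t8 s8" "t8 \<le> 600 * ((n + 1) * (m + 1))"
    and ne8: "next_event l r ((\<lambda>(i, k). level_diff \<sigma> i k) ` ({..<n} \<times> {1..m})) (rmem s8 ''z'' 0)"
    and ag8: "agree (nmods level_prog) (rmods level_prog) s7 s8"
    by (rule okE[OF ok_level[OF f7(1-3) lr(1) f7(8,9)]])
  define z where "z = rmem s8 ''z'' 0"
  have f8: "env \<sigma> s8" "rmem s8 ''l'' 0 = l" "rmem s8 ''t'' = rmem s ''t''"
    "nmem s8 ''off'' = nmem s ''off''" "nmem s8 ''k'' = nmem s ''k''" "nmem s8 ''x'' = nmem s ''x''"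
    using env_agree[OF ag8 f7(1)] agreeR[OF ag8] agreeN[OF ag8] f7 by simp_all
  have lz: "l < z" "z \<le> r" using ne8 by (auto simp: next_event_def z_def)
  define s9 where "s9 = run step5 s8"
  define c where "c = (l + z) / 2"
  obtain t9 where x9: "exec step5 s8 t9 s9" "t9 \<le> 30"
    using exec_run[of step5 s8] by (auto simp: s9_def step5_def)
  have f9: "env \<sigma> s9" "rmem s9 ''e'' 0 = c" "rmem s9 ''z'' 0 = z" "rmem s9 ''t'' = rmem s ''t''"
    "nmem s9 ''off'' = nmem s ''off''" "nmem s9 ''k'' = nmem s ''k''" "nmem s9 ''x'' = nmem s ''x''"
    using f8 by (auto simp: s9_def step5_def env_def z_def c_def)
  obtain t10 s10 where x10: "exec bound_prog s9 t10 s10" "t10 \<le> 400 * ((n + 1) * (n + 1))"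
    and U10: "rmem s10 ''U'' 0 = U \<sigma> c"
    and ag10: "agree (nmods bound_prog) (rmods bound_prog) s9 s10"
    by (rule okE[OF ok_bound[OF f9(1-2)]])
  have f10: "env \<sigma> s10" "rmem s10 ''e'' 0 = c" "rmem s10 ''z'' 0 = z" "rmem s10 ''t'' = rmem s ''t''"
    "nmem s10 ''off'' = nmem s ''off''" "nmem s10 ''k'' = nmem s ''k''" "nmem s10 ''x'' = nmem s ''x''"
    using env_agree[OF ag10 f9(1)] agreeR[OF ag10] agreeN[OF ag10] f9 by simp_all
  obtain t11 s11 where x11: "exec round_prog s10 t11 s11" "t11 \<le> 600 * ((n + 1) * (m + 1))"
    and q11: "rounded \<sigma> c (nmem s11 ''q'')"
    and ag11: "agree (nmods round_prog) (rmods round_prog) s10 s11"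
    by (rule okE[OF ok_round[OF f10(1-2) U10]])
  define q where "q = nmem s11 ''q''"
  have f11: "env \<sigma> s11" "rmem s11 ''z'' 0 = z" "rmem s11 ''t'' = rmem s ''t''"
    "nmem s11 ''off'' = nmem s ''off''" "nmem s11 ''k'' = nmem s ''k''" "nmem s11 ''x'' = nmem s ''x''"
    using env_agree[OF ag11 f10(1)] agreeR[OF ag11] agreeN[OF ag11] f10 by simp_all
  obtain t12 s12 where x12: "exec table_prog s11 t12 s12" "t12 \<le> 600 * ((n + 1) * (m + 1))"
    and tab12: "table q n s12 \<and> nmem s12 ''rb'' 0 = row n"
    and ag12: "agree (nmods table_prog) (rmods table_prog) s11 s12"
    by (rule okE[OF ok_table[OF f11(1)], folded q_def])
  have f12: "env \<sigma> s12" "rmem s12 ''z'' 0 = z" "rmem s12 ''t'' = rmem s ''t''"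
    "nmem s12 ''off'' = nmem s ''off''" "nmem s12 ''k'' = nmem s ''k''" "nmem s12 ''x'' = nmem s ''x''"
    "nmem s12 ''q'' = q"
    using env_agree[OF ag12 f11(1)] agreeR[OF ag12] agreeN[OF ag12] f11 by (simp_all add: q_def)
  obtain t13 s13 where x13: "exec best_prog s12 t13 s13" "t13 \<le> 60 * (m + 1)"
    and V13: "nmem s13 ''V'' 0 \<le> m \<and> min_weight q n (nmem s13 ''V'' 0) \<le> W \<and>
      (\<forall>v\<le>m. min_weight q n v \<le> W \<longrightarrow> v \<le> nmem s13 ''V'' 0)"
    and ag13: "agree (nmods best_prog) (rmods best_prog) s12 s13"
    using tab12 by (elim conjE) (rule okE[OF ok_best[OF f12(1)]])
  have f13: "env \<sigma> s13" "rmem s13 ''z'' 0 = z" "rmem s13 ''t'' = rmem s ''t''"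
    "nmem s13 ''off'' = nmem s ''off''" "nmem s13 ''k'' = nmem s ''k''" "nmem s13 ''x'' = nmem s ''x''"
    "nmem s13 ''q'' = q" "table q n s13" "nmem s13 ''rb'' 0 = row n" "nmem s13 ''off'' 0 = k"
    using env_agree[OF ag13 f12(1)] agreeR[OF ag13] agreeN[OF ag13] f12 tab12 off by (simp_all add: table_def)
  obtain t14 s14 where x14: "exec back_prog s13 t14 s14" "t14 \<le> 100 * (n + 1)"
    and X14: "optimal_rounded q (\<lambda>i. nmem s14 ''x'' (k + i)) \<and> (\<forall>j<k. nmem s14 ''x'' j = nmem s13 ''x'' j)"
    and ag14: "agree (nmods back_prog) (rmods back_prog) s13 s14"
    using V13 by (elim conjE) (rule okE[OF ok_back[OF f13(1,8,9,7,10)]], auto)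
  have f14: "env \<sigma> s14" "rmem s14 ''z'' 0 = z" "rmem s14 ''t'' = rmem s ''t''"
    "nmem s14 ''off'' 0 = k" "nmem s14 ''k'' = nmem s ''k''"
    using env_agree[OF ag14 f13(1)] agreeR[OF ag14] agreeN[OF ag14] f13 by simp_all
  define s15 where "s15 = run step6 s14"
  obtain t15 where x15: "exec step6 s14 t15 s15" "t15 \<le> 50"
    using exec_run[of step6 s14] by (auto simp: s15_def step6_def)
  have sg14: "rmem s14 ''sg'' 0 = \<sigma>" using f14(1) by (simp add: env_def)
  have abs: "\<bar>y\<bar> = \<sigma> * y" if "y \<in> {l..z}" for y
    using that lz lr l by (auto simp: \<sigma>_def r0_def split: if_splits)
  have f15: "env (rmem s15 ''sg'' 0) s15" "rmem s15 ''l'' 0 = z" "nmem s15 ''off'' 0 = k + n"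
    "nmem s15 ''k'' 0 = Suc (nmem s ''k'' 0)"
    "rmem s15 ''t'' = (rmem s ''t'')(nmem s ''k'' 0 := z / (1 - \<bar>z\<bar>))" "nmem s15 ''x'' = nmem s14 ''x''"
    using f14 abs[of z] lz sg14 by (auto simp: s15_def step6_def env_def)

  have os: "one_signed_on l r (order_diff \<sigma> i j)" if "i \<le> n" "j \<le> n" for i j
  proof (rule one_signed_on_crossing[OF interpolated_on_order_diff lr0])
    show "r \<le> crossing l r0 (order_diff \<sigma> i j)" using ne2 that by (auto simp: next_event_def r_def)
  qed
  have Ur: "interpolated_on l r (U \<sigma>)" using os lr by (intro interpolated_on_U) auto
  have Uz: "interpolated_on l z (U \<sigma>)" using interpolated_on_subinterval[OF Ur] lz lr by auto
  have ls: "one_signed_on l z (level_diff \<sigma> i k')" if "i < n" "k' \<in> {1..m}" for i k'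
  proof (rule one_signed_on_crossing[OF interpolated_on_level_diff[OF Ur] lr(1)])
    show "z \<le> crossing l r (level_diff \<sigma> i k')" using ne8 that by (force simp: next_event_def z_def)
  qed
  have gd: "good \<epsilon> l z (\<lambda>i. nmem s15 ''x'' (k + i))"
    unfolding good_def
  proof (intro conjI exI[of _ \<sigma>] ballI allI impI)
    have x: "optimal_rounded q (\<lambda>i. nmem s15 ''x'' (k + i))" using X14 f15 by simp
    then show "binary (\<lambda>i. nmem s15 ''x'' (k + i))" by (simp add: optimal_rounded_def)
    fix y assume y: "y \<in> {l..z}"
    show "\<bar>y\<bar> = \<sigma> * y" using y by (rule abs)
    fix x' assume "binary x'" "\<forall>x''. binary x'' \<longrightarrow> val \<sigma> y x'' \<le> val \<sigma> y x'"
    then show "(1 - \<epsilon>) * val \<sigma> y x' \<le> val \<sigma> y (\<lambda>i. nmem s15 ''x'' (k + i))"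
      using lz(1) q11 by (intro cell_approximation[OF lz(1) Uz ls _ _ _ x y eps, of c]) (auto simp: c_def q_def)
  qed
  \<comment> \<open>A stop is a level crossing, or else the end \<open>r\<close> of the range, which
    is an order crossing or the end of the half.\<close>
  have zev: "z \<in> events"
  proof -
    have sub: "half_events \<sigma> \<subseteq> events" by (auto simp: \<sigma>_def events_def)
    have "z = r \<or> z \<in> half_events \<sigma>"
      using ne8 level_crossing_event[OF Ur lr(1)] by (auto simp: next_event_def z_def)
    moreover have "r = r0 \<or> r \<in> half_events \<sigma>"
      using ne2 order_crossing_event[OF lr0] by (auto simp: next_event_def r_def)
    moreover have "r0 \<in> events" by (auto simp: r0_def events_def)
    ultimately show ?thesis using sub by auto
  qed
  have z1: "z \<le> 1" using lz lr by (auto simp: r0_def split: if_splits)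
  have ex: "exec step_prog s (t1 + (t2 + (t3 + (t4 + (t5 + (t6 + (t7 + (t8 + (t9 + (t10 + (t11 + (t12 + (t13 + (t14 + t15)))))))))))))) s15"
    unfolding step_prog_def
    by (intro exec_Seq[OF x1(1)] exec_Seq[OF x2(1)] exec_Seq[OF x3(1)] exec_Seq[OF x4(1)] exec_Seq[OF x5(1)]
        exec_Seq[OF x6(1)] exec_Seq[OF x7(1)] exec_Seq[OF x8(1)] exec_Seq[OF x9(1)] exec_Seq[OF x10(1)]
        exec_Seq[OF x11(1)] exec_Seq[OF x12(1)] exec_Seq[OF x13(1)] exec_Seq[OF x14(1)] x15(1))
  have A: "(n + 1) * (n + 1) \<le> work" "(n + 1) * (m + 1) \<le> work" "m + 1 \<le> work" "n + 1 \<le> work" "1 \<le> work"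
    by (simp_all add: algebra_simps)
  define Z where "Z = work"
  have B: "t2 \<le> 600 * Z" "t4 \<le> 400 * Z" "t6 \<le> 400 * Z" "t8 \<le> 600 * Z" "t10 \<le> 400 * Z" "t11 \<le> 600 * Z"
    "t12 \<le> 600 * Z" "t13 \<le> 60 * Z" "t14 \<le> 100 * Z" "1 \<le> Z"
    unfolding Z_def
    by (rule order_trans[OF x2(2)] order_trans[OF x4(2)] order_trans[OF x6(2)] order_trans[OF x8(2)]
        order_trans[OF x10(2)] order_trans[OF x11(2)] order_trans[OF x12(2)] order_trans[OF x13(2)]
        order_trans[OF x14(2)] A, (rule mult_le_mono2, rule A)?)+
  have "t1 + (t2 + (t3 + (t4 + (t5 + (t6 + (t7 + (t8 + (t9 + (t10 + (t11 + (t12 + (t13 + (t14 + t15))))))))))))) \<le> 6000 * work"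
    unfolding Z_def[symmetric] using x1(2) x3(2) x5(2) x7(2) x9(2) x15(2) B by linarith
  then show ?thesis
    unfolding ok_def using ex f15 lz z1 zev gd X14 f13(6) by (intro exI[of _ s15] exI conjI) auto
qed

text \<open>The witness \<open>zs\<close> lists the stops. The sign is read from the register
  because it is still 0 before the first step; each step sets it anew. The register
  \<open>off\<close> is kept since addresses cannot be multiplied.\<close>

definition sweep_inv :: "real \<Rightarrow> ram \<Rightarrow> bool" where
  "sweep_inv \<epsilon> s \<longleftrightarrow> env (rmem s ''sg'' 0) s \<and> rmem s ''l'' 0 \<le> 1 \<and> nmem s ''off'' 0 = nmem s ''k'' 0 * n \<and>
     (\<exists>zs. zs 0 = -1 \<and> zs (nmem s ''k'' 0) = rmem s ''l'' 0 \<and> (\<forall>j<nmem s ''k'' 0. zs j < zs (Suc j) \<and>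
        rmem s ''t'' j = zs (Suc j) / (1 - \<bar>zs (Suc j)\<bar>) \<and> good \<epsilon> (zs j) (zs (Suc j)) (\<lambda>i. nmem s ''x'' (j * n + i))))"

text \<open>Each step moves \<open>l\<close> to an event strictly to its right, so the number of
  events beyond \<open>l\<close> decreases; \<open>card_events\<close> bounds it by
  \<open>8 * work\<close>, and a step costs at most \<open>6000 * work\<close>.\<close>

lemma ok_sweep_loop:
  assumes eps: "2 * real n \<le> \<epsilon> * real m" and inv: "sweep_inv \<epsilon> s"
  shows "ok (While (RLess (Rv ''l'') (RConst 1)) step_prog) s (50000 * work\<^sup>2)
    (\<lambda>s'. sweep_inv \<epsilon> s' \<and> rmem s' ''l'' 0 = 1)"
proof (rule ok_weaken)
  let ?\<mu> = "\<lambda>s. card {e \<in> events. rmem s ''l'' 0 < e}"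
  show "ok (While (RLess (Rv ''l'') (RConst 1)) step_prog) s
    ((1 + bcost (RLess (Rv ''l'') (RConst 1)) + 6000 * work) * ?\<mu> s + (1 + bcost (RLess (Rv ''l'') (RConst 1))))
    (\<lambda>s'. sweep_inv \<epsilon> s' \<and> \<not> bval (RLess (Rv ''l'') (RConst 1)) s')"
  proof (rule ok_While[where I = "sweep_inv \<epsilon>" and \<mu> = ?\<mu>])
    show "sweep_inv \<epsilon> s" by (rule inv)
    fix s assume inv: "sweep_inv \<epsilon> s" and b: "bval (RLess (Rv ''l'') (RConst 1)) s"
    define l where "l = rmem s ''l'' 0"
    define k where "k = nmem s ''k'' 0"
    obtain zs where zs: "zs 0 = -1" "zs k = l" "\<And>j. j < k \<Longrightarrow> zs j < zs (Suc j) \<and>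
        rmem s ''t'' j = zs (Suc j) / (1 - \<bar>zs (Suc j)\<bar>) \<and> good \<epsilon> (zs j) (zs (Suc j)) (\<lambda>i. nmem s ''x'' (j * n + i))"
      using inv unfolding sweep_inv_def l_def k_def by blast
    have env: "env (rmem s ''sg'' 0) s" and off: "nmem s ''off'' 0 = k * n"
      using inv by (auto simp: sweep_inv_def k_def)
    have l1: "-1 \<le> l" using chain_le[of k zs 0 k] zs by simp
    have l2: "l < 1" using b by (simp add: l_def)
    have "ok step_prog s (6000 * work) (\<lambda>s'. env (rmem s' ''sg'' 0) s' \<and> l < rmem s' ''l'' 0 \<and>
      rmem s' ''l'' 0 \<le> 1 \<and> rmem s' ''l'' 0 \<in> events \<and> nmem s' ''off'' 0 = k * n + n \<and>
      nmem s' ''k'' 0 = Suc k \<and>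
      rmem s' ''t'' = (rmem s ''t'')(k := rmem s' ''l'' 0 / (1 - \<bar>rmem s' ''l'' 0\<bar>)) \<and>
      (\<forall>j<k * n. nmem s' ''x'' j = nmem s ''x'' j) \<and> good \<epsilon> l (rmem s' ''l'' 0) (\<lambda>i. nmem s' ''x'' (k * n + i)))"
      unfolding k_def by (rule ok_step[OF env l_def[symmetric] l1 l2 eps off[unfolded k_def]])
    then show "ok step_prog s (6000 * work) (\<lambda>s'. sweep_inv \<epsilon> s' \<and> ?\<mu> s' < ?\<mu> s)"
    proof (rule ok_weaken)
      fix s' assume "env (rmem s' ''sg'' 0) s' \<and> l < rmem s' ''l'' 0 \<and>
        rmem s' ''l'' 0 \<le> 1 \<and> rmem s' ''l'' 0 \<in> events \<and> nmem s' ''off'' 0 = k * n + n \<and>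
        nmem s' ''k'' 0 = Suc k \<and>
        rmem s' ''t'' = (rmem s ''t'')(k := rmem s' ''l'' 0 / (1 - \<bar>rmem s' ''l'' 0\<bar>)) \<and>
        (\<forall>j<k * n. nmem s' ''x'' j = nmem s ''x'' j) \<and> good \<epsilon> l (rmem s' ''l'' 0) (\<lambda>i. nmem s' ''x'' (k * n + i))"
      then have s': "env (rmem s' ''sg'' 0) s'" "l < rmem s' ''l'' 0" "rmem s' ''l'' 0 \<le> 1" "rmem s' ''l'' 0 \<in> events"
        "nmem s' ''off'' 0 = k * n + n" "nmem s' ''k'' 0 = Suc k"
        "rmem s' ''t'' = (rmem s ''t'')(k := rmem s' ''l'' 0 / (1 - \<bar>rmem s' ''l'' 0\<bar>))"
        "\<And>j. j < k * n \<Longrightarrow> nmem s' ''x'' j = nmem s ''x'' j" "good \<epsilon> l (rmem s' ''l'' 0) (\<lambda>i. nmem s' ''x'' (k * n + i))"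
        by auto
      define zs' where "zs' = zs(Suc k := rmem s' ''l'' 0)"
      have "zs' j < zs' (Suc j) \<and> rmem s' ''t'' j = zs' (Suc j) / (1 - \<bar>zs' (Suc j)\<bar>) \<and>
        good \<epsilon> (zs' j) (zs' (Suc j)) (\<lambda>i. nmem s' ''x'' (j * n + i))" if j: "j < Suc k" for j
      proof (cases "j = k")
        case True
        then show ?thesis using s' zs(2) by (simp add: zs'_def)
      next
        case False
        then have jk: "j < k" using j by simp
        have "nmem s' ''x'' (j * n + i) = nmem s ''x'' (j * n + i)" if "i < n" for i
        proof (rule s'(8))
          have "j * n + i < Suc j * n" using that by simp
          also have "\<dots> \<le> k * n" using jk by (intro mult_le_mono1) simp
          finally show "j * n + i < k * n" .
        qed
        then have "good \<epsilon> (zs j) (zs (Suc j)) (\<lambda>i. nmem s' ''x'' (j * n + i)) \<longleftrightarrow>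
          good \<epsilon> (zs j) (zs (Suc j)) (\<lambda>i. nmem s ''x'' (j * n + i))"
          by (simp add: good_def binary_def val_def)
        then show ?thesis using zs(3)[OF jk] jk s'(7) by (simp add: zs'_def)
      qed
      then have "sweep_inv \<epsilon> s'"
        unfolding sweep_inv_def using s' zs(1) by (intro conjI exI[of _ zs']) (auto simp: zs'_def)
      moreover have "{e \<in> events. rmem s' ''l'' 0 < e} \<subset> {e \<in> events. rmem s ''l'' 0 < e}"
        using s'(2,4) by (auto simp: l_def)
      ultimately show "sweep_inv \<epsilon> s' \<and> ?\<mu> s' < ?\<mu> s"
        using card_events by (auto intro!: psubset_card_mono)
    qed simp
  qed
  have "?\<mu> s \<le> 8 * work" using card_mono[of events "{e \<in> events. rmem s ''l'' 0 < e}"] card_events by auto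
  then have "(5 + 6000 * work) * ?\<mu> s + 5 \<le> (5 + 6000 * work) * (8 * work) + 5"
    by (intro add_mono mult_le_mono2) auto
  also have "\<dots> \<le> (6005 * work) * (8 * work) + 5 * (work * work)"
    by (intro add_mono mult_le_mono1) (simp_all add: Suc_le_eq)
  also have "\<dots> \<le> 50000 * work\<^sup>2" unfolding power2_eq_square by (simp only: mult.assoc mult.left_commute[of work])
  finally show "(1 + bcost (RLess (Rv ''l'') (RConst 1)) + 6000 * work) * ?\<mu> s + (1 + bcost (RLess (Rv ''l'') (RConst 1)))
    \<le> 50000 * work\<^sup>2" by simp
  show "sweep_inv \<epsilon> s' \<and> rmem s' ''l'' 0 = 1"
    if "sweep_inv \<epsilon> s' \<and> \<not> bval (RLess (Rv ''l'') (RConst 1)) s'" for s'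
    using that by (auto simp: sweep_inv_def)
qed

end

section \<open>From cells to intervals of the parameter\<close>

text \<open>The inverse of the substitution. Its values never reach -1 or 1, which turns the first
  and the last cell into rays.\<close>

definition squeeze :: "real \<Rightarrow> real" where
  "squeeze l = l / (1 + \<bar>l\<bar>)"

lemma squeeze_bounds: "-1 < squeeze l" "squeeze l < 1"
  by (auto simp: squeeze_def field_simps)

lemma squeeze_less: "a < b \<Longrightarrow> squeeze a < squeeze b"
proof -
  assume ab: "a < b"
  \<comment> \<open>For equal signs the two sides coincide; otherwise the left side is at most 0 and
    the right side at least 0.\<close>
  have "a * \<bar>b\<bar> \<le> b * \<bar>a\<bar>"
    using ab mult_nonpos_nonneg[of a b] by (cases "0 \<le> a"; cases "0 \<le> b") (auto simp: mult_nonneg_nonpos)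
  then have "a * (1 + \<bar>b\<bar>) < b * (1 + \<bar>a\<bar>)" using ab by (simp add: distrib_left)
  then show ?thesis by (simp add: squeeze_def field_simps add_pos_nonneg)
qed

lemma squeeze_le_iff: "squeeze a \<le> squeeze b \<longleftrightarrow> a \<le> b"
  using squeeze_less[of a b] squeeze_less[of b a] by (cases a b rule: linorder_cases) auto

lemma squeeze_inverse: "-1 < y \<Longrightarrow> y < 1 \<Longrightarrow> squeeze (y / (1 - \<bar>y\<bar>)) = y"
proof -
  assume "-1 < y" "y < 1"
  then have "0 < 1 - \<bar>y\<bar>" by auto
  then show ?thesis by (simp add: squeeze_def abs_div field_simps)
qed

lemma squeeze_scale: "l * (1 - \<bar>squeeze l\<bar>) = squeeze l" "0 < 1 - \<bar>squeeze l\<bar>"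
proof -
  have "0 < 1 + \<bar>l\<bar>" by auto
  then show "l * (1 - \<bar>squeeze l\<bar>) = squeeze l" by (simp add: squeeze_def abs_div field_simps)
  show "0 < 1 - \<bar>squeeze l\<bar>" using squeeze_bounds[of l] by auto
qed

lemma partition_on_half_open_chain:
  fixes zs :: "nat \<Rightarrow> real"
  assumes zs: "\<And>j. j < K \<Longrightarrow> zs j < zs (Suc j)" and ends: "zs 0 = -1" "zs K = 1"
  defines "I j \<equiv> squeeze -` {zs j<..zs (Suc j)}"
  shows "partition_on UNIV (I ` {..<K})" "inj_on I {..<K}"
proof -
  have mono: "i \<le> j \<Longrightarrow> j \<le> K \<Longrightarrow> zs i \<le> zs j" for i j by (rule chain_le[of K zs]) (use zs in auto)
  have ne: "I j \<noteq> {}" if "j < K" for j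
  proof -
    define c where "c = (zs j + zs (Suc j)) / 2"
    have c: "zs j < c" "c < zs (Suc j)" using zs[OF that] by (auto simp: c_def)
    then have "-1 < c" "c < 1" using mono[of 0 j] mono[of "Suc j" K] ends that by auto
    then have "c / (1 - \<bar>c\<bar>) \<in> I j" using c by (simp add: I_def squeeze_inverse)
    then show ?thesis by blast
  qed
  have disj: "I i \<inter> I j = {}" if "i < j" "j < K" for i j
    using mono[of "Suc i" j] that by (fastforce simp: I_def)
  have disj': "I i \<inter> I j = {}" if "i \<noteq> j" "i < K" "j < K" for i j
    using disj[of i j] disj[of j i] that by (cases i j rule: linorder_cases) auto
  show "inj_on I {..<K}"
  proof (rule inj_onI)
    fix i j assume "i \<in> {..<K}" "j \<in> {..<K}" "I i = I j"
    then show "i = j" using ne[of i] disj'[of i j] by auto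
  qed
  have cover: "\<exists>j<K. l \<in> I j" for l
  proof -
    \<comment> \<open>The first stop at or beyond \<open>squeeze l\<close> is the right end of its
      cell, since cells contain their right but not their left end.\<close>
    define j where "j = (LEAST j. squeeze l \<le> zs j)"
    have K: "squeeze l \<le> zs K" using squeeze_bounds[of l] ends by simp
    have j: "squeeze l \<le> zs j" unfolding j_def using K by (rule LeastI)
    have jK: "j \<le> K" unfolding j_def using K by (rule Least_le)
    have "j \<noteq> 0" using j ends squeeze_bounds(1)[of l] by (metis not_le)
    then obtain i where i: "j = Suc i" by (cases j) auto
    have "\<not> squeeze l \<le> zs i" using not_less_Least[of i "\<lambda>j. squeeze l \<le> zs j"] i by (simp add: j_def[symmetric])
    then show ?thesis using j jK i by (intro exI[of _ i]) (auto simp: I_def)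
  qed
  show "partition_on UNIV (I ` {..<K})"
  proof (rule partition_onI)
    show "\<Union> (I ` {..<K}) = UNIV" using cover by blast
    show "{} \<notin> I ` {..<K}" using ne by blast
    show "disjnt p p'" if "p \<in> I ` {..<K}" "p' \<in> I ` {..<K}" "p \<noteq> p'" for p p'
    proof -
      obtain i j where "p = I i" "i < K" "p' = I j" "j < K" using \<open>p \<in> _\<close> \<open>p' \<in> _\<close> by auto
      then show ?thesis using disj'[of i j] \<open>p \<noteq> p'\<close> by (auto simp: disjnt_def)
    qed
  qed
qed

lemma is_interval_squeeze_vimage: "is_interval (squeeze -` {a<..b})"
  unfolding is_interval_1 using squeeze_le_iff
  by (auto simp: subset_iff) (meson less_le_trans order_trans)+

section \<open>Application of the sweep to a knapsack instance\<close>

locale instance_sweep = sweep +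
  fixes P :: knapsack and \<epsilon> :: real
  assumes n_eq: "n = items P" and W_eq: "W = real (capacity P)"
    and w_eq: "i < n \<Longrightarrow> w i = real (weight P i)" and a_eq: "i < n \<Longrightarrow> a i = real_of_int (icpt P i)"
    and b_eq: "i < n \<Longrightarrow> b i = real_of_int (slope P i)"
    \<comment> \<open>The lower bound on \<open>m\<close> gives the accuracy; the minimality that
      follows gives the running time.\<close>
    and m_ge: "2 * real n \<le> \<epsilon> * real m"
    and m_least: "1 \<le> k \<Longrightarrow> 2 * real n \<le> \<epsilon> * real k \<Longrightarrow> m \<le> k"
begin

lemma feasible_iff: "restrict x {..<n} \<in> feasible P \<longleftrightarrow> binary x"
proof -
  have "(\<Sum>i<n. w i * real (x i)) = real (\<Sum>i<n. weight P i * restrict x {..<n} i)"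
    by (simp add: w_eq)
  then have "(\<Sum>i<n. w i * real (x i)) \<le> W \<longleftrightarrow> (\<Sum>i<n. weight P i * restrict x {..<n} i) \<le> capacity P"
    unfolding W_eq by (simp only: of_nat_le_iff)
  then show ?thesis by (auto simp: feasible_def binary_def n_eq[symmetric])
qed

text \<open>The factor is positive and common to all solutions, so optimality and relative
  guarantees carry over.\<close>

lemma profit_scale:
  assumes "\<bar>squeeze l\<bar> = \<sigma> * squeeze l"
  shows "val \<sigma> (squeeze l) x = (1 - \<bar>squeeze l\<bar>) * profit P l (restrict x {..<n})"
proof -
  have "p \<sigma> (squeeze l) i = (1 - \<bar>squeeze l\<bar>) * (real_of_int (icpt P i) + l * real_of_int (slope P i))" if "i < n" for i
  proof -
    have "b i * squeeze l = b i * (l * (1 - \<bar>squeeze l\<bar>))" using squeeze_scale(1)[of l] by simp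
    then have "p \<sigma> (squeeze l) i = a i * (1 - \<bar>squeeze l\<bar>) + b i * (l * (1 - \<bar>squeeze l\<bar>))"
      using assms by (simp add: p_def)
    then show ?thesis using that by (simp add: a_eq b_eq algebra_simps)
  qed
  then show ?thesis
    unfolding val_def profit_def n_eq[symmetric] sum_distrib_left by (intro sum.cong) auto
qed

lemma good_approximation:
  assumes "good \<epsilon> l z x" "squeeze t \<in> {l..z}"
  shows "(1 - \<epsilon>) * opt_profit P t \<le> profit P t (restrict x {..<n})"
proof -
  define y where "y = squeeze t"
  obtain \<sigma> where abs: "\<bar>y\<bar> = \<sigma> * y" and ap: "\<And>x'. binary x' \<Longrightarrow> (\<And>x''. binary x'' \<Longrightarrow> val \<sigma> y x'' \<le> val \<sigma> y x') \<Longrightarrow>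
     (1 - \<epsilon>) * val \<sigma> y x' \<le> val \<sigma> y x"
    using assms unfolding good_def y_def by blast
  define u where "u = 1 - \<bar>y\<bar>"
  have u: "0 < u" using squeeze_scale(2)[of t] by (simp add: u_def y_def)
  have val: "val \<sigma> y x = u * profit P t (restrict x {..<n})" for x
    using profit_scale[of t \<sigma> x] abs by (simp add: y_def u_def)
  have "opt_profit P t \<in> profit P t ` feasible P"
    unfolding opt_profit_def by (intro Max_in) (simp_all add: finite_feasible feasible_nonempty)
  then obtain xo where xo: "xo \<in> feasible P" "opt_profit P t = profit P t xo" by auto
  have "xo \<in> {..<items P} \<rightarrow>\<^sub>E {0, 1}" using xo(1) unfolding feasible_def by blast
  then have r: "restrict xo {..<n} = xo" unfolding n_eq by (rule PiE_restrict)
  then have bo: "binary xo" using xo(1) feasible_iff[of xo] by simp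
  have "(1 - \<epsilon>) * val \<sigma> y xo \<le> val \<sigma> y x"
  proof (rule ap[OF bo])
    fix x'' assume "binary x''"
    then have "restrict x'' {..<n} \<in> feasible P" by (simp only: feasible_iff)
    then have "profit P t (restrict x'' {..<n}) \<in> profit P t ` feasible P" by (rule imageI)
    then have "profit P t (restrict x'' {..<n}) \<le> opt_profit P t"
      unfolding opt_profit_def by (rule Max_ge[OF finite_imageI[OF finite_feasible]])
    then show "val \<sigma> y x'' \<le> val \<sigma> y xo" unfolding val r xo(2) using u by (simp add: mult_left_mono)
  qed
  then have "u * ((1 - \<epsilon>) * opt_profit P t) \<le> u * profit P t (restrict x {..<n})"
    unfolding val r xo(2) by (simp add: mult.left_commute)
  then show ?thesis using u by simp
qed

lemma sweep_inv_approx_solution: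
  assumes inv: "sweep_inv \<epsilon> s" and l: "rmem s ''l'' 0 = 1"
  shows "approx_solution P \<epsilon> (output_solution P (run (Nlet ''k'' (NSub (Nv ''k'') (NConst 1))) s))"
    (is "approx_solution P \<epsilon> (output_solution P ?s)")
proof -
  define K where "K = nmem s ''k'' 0"
  obtain zs where zs: "zs 0 = -1" "zs K = 1" "\<And>j. j < K \<Longrightarrow> zs j < zs (Suc j)"
    "\<And>j. j < K \<Longrightarrow> rmem s ''t'' j = zs (Suc j) / (1 - \<bar>zs (Suc j)\<bar>)"
    "\<And>j. j < K \<Longrightarrow> good \<epsilon> (zs j) (zs (Suc j)) (\<lambda>i. nmem s ''x'' (j * n + i))"
    using inv l unfolding sweep_inv_def K_def by auto
  have K: "0 < K"
  proof (rule ccontr)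
    assume "\<not> 0 < K"
    then show False using zs(1,2) by simp
  qed
  define I where "I j = squeeze -` {zs j<..zs (Suc j)}" for j
  define X where "X j = (\<lambda>i\<in>{..<n}. nmem s ''x'' (j * n + i))" for j
  have s: "nmem ?s ''k'' 0 = K - 1" "nmem ?s ''x'' = nmem s ''x''" "rmem ?s = rmem s" by (simp_all add: K_def)
  have mono: "i \<le> j \<Longrightarrow> j \<le> K \<Longrightarrow> zs i \<le> zs j" for i j by (rule chain_le[of K zs]) (use zs in auto)
  have inner: "-1 < zs (Suc j) \<and> zs (Suc j) < 1" if "Suc j < K" for j
    using mono[of 0 j] mono[of "Suc (Suc j)" K] zs(1,2) zs(3)[of j] zs(3)[of "Suc j"] that by auto
  have t: "squeeze (rmem s ''t'' j) = zs (Suc j)" if "Suc j < K" for j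
    using squeeze_inverse[of "zs (Suc j)"] inner[OF that] zs(4)[of j] that by simp
  have ivl: "output_interval ?s j = I j" if j: "j < K" for j
  proof -
    have "(0 < j \<longrightarrow> rmem s ''t'' (j - 1) < u) \<longleftrightarrow> zs j < squeeze u" for u
    proof (cases j)
      case 0
      then show ?thesis using zs(1) squeeze_bounds(1)[of u] by simp
    next
      case (Suc i)
      then show ?thesis using t[of i] j squeeze_le_iff[of u "rmem s ''t'' i"] by (auto simp: not_le[symmetric])
    qed
    moreover have "(j < K - 1 \<longrightarrow> u \<le> rmem s ''t'' j) \<longleftrightarrow> squeeze u \<le> zs (Suc j)" for u
    proof (cases "j < K - 1")
      case True
      then show ?thesis using t[of j] squeeze_le_iff[of u "rmem s ''t'' j"] by auto
    next
      case False
      \<comment> \<open>The last cell has no upper breakpoint and ends at 1, which lies above every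
        value of \<open>squeeze\<close>; so neither side restricts \<open>u\<close>.\<close>
      then have "Suc j = K" using j by simp
      then show ?thesis using zs(2) squeeze_bounds(2)[of u] False by simp
    qed
    ultimately show ?thesis by (auto simp: output_interval_def I_def s K_def[symmetric])
  qed
  have "{..K - 1} = {..<K}" using K by auto
  then have out: "output_solution P ?s = (\<lambda>j. (I j, X j)) ` {..<K}"
    unfolding output_solution_def s(1,2) n_eq[symmetric] X_def by (intro image_cong) (simp_all only: ivl lessThan_iff)
  have fst: "fst ` (\<lambda>j. (I j, X j)) ` {..<K} = I ` {..<K}" by (simp add: image_image)
  note part = partition_on_half_open_chain[of K zs, OF zs(3,1,2), folded I_def]
  have "inj_on fst ((\<lambda>j. (I j, X j)) ` {..<K})"
    using part(2) by (auto simp: inj_on_def)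
  moreover have "is_interval (I j)" for j unfolding I_def by (rule is_interval_squeeze_vimage)
  moreover have "X j \<in> feasible P" if "j < K" for j
    using zs(5)[OF that] feasible_iff by (simp add: X_def good_def)
  moreover have "(1 - \<epsilon>) * opt_profit P u \<le> profit P u (X j)" if "j < K" "u \<in> I j" for j u
    unfolding X_def by (rule good_approximation[OF zs(5)[OF that(1)]]) (use that in \<open>auto simp: I_def\<close>)
  ultimately show ?thesis
    unfolding approx_solution_def out fst using part(1) by auto
qed

end

section \<open>Initialisation and total running time\<close>

context instance_sweep begin

lemma ok_init: "ok init_prog (input_state P \<epsilon>) (100 * work) (sweep_inv \<epsilon>)"
proof -
  define s0 where "s0 = input_state P \<epsilon>"
  define s1 where "s1 = run (RSet ''w'' (Nv ''n'') (RConst 1)) s0"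
  let ?body = "Rlet ''nr'' (RAdd (Rv ''nr'') (RConst 1))"
  let ?c = "Seq (Nlet ''m'' (NConst 1)) (Seq (Rlet ''mr'' (RConst 1)) (Rlet ''l'' (RConst (-1))))"
  let ?b = "RLess (RMul (Rv ''mr'') (Rv ''eps'')) (RMul (RConst 2) (Rv ''nr''))"
  let ?d = "Seq (Nlet ''m'' (NAdd (Nv ''m'') (NConst 1))) (Rlet ''mr'' (RAdd (Rv ''mr'') (RConst 1)))"
  define pre where "pre s \<longleftrightarrow> nmem s ''n'' 0 = n \<and> nmem s ''k'' 0 = 0 \<and> nmem s ''off'' 0 = 0 \<and>
    rmem s ''eps'' 0 = \<epsilon> \<and> rmem s ''W'' 0 = W \<and>
    (\<forall>i\<le>n. rmem s ''w'' i = w i \<and> rmem s ''a'' i = a i \<and> rmem s ''b'' i = b i)" for s :: ram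
  have pre1: "pre s1" "rmem s1 ''nr'' 0 = 0"
    by (auto simp: pre_def s1_def s0_def input_state_def W_eq w_eq a_eq b_eq n_eq[symmetric] w_n a_n b_n le_less)
  have count: "ok (For ''i'' (Nv ''n'') ?body) s1 (18 * n + 12) (\<lambda>s. rmem s ''nr'' 0 = real n)"
    by (rule ok_For[where I = "\<lambda>i s. rmem s ''nr'' 0 = real i" and T = 6])
      (use pre1 in \<open>auto simp: pre_def agreeN intro!: ok_run\<close>)
  have loop: "ok (Seq ?c (While ?b ?d)) s2 (40 * (m + 1)) (sweep_inv \<epsilon>)"
    if nr: "rmem s2 ''nr'' 0 = real n" and pre: "pre s2" for s2
  proof (rule ok_Seq_run)
    define s3 where "s3 = run ?c s2"
    define J where "J s \<longleftrightarrow> pre s \<and> rmem s ''nr'' 0 = real n \<and> rmem s ''l'' 0 = -1 \<and>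
      1 \<le> nmem s ''m'' 0 \<and> nmem s ''m'' 0 \<le> m \<and> rmem s ''mr'' 0 = real (nmem s ''m'' 0)" for s :: ram
    have "J s3" using nr pre m_pos by (auto simp: J_def s3_def pre_def)
    have "ok (While ?b ?d) s3 ((1 + bcost ?b + 12) * (m - nmem s3 ''m'' 0) + (1 + bcost ?b)) (\<lambda>s. J s \<and> \<not> bval ?b s)"
    proof (rule ok_While[where I = J and \<mu> = "\<lambda>s. m - nmem s ''m'' 0"])
      fix s assume J: "J s" and b: "bval ?b s"
      have "nmem s ''m'' 0 < m"
      proof (rule ccontr)
        assume "\<not> nmem s ''m'' 0 < m"
        then have "nmem s ''m'' 0 = m" using J by (simp add: J_def)
        then show False using b J m_ge by (simp add: J_def pre_def mult.commute)
      qed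
      then show "ok ?d s 12 (\<lambda>s'. J s' \<and> m - nmem s' ''m'' 0 < m - nmem s ''m'' 0)"
        using J by (intro ok_run) (auto simp: J_def pre_def)
    qed fact
    then show "ok (While ?b ?d) (run ?c s2) (25 * (m + 1)) (sweep_inv \<epsilon>)"
      unfolding s3_def
    proof (rule ok_weaken)
      fix s assume Js: "J s \<and> \<not> bval ?b s"
      then have "2 * real n \<le> \<epsilon> * real (nmem s ''m'' 0)" "1 \<le> nmem s ''m'' 0"
        by (auto simp: J_def pre_def mult.commute)
      then have "m \<le> nmem s ''m'' 0" by (intro m_least) auto
      then have "nmem s ''m'' 0 = m" using Js by (simp add: J_def)
      \<comment> \<open>No cell exists yet: with \<open>k = 0\<close> the chain of stops consists of
        -1 alone.\<close>
      then show "sweep_inv \<epsilon> s"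
        using Js by (auto simp: sweep_inv_def J_def pre_def env_def intro!: exI[of _ "\<lambda>_. -1"])
    qed simp
  qed auto
  have "ok (Seq (For ''i'' (Nv ''n'') ?body) (Seq ?c (While ?b ?d))) s1 (18 * n + 12 + 40 * (m + 1)) (sweep_inv \<epsilon>)"
  proof (rule ok_Seq[OF count loop])
    fix s2 assume "agree (nmods (For ''i'' (Nv ''n'') ?body)) (rmods (For ''i'' (Nv ''n'') ?body)) s1 s2"
    then show "pre s2" using pre1(1) by (simp add: pre_def agree_def)
  qed auto
  then show ?thesis
    unfolding init_prog_def s1_def s0_def
    by (rule ok_Seq_run[rotated]) (auto simp: algebra_simps)
qed

lemma ok_sweep:
  "ok sweep_prog (input_state P \<epsilon>) (60000 * work\<^sup>2) (\<lambda>s. approx_solution P \<epsilon> (output_solution P s))"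
  unfolding sweep_prog_def
proof (rule ok_Seq[OF ok_init])
  fix s assume "sweep_inv \<epsilon> s"
  then show "ok (Seq (While (RLess (Rv ''l'') (RConst 1)) step_prog) (Nlet ''k'' (NSub (Nv ''k'') (NConst 1)))) s
    (50000 * work\<^sup>2 + 6) (\<lambda>s. approx_solution P \<epsilon> (output_solution P s))"
  proof (rule ok_Seq[OF ok_sweep_loop[OF m_ge]])
    fix s' assume "sweep_inv \<epsilon> s' \<and> rmem s' ''l'' 0 = 1"
    then show "ok (Nlet ''k'' (NSub (Nv ''k'') (NConst 1))) s' 6 (\<lambda>s. approx_solution P \<epsilon> (output_solution P s))"
      using sweep_inv_approx_solution[of s'] by (intro ok_run) auto
  qed simp
next
  have "1 \<le> work" by simp
  then have "work \<le> work\<^sup>2" "1 \<le> work\<^sup>2" by (simp_all only: self_le_power one_le_power pos2)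
  then show "100 * work + (50000 * work\<^sup>2 + 6) \<le> 60000 * work\<^sup>2" by linarith
qed

text \<open>Minimality of \<open>m\<close> gives m \<le> 2 n / \<epsilon> + 1. By n \<ge> 1 and
  \<epsilon> < 1, both n and 1 are at most n / \<epsilon>, so the factors of \<open>work\<close> are
  at most 2 n and 5 n / \<epsilon>.\<close>

lemma work_bound:
  assumes eps: "0 < \<epsilon>" "\<epsilon> < 1" and n: "1 \<le> n"
  shows "real work \<le> 10 * (real n ^ 2 / \<epsilon>)"
proof -
  define X where "X = real n / \<epsilon>"
  have n1: "1 \<le> real n" using n by simp
  have nX: "real n \<le> X" using eps n1 by (simp add: X_def pos_le_divide_eq mult_left_le)
  have m: "real m \<le> 2 * X + 1"
  proof (cases "m = 1")
    case False
    then have "1 \<le> m - 1" using m_pos by simp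
    then have "\<epsilon> * real (m - 1) < 2 * real n" using m_least[of "m - 1"] m_pos by fastforce
    then have "real (m - 1) \<le> 2 * X" using eps by (simp add: X_def field_simps)
    then show ?thesis using m_pos by (simp add: of_nat_diff)
  qed (use nX n1 in simp)
  have "real work = (real n + 1) * (real n + real m + 1)" by (simp add: algebra_simps)
  also have "\<dots> \<le> (2 * real n) * (5 * X)" using n1 nX m by (intro mult_mono) auto
  also have "\<dots> = 10 * (real n ^ 2 / \<epsilon>)" by (simp add: X_def power2_eq_square)
  finally show ?thesis .
qed

end

theorem theorem2:
  "\<exists>(c :: com) (C :: real). \<forall>(P :: knapsack) (\<epsilon> :: real).
     knapsack_instance P \<longrightarrow> 0 < \<epsilon> \<longrightarrow> \<epsilon> < 1 \<longrightarrow>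
     (\<exists>t s. exec c (input_state P \<epsilon>) t s \<and>
            approx_solution P \<epsilon> (output_solution P s) \<and>
            (1 \<le> items P \<longrightarrow> real t \<le> C * real (items P) ^ 4 / \<epsilon>\<^sup>2))"
proof (intro exI[of _ sweep_prog] exI[of _ "6000000::real"] allI impI)
  fix P :: knapsack and \<epsilon> :: real
  assume inst: "knapsack_instance P" and eps: "0 < \<epsilon>" "\<epsilon> < 1"
  define n where "n = items P"
  define ok_m where "ok_m m \<longleftrightarrow> 1 \<le> m \<and> 2 * real n \<le> \<epsilon> * real m" for m :: nat
  define m where "m = (LEAST m. ok_m m)"
  obtain k :: nat where "2 * real n / \<epsilon> < real k" using reals_Archimedean2 by blast
  then have "2 * real n \<le> \<epsilon> * real (Suc k)" using eps by (simp add: field_simps)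
  then have "ok_m (Suc k)" by (simp add: ok_m_def)
  then have m: "ok_m m" unfolding m_def by (rule LeastI)
  have least: "m \<le> j" if "ok_m j" for j unfolding m_def using that by (rule Least_le)
  define w where "w i = (if i < n then real (weight P i) else 1)" for i
  define a where "a i = (if i < n then real_of_int (icpt P i) else 0)" for i
  define b where "b i = (if i < n then real_of_int (slope P i) else 0)" for i
  interpret instance_sweep n m "real (capacity P)" w a b P \<epsilon>
    by unfold_locales (use inst m least in \<open>auto simp: knapsack_instance_def w_def a_def b_def n_def ok_m_def\<close>)
  obtain t s where ts: "exec sweep_prog (input_state P \<epsilon>) t s" "t \<le> 60000 * work\<^sup>2"
    "approx_solution P \<epsilon> (output_solution P s)"
    using ok_sweep unfolding ok_def by blast
  \<comment> \<open>The constant is 60000 from \<open>ok_sweep\<close> times the square of the 10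
    from \<open>work_bound\<close>.\<close>
  have "real t \<le> 6000000 * real (items P) ^ 4 / \<epsilon>\<^sup>2" if "1 \<le> items P"
  proof -
    have "real t \<le> real (60000 * work\<^sup>2)" using ts(2) by (simp only: of_nat_le_iff)
    also have "\<dots> = 60000 * (real work)\<^sup>2" by (simp only: of_nat_mult of_nat_power of_nat_numeral)
    also have "\<dots> \<le> 60000 * (10 * (real n ^ 2 / \<epsilon>))\<^sup>2"
      using work_bound[OF eps] that by (intro mult_left_mono power_mono) (auto simp: n_def)
    also have "\<dots> = 6000000 * real (items P) ^ 4 / \<epsilon>\<^sup>2"
      by (simp add: n_def power_mult_distrib power_divide)
    finally show ?thesis .
  qed
  with ts show "\<exists>t s. exec sweep_prog (input_state P \<epsilon>) t s \<and> approx_solution P \<epsilon> (output_solution P s) \<and>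
    (1 \<le> items P \<longrightarrow> real t \<le> 6000000 * real (items P) ^ 4 / \<epsilon>\<^sup>2)" by blast
qed

end
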